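(* Let $X$ be a complex Hermitian vector space with $\dim_{\mathbf C}X=8$, Kähler form $\omega$ and holomorphic volume form $\Omega$, and let $X=X_1\oplus X_2$ be an orthogonal decomposition into complex $4$-dimensional subspaces with holomorphic volume forms $\Omega_1,\Omega_2$. Let \[ \Phi=\operatorname{Re}\Omega+\tfrac1{4!}\omega^4+\operatorname{Re}(\Omega_1+\Omega_2)\wedge\tfrac12\omega^2\in\bigwedge\nolimits^8X\cong\bigwedge\nolimits^8\mathbf R^{16}. \] If $\Phi_1,\Phi_2\in\bigwedge^8\mathbf R^{32}$ are orthogonally supported copies of $\Phi$, then their wedge product satisfies \[ \|\Phi_1\wedge\Phi_2\|\ \ge\ \frac{294}{256}\ >\ 1\ =\ \|\Phi_1\|\,\|\Phi_2\| . \]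
   Context: $\bigwedge^mV$ is the space of alternating real $m$-linear forms on a Euclidean space $V$; $\|\alpha\|=\sup\{\alpha(\xi)\}$, over simple $m$-vectors $\xi$ of Euclidean norm $1$, is the comass. The wedge product is normalized by $\alpha\wedge\beta=\frac{(k+l)!}{k!\,l!}\operatorname{Alt}(\alpha\otimes\beta)$, where $\operatorname{Alt}$ is the average of signed permutations; powers are wedge powers. For a Hermitian product $H$, conjugate linear in the first argument, $H=\langle\cdot,\cdot\rangle+\mathbf i\,\omega$ defines the Euclidean inner product and the Kähler form $\omega$. A holomorphic volume form on a complex $d$-dimensional Hermitian space is $Z_1\wedge\dots\wedge Z_d$ with $Z_1,\dots,Z_d$ the coordinate functions of a unitary basis; forms on $X_i$ are regarded as forms on $X$ via orthogonal projection. "Orthogonally supported copies" means that $\Phi_1$ and $\Phi_2$ are the pullbacks of $\Phi$ under the two projections $\mathbf R^{32}=\mathbf R^{16}\times\mathbf R^{16}\to\mathbf R^{16}$, with $\mathbf R^{16}$ identified isometrically with $X$. *)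

theory Defs
  imports "HOL-Analysis.Analysis" "HOL-Combinatorics.Permutations"
    "Jordan_Normal_Form.Determinant"
begin

text \<open>
  An \<open>m\<close>-form on \<open>'a\<close> is represented by a function \<open>\<alpha> :: (nat \<Rightarrow> 'a) \<Rightarrow> 'b\<close>; the value on
  \<open>(v\<^sub>0, \<dots>, v\<^sub>m\<^sub>-\<^sub>1)\<close> is \<open>\<alpha> v\<close>, and only the entries \<open>v i\<close> with \<open>i < m\<close> matter. The degree is not
  part of the representation, so the operations below take it as an explicit argument.
\<close>

type_synonym ('a, 'b) form = "(nat \<Rightarrow> 'a) \<Rightarrow> 'b"

definition tensor :: "nat \<Rightarrow> ('a, 'b::times) form \<Rightarrow> ('a, 'b) form \<Rightarrow> ('a, 'b) form" where
  "tensor k \<alpha> \<beta> = (\<lambda>v. \<alpha> v * \<beta> (\<lambda>i. v (k + i)))"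

definition Alt :: "nat \<Rightarrow> ('a, 'b::field_char_0) form \<Rightarrow> ('a, 'b) form" where
  "Alt m \<alpha> = (\<lambda>v. (\<Sum>p | p permutes {..<m}. of_int (sign p) * \<alpha> (v \<circ> p)) / fact m)"

definition wedge ::
    "nat \<Rightarrow> nat \<Rightarrow> ('a, 'b::field_char_0) form \<Rightarrow> ('a, 'b) form \<Rightarrow> ('a, 'b) form" where
  "wedge k l \<alpha> \<beta> = (\<lambda>v. fact (k + l) / (fact k * fact l) * Alt (k + l) (tensor k \<alpha> \<beta>) v)"

text \<open>\<open>wedge_power k \<alpha> n\<close> is the \<open>n\<close>-th wedge power of a \<open>k\<close>-form, a form of degree \<open>k * n\<close>.\<close>

primrec wedge_power :: "nat \<Rightarrow> ('a, 'b::field_char_0) form \<Rightarrow> nat \<Rightarrow> ('a, 'b) form" where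
  "wedge_power k \<alpha> 0 = (\<lambda>_. 1)"
| "wedge_power k \<alpha> (Suc n) = wedge (k * n) k (wedge_power k \<alpha> n) \<alpha>"

text \<open>\<open>wedge_covectors Z d\<close> is \<open>Z 0 \<and> \<dots> \<and> Z (d - 1)\<close>.\<close>

primrec wedge_covectors :: "(nat \<Rightarrow> 'a \<Rightarrow> 'b::field_char_0) \<Rightarrow> nat \<Rightarrow> ('a, 'b) form" where
  "wedge_covectors Z 0 = (\<lambda>_. 1)"
| "wedge_covectors Z (Suc n) = wedge n 1 (wedge_covectors Z n) (\<lambda>v. Z n (v 0))"

definition pullback :: "('a \<Rightarrow> 'c) \<Rightarrow> ('c, 'b) form \<Rightarrow> ('a, 'b) form" where
  "pullback f \<alpha> = (\<lambda>v. \<alpha> (f \<circ> v))"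

text \<open>
  The Euclidean norm of the simple \<open>m\<close>-vector \<open>v 0 \<and> \<dots> \<and> v (m - 1)\<close>, for the inner product
  \<open>\<langle>v\<^sub>0 \<and> \<dots> \<and> v\<^sub>m\<^sub>-\<^sub>1, w\<^sub>0 \<and> \<dots> \<and> w\<^sub>m\<^sub>-\<^sub>1\<rangle> = det (v\<^sub>i \<bullet> w\<^sub>j)\<close> on \<open>m\<close>-vectors.
\<close>

definition simple_norm :: "nat \<Rightarrow> (nat \<Rightarrow> 'a::real_inner) \<Rightarrow> real" where
  "simple_norm m v = sqrt (Determinant.det (Matrix.mat m m (\<lambda>(i, j). v i \<bullet> v j)))"

text \<open>
  The value of an alternating form \<open>\<alpha>\<close> on the simple \<open>m\<close>-vector \<open>v 0 \<and> \<dots> \<and> v (m - 1)\<close> is \<open>\<alpha> v\<close>.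
  For such \<open>\<alpha>\<close> the set below is bounded above, and it is nonempty if \<open>m \<le> DIM('a)\<close>; the
  supremum is unspecified otherwise.
\<close>

definition comass :: "nat \<Rightarrow> ('a::euclidean_space, real) form \<Rightarrow> real" where
  "comass m \<alpha> = Sup {\<alpha> v |v. simple_norm m v = 1}"

text \<open>Conjugate linearity of \<open>H\<close> in the first argument follows from \<open>H_commute\<close>.\<close>

locale hermitian_space = vector_space scaleC
  for scaleC :: "complex \<Rightarrow> 'a::ab_group_add \<Rightarrow> 'a" +
  fixes H :: "'a \<Rightarrow> 'a \<Rightarrow> complex"
  assumes H_add_right: "H x (y + z) = H x y + H x z"
    and H_scale_right: "H x (scaleC c y) = c * H x y"
    and H_commute: "H y x = cnj (H x y)"
    and H_pos: "x \<noteq> 0 \<Longrightarrow> Re (H x x) > 0"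
begin

definition euclidean_inner :: "'a \<Rightarrow> 'a \<Rightarrow> real" where
  "euclidean_inner x y = Re (H x y)"

definition kaehler_form :: "('a, real) form" where
  "kaehler_form = (\<lambda>v. Im (H (v 0) (v 1)))"

definition orthogonal_decomposition :: "'a set \<Rightarrow> 'a set \<Rightarrow> bool" where
  "orthogonal_decomposition W\<^sub>1 W\<^sub>2 \<longleftrightarrow>
     subspace W\<^sub>1 \<and> subspace W\<^sub>2 \<and> {x + y |x y. x \<in> W\<^sub>1 \<and> y \<in> W\<^sub>2} = UNIV \<and>
     (\<forall>x\<in>W\<^sub>1. \<forall>y\<in>W\<^sub>2. H x y = 0)"

definition orth_proj :: "'a set \<Rightarrow> 'a \<Rightarrow> 'a" where
  "orth_proj W x = (THE y. y \<in> W \<and> (\<forall>w\<in>W. H w (x - y) = 0))"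

definition unitary_basis :: "'a set \<Rightarrow> nat \<Rightarrow> (nat \<Rightarrow> 'a) \<Rightarrow> bool" where
  "unitary_basis W d e \<longleftrightarrow>
     (\<forall>i<d. \<forall>j<d. H (e i) (e j) = (if i = j then 1 else 0)) \<and> span (e ` {..<d}) = W"

definition coordinate :: "nat \<Rightarrow> (nat \<Rightarrow> 'a) \<Rightarrow> nat \<Rightarrow> 'a \<Rightarrow> complex" where
  "coordinate d e i x = representation (e ` {..<d}) x (e i)"

text \<open>
  A form on a subspace \<open>W\<close> is given by a function on all of \<open>nat \<Rightarrow> 'a\<close> whose values outside \<open>W\<close>
  are irrelevant.
\<close>

definition holomorphic_volume_form :: "'a set \<Rightarrow> nat \<Rightarrow> ('a, complex) form \<Rightarrow> bool" where
  "holomorphic_volume_form W d \<Omega> \<longleftrightarrow>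
     (\<exists>e. unitary_basis W d e \<and>
          (\<forall>v. (\<forall>i<d. v i \<in> W) \<longrightarrow> \<Omega> v = wedge_covectors (coordinate d e) d v))"

definition euclidean_identification :: "('e::real_inner \<Rightarrow> 'a) \<Rightarrow> bool" where
  "euclidean_identification \<iota> \<longleftrightarrow>
     Vector_Spaces.linear scaleR (\<lambda>r. scaleC (complex_of_real r)) \<iota> \<and> bij \<iota> \<and>
     (\<forall>x y. euclidean_inner (\<iota> x) (\<iota> y) = x \<bullet> y)"

end

end

theory Submission
  imports Defs
begin

text \<open>
  The comass bound. On an oriented 8-plane choose an orthonormal basis in which \<open>\<omega>\<close> is block diagonal, with
  entries \<open>c\<^sub>0, \<dots>, c\<^sub>3\<close>. Then \<open>w\<^sub>2\<^sub>k = u\<^sub>2\<^sub>k\<close> and \<open>w\<^sub>2\<^sub>k\<^sub>+\<^sub>1 = c\<^sub>k \<i> u\<^sub>2\<^sub>k + s\<^sub>k u\<^sub>2\<^sub>k\<^sub>+\<^sub>1\<close> for a unitary basis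
  \<open>u\<close> and \<open>c\<^sub>k\<^sup>2 + s\<^sub>k\<^sup>2 = 1\<close>, and \<open>\<bar>\<Phi>\<bar>\<close> is at most
  \<open>\<Prod>s + \<Prod>\<bar>c\<bar> + \<Sum> \<bar>c\<^sub>k c\<^sub>l\<bar> s\<^sub>i s\<^sub>j (A\<^sub>i\<^sub>j + A\<^sub>k\<^sub>l)\<close>, summed over the six ordered splittings of \<open>{0, 1, 2, 3}\<close>
  into pairs \<open>{i, j}\<close>, \<open>{k, l}\<close>, where \<open>A\<^sub>i\<^sub>j\<close> is the
  modulus of the \<open>4 \<times> 4\<close> minor of the first four coordinates at the columns of blocks \<open>i\<close> and \<open>j\<close> of \<open>u\<close>; the
  minor of the last four coordinates has modulus \<open>A\<^sub>k\<^sub>l\<close> because \<open>u\<close> is unitary. The key inequality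
  \<open>\<Sum> A\<^sub>i\<^sub>j \<le> 1\<close> holds for every \<open>4 \<times> 2n\<close> matrix with orthonormal rows, by induction on \<open>n\<close>: rotate the rows
  so that two of them vanish on the last block. It reduces the bound to
  \<open>(\<bar>c\<^sub>i c\<^sub>j\<bar> + s\<^sub>i s\<^sub>j) (\<bar>c\<^sub>k c\<^sub>l\<bar> + s\<^sub>k s\<^sub>l) \<le> 1\<close>. None of this depends on the phase between \<open>\<Omega>\<close> and \<open>\<Omega>\<^sub>1 \<and> \<Omega>\<^sub>2\<close>.

  The lower bound. Evaluate \<open>\<Phi>\<^sub>1 \<and> \<Phi>\<^sub>2\<close> on the diagonal \<open>{(x, x)}\<close>: the value is \<open>2\<^sup>-\<^sup>8\<close> times the coefficient of
  the volume form in \<open>\<Phi> \<and> \<Phi>\<close>, which is \<open>128 + 70 + 96 = 294\<close>, the contributions of the squares of the three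
  summands of \<open>\<Phi>\<close>.
\<close>

text \<open>Two mismatches shape the upper bound. The comass ranges over all tuples of Gram
  determinant 1, while the normal form needs orthonormal ones; and \<open>\<Phi>\<^sub>1\<close>
  sees a tuple of the 32-dimensional space only through a projection. Both are met by diagonalizing
  the pulled back inner product on the span of the tuple: the new orthonormal frame differs by a
  determinant of modulus 1, and its images are orthogonal of length at most 1, so multilinearity
  reduces to orthonormal images. The normal form itself comes from maximizing
  \<open>\<omega>\<close> over orthonormal pairs. A form is a bare function here, without degree or
  symmetry. Every form is therefore written as a sum of determinants of lists of covectors, for
  which the wedge product is concatenation. Signs and vanishing become statements about lists: even
  blocks commute, and a repeated letter gives 0. On a normal frame the letters are the dual
  covectors of the frame and the coordinates; for the self-wedge they are the coordinates and their
  conjugates, where each of the eight conjugate pairs contributes -2i, so that the basic value is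
  (-2i)^8 = 256.\<close>

no_notation Matrix.scalar_prod (infix "\<bullet>" 70)
hide_const (open) Matrix.orthogonal

section \<open>Forms as determinants of covectors\<close>

text \<open>The form \<open>zs ! 0 \<and> ... \<and> zs ! (n - 1)\<close> in the normalization of
  \<open>wedge\<close>. A list of covectors carries its own degree and turns the wedge product into
  \<open>@\<close>; only the first \<open>length zs\<close> vectors are read.\<close>

definition cdet :: "('a \<Rightarrow> 'b::comm_ring_1) list \<Rightarrow> ('a, 'b) form" where
  "cdet zs v = Determinant.det (Matrix.mat (length zs) (length zs) (\<lambda>(i, j). (zs ! i) (v j)))"

lemma cdet_perm_sum:
  "cdet zs v = (\<Sum>p | p permutes {..<length zs}. of_int (sign p) * (\<Prod>i<length zs. (zs ! i) (v (p i))))"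
proof -
  have "cdet zs v = (\<Sum>p | p permutes {0..<length zs}. of_int (sign p) *
      (\<Prod>i=0..<length zs. (zs ! i) (v (p i))))"
    unfolding cdet_def by (subst det_def') (auto intro!: sum.cong prod.cong simp: permutes_in_image[THEN iffD2])
  then show ?thesis by (simp add: atLeast0LessThan)
qed

lemma cdet_Nil [simp]: "cdet [] = (\<lambda>_. 1)"
  by (simp add: cdet_def fun_eq_iff)

lemma cdet_single [simp]: "cdet [z] v = z (v 0)"
  by (simp add: cdet_perm_sum lessThan_Suc permutes_sing)

lemma cdet_cong:
  assumes "\<And>j. j < length zs \<Longrightarrow> v j = w j"
  shows "cdet zs v = cdet zs w"
  unfolding cdet_def by (rule arg_cong[where f = Determinant.det]) (auto intro!: cong_mat simp: assms)

text \<open>Moves a permutation of the arguments of the second tensor factor to the positions that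
  these arguments occupy behind the first \<open>k\<close>.\<close>

definition shift_perm :: "nat \<Rightarrow> (nat \<Rightarrow> nat) \<Rightarrow> nat \<Rightarrow> nat" where
  "shift_perm k q i = (if i < k then i else k + q (i - k))"

lemma shift_perm:
  assumes "q permutes {..<l}"
  shows "shift_perm k q permutes {..<k + l}" "sign (shift_perm k q) = sign q"
proof -
  have inv: "inv_into {..<l} ((+) k) (k + x) = x" if "x < l" for x
    using that by (intro inv_into_f_f) auto
  have eq: "shift_perm k q = map_permutation {..<l} ((+) k) q"
  proof
    fix i
    show "shift_perm k q i = map_permutation {..<l} ((+) k) q i"
    proof (cases "k \<le> i \<and> i < k + l")
      case True
      then obtain x where x: "i = k + x" "x < l" by (metis le_iff_add nat_add_left_cancel_less)
      then show ?thesis by (auto simp: shift_perm_def map_permutation_def restrict_id_def inv)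
    next
      case False
      then have "i \<notin> (+) k ` {..<l}" by auto
      moreover have "shift_perm k q i = i"
        using False permutes_not_in[OF assms, of "i - k"] by (auto simp: shift_perm_def)
      ultimately show ?thesis by (auto simp: map_permutation_def restrict_id_def)
    qed
  qed
  have "map_permutation {..<l} ((+) k) q permutes (+) k ` {..<l}"
    by (rule map_permutation_permutes) (auto simp: assms intro: inj_imp_bij_betw_inv bij_betw_imageI)
  then show "shift_perm k q permutes {..<k + l}"
    unfolding eq by (rule permutes_subset) auto
  show "sign (shift_perm k q) = sign q"
    unfolding eq by (rule sign_map_permutation) (auto simp: assms)
qed

text \<open>Each of the two determinants expands over permutations, and a pair \<open>(p, q)\<close>
  acts on the \<open>k + l\<close> arguments as the single permutation
  \<open>p \<circ> shift_perm k q\<close>. Alternation absorbs it together with its sign, so all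
  \<open>k! l!\<close> pairs contribute the same determinant, and this is the factor that the
  normalization of \<open>wedge\<close> divides out.\<close>

lemma wedge_cdet:
  fixes zs ys :: "('a \<Rightarrow> 'b::field_char_0) list"
  shows "wedge (length zs) (length ys) (cdet zs) (cdet ys) = cdet (zs @ ys)"
proof
  fix v :: "nat \<Rightarrow> 'a"
  define k l n where "k = length zs" and "l = length ys" and "n = k + l"
  define T where "T u = (\<Prod>i<n. ((zs @ ys) ! i) (u i))" for u :: "nat \<Rightarrow> 'a"
  let ?S = "\<lambda>n. {p. p permutes {..<n}}"
  let ?s = "\<lambda>p. of_int (sign p) :: 'b"
  have cat: "cdet (zs @ ys) v = (\<Sum>r\<in>?S n. ?s r * T (v \<circ> r))"
    by (simp add: cdet_perm_sum T_def n_def k_def l_def)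
  have tens: "tensor k (cdet zs) (cdet ys) u = (\<Sum>p\<in>?S k. \<Sum>q\<in>?S l. ?s (p \<circ> shift_perm k q) * T (u \<circ> (p \<circ> shift_perm k q)))"
    for u
  proof -
    have "T (u \<circ> (p \<circ> shift_perm k q)) = (\<Prod>i<k. (zs ! i) (u (p i))) * (\<Prod>i<l. (ys ! i) (u (k + q i)))"
      if p: "p \<in> ?S k" and q: "q \<in> ?S l" for p q
    proof -
      have pk: "p (k + x) = k + x" for x
        using p permutes_not_in[of p "{..<k}" "k + x"] by auto
      have "{..<n} = {..<k} \<union> (+) k ` {..<l}"
        by (auto simp: n_def) (metis image_eqI le_iff_add lessThan_iff nat_add_left_cancel_less not_less)
      then have "T (u \<circ> (p \<circ> shift_perm k q)) =
          (\<Prod>i<k. ((zs @ ys) ! i) (u (p (shift_perm k q i)))) *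
          (\<Prod>i\<in>(+) k ` {..<l}. ((zs @ ys) ! i) (u (p (shift_perm k q i))))"
        unfolding T_def by (subst prod.union_disjoint[symmetric]) auto
      also have "(\<Prod>i<k. ((zs @ ys) ! i) (u (p (shift_perm k q i)))) = (\<Prod>i<k. (zs ! i) (u (p i)))"
        by (rule prod.cong) (auto simp: shift_perm_def k_def nth_append)
      also have "(\<Prod>i\<in>(+) k ` {..<l}. ((zs @ ys) ! i) (u (p (shift_perm k q i)))) = (\<Prod>i<l. (ys ! i) (u (k + q i)))"
        by (subst prod.reindex) (auto simp: shift_perm_def pk nth_append k_def[symmetric])
      finally show ?thesis .
    qed
    moreover have "?s (p \<circ> shift_perm k q) = ?s p * ?s q" if p: "p \<in> ?S k" and q: "q \<in> ?S l" for p q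
    proof -
      have "permutation p" using p permutation_permutes by blast
      moreover have "permutation (shift_perm k q)"
        using q shift_perm(1) permutation_permutes by blast
      ultimately show ?thesis using q by (simp add: sign_compose shift_perm(2))
    qed
    ultimately have "(\<Sum>p\<in>?S k. \<Sum>q\<in>?S l. ?s (p \<circ> shift_perm k q) * T (u \<circ> (p \<circ> shift_perm k q))) =
        (\<Sum>p\<in>?S k. \<Sum>q\<in>?S l. (?s p * (\<Prod>i<k. (zs ! i) (u (p i)))) * (?s q * (\<Prod>i<l. (ys ! i) (u (k + q i)))))"
      by (intro sum.cong refl) (simp add: mult_ac)
    also have "\<dots> = cdet zs u * cdet ys (\<lambda>i. u (k + i))"
      by (simp add: cdet_perm_sum k_def l_def sum_product)
    finally show ?thesis by (simp add: tensor_def)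
  qed
  have perm: "(\<Sum>r\<in>?S n. ?s r * (?s g * T (v \<circ> r \<circ> g))) = cdet (zs @ ys) v" if g: "g permutes {..<n}" for g
  proof -
    have "cdet (zs @ ys) v = (\<Sum>r\<in>?S n. ?s (r \<circ> g) * T (v \<circ> (r \<circ> g)))"
      unfolding cat by (rule sum_permutations_compose_right[OF g])
    also have "\<dots> = (\<Sum>r\<in>?S n. ?s r * (?s g * T (v \<circ> r \<circ> g)))"
    proof (intro sum.cong refl)
      fix r assume "r \<in> ?S n"
      then have "permutation r" "permutation g" using g permutation_permutes by blast+
      then show "?s (r \<circ> g) * T (v \<circ> (r \<circ> g)) = ?s r * (?s g * T (v \<circ> r \<circ> g))"
        by (simp add: sign_compose comp_assoc mult.assoc)
    qed
    finally show ?thesis by simp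
  qed
  have gp: "p \<circ> shift_perm k q permutes {..<n}" if "p \<in> ?S k" "q \<in> ?S l" for p q
    using that shift_perm(1)[of q l k] permutes_subset[of p "{..<k}" "{..<n}"]
    by (auto simp: n_def intro!: permutes_compose)
  have "(\<Sum>r\<in>?S n. ?s r * tensor k (cdet zs) (cdet ys) (v \<circ> r)) =
      (\<Sum>r\<in>?S n. \<Sum>p\<in>?S k. \<Sum>q\<in>?S l. ?s r * (?s (p \<circ> shift_perm k q) * T (v \<circ> r \<circ> (p \<circ> shift_perm k q))))"
    unfolding tens by (simp add: sum_distrib_left)
  also have "\<dots> = (\<Sum>p\<in>?S k. \<Sum>q\<in>?S l. \<Sum>r\<in>?S n. ?s r * (?s (p \<circ> shift_perm k q) * T (v \<circ> r \<circ> (p \<circ> shift_perm k q))))"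
    by (subst sum.swap, subst (2) sum.swap) simp
  also have "\<dots> = (\<Sum>p\<in>?S k. \<Sum>q\<in>?S l. cdet (zs @ ys) v)"
    by (intro sum.cong refl perm gp)
  also have "\<dots> = fact k * fact l * cdet (zs @ ys) v"
    by (simp add: card_permutations[OF refl])
  finally show "wedge (length zs) (length ys) (cdet zs) (cdet ys) v = cdet (zs @ ys) v"
    by (simp add: wedge_def Alt_def k_def[symmetric] l_def[symmetric] n_def[symmetric])
qed


section \<open>Bilinearity and locality of the wedge product, real and complex values\<close>

lemma wedge_add_left: "wedge k l (\<lambda>v. F v + G v) A = (\<lambda>v. wedge k l F A v + wedge k l G A v)"
  and wedge_add_right: "wedge k l A (\<lambda>v. F v + G v) = (\<lambda>v. wedge k l A F v + wedge k l A G v)"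
  by (simp_all add: wedge_def Alt_def tensor_def fun_eq_iff algebra_simps add_divide_distrib sum.distrib)

lemma wedge_scale_left: "wedge k l (\<lambda>v. c * F v) A = (\<lambda>v. c * wedge k l F A v)"
  and wedge_scale_right: "wedge k l A (\<lambda>v. c * F v) = (\<lambda>v. c * wedge k l A F v)"
  by (simp_all add: wedge_def Alt_def tensor_def fun_eq_iff sum_distrib_left mult_ac)

lemma wedge_zero_left: "wedge k l (\<lambda>v. 0) A = (\<lambda>v. 0)"
  and wedge_zero_right: "wedge k l A (\<lambda>v. 0) = (\<lambda>v. 0)"
  by (simp_all add: wedge_def Alt_def tensor_def fun_eq_iff)

lemma wedge_sum_left: "wedge k l (\<lambda>v. \<Sum>s\<in>S. F s v) A = (\<lambda>v. \<Sum>s\<in>S. wedge k l (F s) A v)"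
  by (induction S rule: infinite_finite_induct) (simp_all add: wedge_zero_left wedge_add_left)

lemma wedge_sum_right: "wedge k l A (\<lambda>v. \<Sum>s\<in>S. F s v) = (\<lambda>v. \<Sum>s\<in>S. wedge k l A (F s) v)"
  by (induction S rule: infinite_finite_induct) (simp_all add: wedge_zero_right wedge_add_right)

text \<open>\<open>wedge\<close> evaluates its factors only on rearrangements of \<open>v\<close>,
  so identities that hold just for frame vectors can be substituted. The second factor receives a
  shifted tuple, which also reaches entries of \<open>v\<close> beyond the degree; hence the range
  of all of \<open>v\<close>.\<close>

lemma wedge_cong:
  assumes "\<And>u. range u \<subseteq> range v \<Longrightarrow> F u = F' u" and "\<And>u. range u \<subseteq> range v \<Longrightarrow> G u = G' u"
  shows "wedge k l F G v = wedge k l F' G' v"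
proof -
  have "F (v \<circ> p) = F' (v \<circ> p)" "G (\<lambda>i. (v \<circ> p) (k + i)) = G' (\<lambda>i. (v \<circ> p) (k + i))" for p
    by (auto intro!: assms)
  then show ?thesis by (simp add: wedge_def Alt_def tensor_def)
qed

lemma wedge_power_cong:
  assumes "\<And>u. range u \<subseteq> range v \<Longrightarrow> F u = G u"
  shows "wedge_power k F n v = wedge_power k G n v"
  using assms
proof (induction n arbitrary: v)
  case (Suc n)
  have "wedge_power k F n u = wedge_power k G n u" if "range u \<subseteq> range v" for u
    using that Suc.prems by (intro Suc.IH) auto
  then show ?case by (auto intro!: wedge_cong Suc.prems)
qed simp

lemma of_real_wedge: "complex_of_real (wedge k l F G v) = wedge k l (\<lambda>u. of_real (F u)) (\<lambda>u. of_real (G u)) v"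
  by (simp add: wedge_def Alt_def tensor_def)

lemma of_real_wedge_power: "complex_of_real (wedge_power k F n v) = wedge_power k (\<lambda>u. of_real (F u)) n v"
proof (induction n arbitrary: v)
  case (Suc n)
  then show ?case by (simp add: of_real_wedge cong: wedge_cong)
qed simp

text \<open>Taking real parts is real linear, and the second factor supplies only real scalars. This
  lets the proof work with a complex form and take the real part last.\<close>

lemma Re_wedge_of_real: "Re (wedge k l F (\<lambda>u. of_real (G u)) v) = wedge k l (\<lambda>u. Re (F u)) G v"
proof -
  have "wedge k l F (\<lambda>u. complex_of_real (G u)) v =
      of_real (fact (k + l) / (fact k * fact l)) * Alt (k + l) (tensor k F (\<lambda>u. of_real (G u))) v"
    by (simp add: wedge_def)
  also have "Alt (k + l) (tensor k F (\<lambda>u. complex_of_real (G u))) v =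
     of_real (1 / fact (k + l)) * (\<Sum>p | p permutes {..<k+l}. of_real (of_int (sign p) * G (\<lambda>i. (v \<circ> p) (k + i))) * F (v \<circ> p))"
    by (simp add: Alt_def tensor_def mult_ac)
  finally show ?thesis
    by (simp add: wedge_def Alt_def tensor_def mult_ac del: of_real_mult of_real_divide)
qed

text \<open>The span of wedge products of linear covectors. Alternation and multilinearity are not
  part of the type of forms; induction over this predicate gives the change of frame rule,
  boundedness, and closure under wedge products and pullbacks.\<close>

inductive alt_form :: "nat \<Rightarrow> ('a::real_vector, complex) form \<Rightarrow> bool" for m where
  alt_form_zero: "alt_form m (\<lambda>_. 0)"
| alt_form_add: "alt_form m F \<Longrightarrow> alt_form m G \<Longrightarrow> alt_form m (\<lambda>v. F v + G v)"
| alt_form_cdet: "length zs = m \<Longrightarrow> (\<And>z. z \<in> set zs \<Longrightarrow> linear z) \<Longrightarrow> alt_form m (\<lambda>v. c * cdet zs v)"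

lemma alt_form_scale: "alt_form m F \<Longrightarrow> alt_form m (\<lambda>v. c * F v)"
proof (induction rule: alt_form.induct)
  case (alt_form_cdet zs d)
  then show ?case using alt_form.alt_form_cdet[of zs m "c * d"] by (simp add: mult.assoc)
qed (simp_all add: distrib_left alt_form.intros)

lemma alt_form_cdet1: "length zs = m \<Longrightarrow> (\<And>z. z \<in> set zs \<Longrightarrow> linear z) \<Longrightarrow> alt_form m (cdet zs)"
  using alt_form_cdet[of zs m 1] by simp

lemma alt_form_sum:
  "(\<And>s. s \<in> S \<Longrightarrow> alt_form m (F s)) \<Longrightarrow> alt_form m (\<lambda>v. \<Sum>s\<in>S. F s v)"
  by (induction S rule: infinite_finite_induct) (auto intro: alt_form_zero alt_form_add)

lemma cnj_cdet: "cnj (cdet zs v) = cdet (map (\<lambda>z x. cnj (z x)) zs) v"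
  by (simp add: cdet_perm_sum)

lemma alt_form_cnj: "alt_form m F \<Longrightarrow> alt_form m (\<lambda>v. cnj (F v))"
proof (induction rule: alt_form.induct)
  case (alt_form_cdet zs c)
  have "linear (\<lambda>x. cnj (z x))" if "z \<in> set zs" for z
    using linear_compose[OF alt_form_cdet(2)[OF that], of cnj]
    by (simp add: o_def bounded_linear.linear bounded_linear_cnj)
  then show ?case using alt_form_cdet by (auto simp: cnj_cdet intro!: alt_form.alt_form_cdet)
qed (simp_all add: alt_form.intros)

lemma alt_form_pullback:
  assumes "alt_form m F" and f: "linear f"
  shows "alt_form m (pullback f F)"
  using assms(1)
proof (induction rule: alt_form.induct)
  case (alt_form_cdet zs c)
  have "cdet zs (f \<circ> v) = cdet (map (\<lambda>z. z \<circ> f) zs) v" for v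
    by (simp add: cdet_perm_sum)
  then show ?case
    using alt_form_cdet f by (auto simp: pullback_def intro!: alt_form.alt_form_cdet linear_compose)
qed (simp_all add: pullback_def alt_form.intros)

lemma alt_form_wedge:
  assumes "alt_form k F" "alt_form l G"
  shows "alt_form (k + l) (wedge k l F G)"
  using assms(1)
proof (induction rule: alt_form.induct)
  case (alt_form_cdet zs c)
  note zs = this
  show ?case using assms(2)
  proof (induction rule: alt_form.induct)
    case (alt_form_cdet ys d)
    then show ?case
      using zs wedge_cdet[of zs ys]
      by (auto simp: wedge_scale_left wedge_scale_right mult.assoc[symmetric] intro!: alt_form.alt_form_cdet)
  qed (simp_all add: wedge_zero_right wedge_add_right alt_form.intros)
qed (simp_all add: wedge_zero_left wedge_add_left alt_form.intros)

lemma alt_form_wedge_power: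
  "alt_form k F \<Longrightarrow> alt_form (k * n) (wedge_power k F n)"
proof (induction n)
  case 0
  show ?case using alt_form_cdet1[of "[]" 0] by simp
next
  case (Suc n)
  then show ?case using alt_form_wedge[of "k * n" "wedge_power k F n" k F] by (simp add: add.commute)
qed

section \<open>Change of frame and boundedness\<close>

lemma cdet_mat_mult:
  fixes zs :: "('a \<Rightarrow> 'b::comm_ring_1) list"
  assumes "\<And>i j. i < length zs \<Longrightarrow> j < length zs \<Longrightarrow> (zs ! i) (v j) = (\<Sum>k<length zs. (zs ! i) (w k) * M k j)"
  shows "cdet zs v = cdet zs w * Determinant.det (Matrix.mat (length zs) (length zs) (\<lambda>(i, j). M i j))"
proof -
  let ?n = "length zs"
  have "Matrix.mat ?n ?n (\<lambda>(i, j). (zs ! i) (v j)) =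
      Matrix.mat ?n ?n (\<lambda>(i, j). (zs ! i) (w j)) * Matrix.mat ?n ?n (\<lambda>(i, j). M i j)"
    by (rule eq_matI) (auto simp: assms scalar_prod_def atLeast0LessThan)
  then show ?thesis unfolding cdet_def by (simp add: det_mult[of _ ?n])
qed

lemma det_of_real:
  "Determinant.det (Matrix.mat m m (\<lambda>(i, j). complex_of_real (M i j))) =
   of_real (Determinant.det (Matrix.mat m m (\<lambda>(i, j). M i j)))"
proof -
  have "map_mat complex_of_real (Matrix.mat m m (\<lambda>(i, j). M i j)) =
    Matrix.mat m m (\<lambda>(i, j). complex_of_real (M i j))" by (rule eq_matI) auto
  then show ?thesis by (metis of_real_hom.hom_det)
qed

lemma alt_form_mat_mult:
  fixes F :: "('a::real_vector, complex) form"
  assumes "alt_form m F" and v: "\<And>j. j < m \<Longrightarrow> v j = (\<Sum>k<m. M k j *\<^sub>R w k)"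
  shows "F v = of_real (Determinant.det (Matrix.mat m m (\<lambda>(i, j). M i j))) * F w"
  using assms(1)
proof (induction rule: alt_form.induct)
  case (alt_form_cdet zs c)
  have "(zs ! i) (v j) = (\<Sum>k<m. (zs ! i) (w k) * of_real (M k j))" if "i < m" "j < m" for i j
  proof -
    have "linear (zs ! i)" using alt_form_cdet that by auto
    then show ?thesis
      using that by (simp add: v linear_sum linear_scale scaleR_conv_of_real mult.commute)
  qed
  then have "cdet zs v = cdet zs w * of_real (Determinant.det (Matrix.mat m m (\<lambda>(i, j). M i j)))"
    using alt_form_cdet(1) cdet_mat_mult[of zs v w "\<lambda>k j. of_real (M k j)"] by (simp add: det_of_real)
  then show ?case by simp
qed (simp_all add: algebra_simps)

text \<open>Leibniz expansion, with a norm bound for each covector. This is what makes the supremum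
  defining the comass of the wedge product a genuine upper bound of the values.\<close>

lemma alt_form_bounded:
  fixes F :: "('a::euclidean_space, complex) form"
  assumes "alt_form m F"
  shows "\<exists>K. \<forall>w. (\<forall>i<m. norm (w i) \<le> 1) \<longrightarrow> cmod (F w) \<le> K"
  using assms
proof (induction rule: alt_form.induct)
  case alt_form_zero
  show ?case by auto
next
  case (alt_form_add F G)
  then obtain K L where "\<And>w. (\<forall>i<m. norm (w i) \<le> 1) \<Longrightarrow> cmod (F w) \<le> K"
    "\<And>w. (\<forall>i<m. norm (w i) \<le> 1) \<Longrightarrow> cmod (G w) \<le> L" by blast
  then have "\<forall>w. (\<forall>i<m. norm (w i) \<le> 1) \<longrightarrow> cmod (F w + G w) \<le> K + L"
    by (meson add_mono norm_triangle_ineq order_trans)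
  then show ?case by blast
next
  case (alt_form_cdet zs c)
  have "\<exists>B. \<forall>x. cmod ((zs ! i) x) \<le> B * norm x" if "i < m" for i
    using linear_bounded[of "zs ! i"] alt_form_cdet that by auto
  then obtain B where B: "\<And>i x. i < m \<Longrightarrow> cmod ((zs ! i) x) \<le> B i * norm x" by metis
  have "cmod (c * cdet zs w) \<le> cmod c * (\<Sum>p | p permutes {..<m}. \<Prod>i<m. \<bar>B i\<bar>)" if w: "\<forall>i<m. norm (w i) \<le> 1" for w
  proof -
    have "cmod (of_int (sign p) * (\<Prod>i<m. (zs ! i) (w (p i)))) \<le> (\<Prod>i<m. \<bar>B i\<bar>)" if p: "p permutes {..<m}" for p
    proof -
      have "cmod ((zs ! i) (w (p i))) \<le> \<bar>B i\<bar>" if "i < m" for i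
      proof -
        have "p i < m" using permutes_in_image[OF p, of i] that by simp
        then have "norm (w (p i)) \<le> 1" using w by simp
        then have "B i * norm (w (p i)) \<le> \<bar>B i\<bar> * 1" by (intro mult_mono) auto
        with B[OF that, of "w (p i)"] show ?thesis by simp
      qed
      then show ?thesis
        by (auto simp: norm_mult prod_norm[symmetric] sign_def intro!: prod_mono)
    qed
    then have "cmod (cdet zs w) \<le> (\<Sum>p | p permutes {..<m}. \<Prod>i<m. \<bar>B i\<bar>)"
      unfolding cdet_perm_sum alt_form_cdet(1) by (intro sum_norm_le) blast
    then show ?thesis by (simp add: norm_mult mult_left_mono del: sum_constant)
  qed
  then show ?case by blast
qed

section \<open>Orthonormal frames adapted to bilinear forms\<close>

text \<open>The first order condition at an extremum, without derivatives: near 0 a linear term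
  cannot be dominated by a quadratic one.\<close>

lemma linear_le_quadratic_imp_zero:
  fixes b k :: real
  assumes "\<And>t. t * b \<le> k * t\<^sup>2"
  shows "b = 0"
proof (rule ccontr)
  assume b: "b \<noteq> 0"
  define K where "K = \<bar>k\<bar> + 1"
  have K: "K > 0" "k \<le> K" by (simp_all add: K_def)
  \<comment> \<open>At this \<open>t\<close> the left side is \<open>b\<^sup>2 / (2 * K)\<close>,
    twice the bound \<open>b\<^sup>2 / (4 * K)\<close> obtained for the right side.\<close>
  have "(b / (2 * K)) * b \<le> k * (b / (2 * K))\<^sup>2" by (rule assms)
  also have "\<dots> \<le> K * (b / (2 * K))\<^sup>2" using K by (intro mult_right_mono) auto
  finally have "b\<^sup>2 / (2 * K) \<le> b\<^sup>2 / (4 * K)" using K by (simp add: power2_eq_square field_simps)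
  then show False using K b by (simp add: field_simps)
qed

lemma dim_orthogonal_complement_pair:
  fixes W :: "'e::euclidean_space set"
  assumes W: "subspace W" and x: "x \<in> W" "norm x = 1" and y: "y \<in> W" "norm y = 1" and xy: "x \<bullet> y = 0"
  shows "dim {z \<in> W. x \<bullet> z = 0 \<and> y \<bullet> z = 0} + 2 = dim W"
proof -
  have "x \<noteq> y" using x xy by (auto simp: dot_square_norm)
  moreover have "independent {x, y}"
    using x y xy by (intro pairwise_orthogonal_independent) (auto simp: pairwise_def real_inner_class.orthogonal_def inner_commute)
  ultimately have "dim {x, y} = 2" by (simp add: dim_eq_card_independent)
  moreover have "dim {z \<in> W. \<forall>v\<in>span {x, y}. orthogonal v z} + dim (span {x, y}) = dim W"
    using span_minimal[of "{x, y}" W] x y W by (intro dim_subspace_orthogonal_to_vectors) auto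
  moreover have "{z \<in> W. \<forall>v\<in>span {x, y}. orthogonal v z} = {z \<in> W. x \<bullet> z = 0 \<and> y \<bullet> z = 0}"
  proof -
    have "(\<forall>v\<in>span {x, y}. orthogonal v z) \<longleftrightarrow> x \<bullet> z = 0 \<and> y \<bullet> z = 0" for z
    proof
      assume "\<forall>v\<in>span {x, y}. orthogonal v z"
      then show "x \<bullet> z = 0 \<and> y \<bullet> z = 0"
        using span_base[of x "{x, y}"] span_base[of y "{x, y}"] by (simp add: real_inner_class.orthogonal_def)
    next
      assume "x \<bullet> z = 0 \<and> y \<bullet> z = 0"
      then have "orthogonal z v" if "v \<in> span {x, y}" for v
        using that by (intro orthogonal_to_span[of v "{x, y}" z]) (auto simp: real_inner_class.orthogonal_def inner_commute)
      then show "\<forall>v\<in>span {x, y}. orthogonal v z" by (simp add: orthogonal_commute)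
    qed
    then show ?thesis by simp
  qed
  ultimately show ?thesis by simp
qed

lemma dim_orthogonal_complement_single:
  fixes W :: "'e::euclidean_space set"
  assumes W: "subspace W" and x: "x \<in> W" "norm x = 1"
  shows "dim {z \<in> W. x \<bullet> z = 0} + 1 = dim W"
proof -
  have "x \<noteq> 0" using x by auto
  then have "dim {x} = 1" by (simp add: dim_singleton)
  moreover have "dim {z \<in> W. \<forall>v\<in>span {x}. orthogonal v z} + dim (span {x}) = dim W"
    using span_minimal[of "{x}" W] x W by (intro dim_subspace_orthogonal_to_vectors) auto
  moreover have "{z \<in> W. \<forall>v\<in>span {x}. orthogonal v z} = {z \<in> W. x \<bullet> z = 0}"
    by (auto simp: span_singleton real_inner_class.orthogonal_def dest: bspec[of _ _ x] intro: image_eqI[of _ _ 1])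
  ultimately show ?thesis by simp
qed

lemma norm_add_orthogonal_unit:
  fixes x z :: "'e::real_inner"
  assumes "norm x = 1" "x \<bullet> z = 0"
  shows "(norm (x + t *\<^sub>R z))\<^sup>2 = 1 + t\<^sup>2 * (norm z)\<^sup>2"
  using assms unfolding power2_norm_eq_inner norm_eq_1
  by (simp add: inner_add_left inner_add_right inner_commute power2_eq_square)

text \<open>A pair \<open>(x, y)\<close> maximizing \<open>B\<close> over the compact set of
  orthonormal pairs of \<open>W\<close> forms one block. Varying \<open>y\<close> shows that
  \<open>B x\<close> vanishes on the complement of the pair, and the same holds for
  \<open>B y\<close> because \<open>(y, - x)\<close> is another maximizer; induction then applies to
  the complement.\<close>

lemma skew_normal_frame:
  fixes B :: "'e::euclidean_space \<Rightarrow> 'e \<Rightarrow> real"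
  assumes B: "bounded_bilinear B" and skew: "\<And>x y. B x y = - B y x"
    and W: "subspace W" "dim W = 2 * n"
  shows "\<exists>w. (\<forall>i<2*n. w i \<in> W) \<and> (\<forall>i<2*n. \<forall>j<2*n. w i \<bullet> w j = (if i = j then 1 else 0)) \<and>
    (\<forall>i<2*n. \<forall>j<2*n. i div 2 \<noteq> j div 2 \<longrightarrow> B (w i) (w j) = 0)"
  using W
proof (induction n arbitrary: W)
  case 0
  then show ?case by auto
next
  case (Suc n)
  interpret B: bounded_bilinear B by (rule B)
  define K where "K = {p. fst p \<in> W \<and> snd p \<in> W \<and> norm (fst p) = 1 \<and> norm (snd p) = 1 \<and> fst p \<bullet> snd p = 0}"
  have "K = (W \<times> W) \<inter> (sphere 0 1 \<times> sphere 0 1) \<inter> {p. fst p \<bullet> snd p = 0}"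
    by (auto simp: K_def)
  moreover have "compact (sphere 0 1 \<times> sphere 0 1 :: ('e \<times> 'e) set)" by (intro compact_Times) auto
  moreover have "closed (W \<times> W)" using Suc.prems(1) by (intro closed_Times closed_subspace)
  moreover have "closed {p::'e\<times>'e. fst p \<bullet> snd p = 0}"
    by (intro closed_Collect_eq continuous_intros)
  ultimately have "compact K" by (auto intro: compact_Int_closed closed_Int_compact)
  moreover have "K \<noteq> {}"
  proof -
    obtain b where b: "b \<subseteq> W" "pairwise orthogonal b" "\<And>x. x \<in> b \<Longrightarrow> norm x = 1" "card b = dim W"
      using orthonormal_basis_subspace[OF Suc.prems(1)] by metis
    have "2 \<le> card b" using b Suc.prems by simp
    then obtain T where "T \<subseteq> b" "card T = 2" using obtain_subset_with_card_n by metis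
    then obtain x y where "x \<in> b" "y \<in> b" "x \<noteq> y" by (auto simp: card_2_iff)
    then have "(x, y) \<in> K" using b by (auto simp: K_def pairwise_def real_inner_class.orthogonal_def)
    then show ?thesis by auto
  qed
  moreover have "continuous_on K (\<lambda>p. B (fst p) (snd p))"
    by (intro B.continuous_on continuous_intros)
  ultimately obtain q where q: "q \<in> K" and max: "\<And>p. p \<in> K \<Longrightarrow> B (fst p) (snd p) \<le> B (fst q) (snd q)"
    using continuous_attains_sup[of K "\<lambda>p. B (fst p) (snd p)"] by blast
  have zero: "B x z = 0" if K: "(x, y) \<in> K" and m: "B x y = B (fst q) (snd q)"
    and z: "z \<in> W" "x \<bullet> z = 0" "y \<bullet> z = 0" for x y z
  proof (rule linear_le_quadratic_imp_zero)
    fix t :: real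
    define m where "m = B x y"
    have yx: "(y, x) \<in> K" using K by (auto simp: K_def inner_commute)
    \<comment> \<open>Swapping the pair changes the sign of \<open>B\<close>, so the maximum is not
      negative.\<close>
    have m0: "m \<ge> 0" using max[OF yx] skew[of y x] that(2) by (simp add: m_def)
    \<comment> \<open>After normalization \<open>y + t z\<close> is again a partner of
      \<open>x\<close>. Its norm exceeds 1 only to second order in \<open>t\<close>, so maximality
      forces the first order term \<open>t * B x z\<close> to vanish.\<close>
    define v where "v = y + t *\<^sub>R z"
    have nv: "(norm v)\<^sup>2 = 1 + t\<^sup>2 * (norm z)\<^sup>2"
      using K z unfolding v_def by (intro norm_add_orthogonal_unit) (auto simp: K_def)
    have v0: "v \<noteq> 0"
    proof
      assume "v = 0"
      then have "1 + t\<^sup>2 * (norm z)\<^sup>2 = 0" using nv by simp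
      moreover have "0 \<le> t\<^sup>2 * (norm z)\<^sup>2" by simp
      ultimately show False by linarith
    qed
    have vW: "v \<in> W" using K z Suc.prems(1) by (auto simp: v_def K_def intro!: subspace_add subspace_scale)
    have "x \<bullet> v = 0" using K z by (simp add: v_def K_def inner_add_right)
    then have "(x, v /\<^sub>R norm v) \<in> K"
      using K v0 vW Suc.prems(1) by (auto simp: K_def intro: subspace_scale)
    from max[OF this] have "B x v / norm v \<le> m" using that(2) by (simp add: m_def B.scaleR_right divide_inverse mult.commute)
    then have "B x v \<le> m * norm v" using v0 by (simp add: field_simps)
    also have "\<dots> \<le> m * (1 + t\<^sup>2 * (norm z)\<^sup>2 / 2)"
    proof (rule mult_left_mono[OF _ m0])
      have "(norm v)\<^sup>2 \<le> (1 + t\<^sup>2 * (norm z)\<^sup>2 / 2)\<^sup>2"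
        unfolding nv by (simp add: power2_eq_square[of "1 + _"] algebra_simps)
      then show "norm v \<le> 1 + t\<^sup>2 * (norm z)\<^sup>2 / 2" by (rule power2_le_imp_le) (auto intro: add_nonneg_nonneg)
    qed
    also have "B x v = m + t * B x z" by (simp add: v_def m_def B.add_right B.scaleR_right)
    finally show "t * B x z \<le> (m * (norm z)\<^sup>2 / 2) * t\<^sup>2" by (simp add: algebra_simps)
  qed
  obtain x y where xy: "q = (x, y)" by (cases q)
  have K: "(x, y) \<in> K" "(y, - x) \<in> K"
    using q Suc.prems(1) xy by (auto simp: K_def inner_commute subspace_neg)
  have Bxz: "B x z = 0" "B y z = 0" if "z \<in> W" "x \<bullet> z = 0" "y \<bullet> z = 0" for z
    using zero[OF K(1) _ that] zero[OF K(2), of z] that skew[of x y] xy by (simp_all add: B.minus_right)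
  define W' where "W' = {z \<in> W. x \<bullet> z = 0 \<and> y \<bullet> z = 0}"
  have "subspace W'" using Suc.prems(1) unfolding W'_def
    by (auto simp: subspace_def inner_add_right)
  moreover have "dim W' = 2 * n"
    using dim_orthogonal_complement_pair[OF Suc.prems(1), of x y] K Suc.prems(2) by (simp add: K_def W'_def)
  ultimately obtain w where w: "\<forall>i<2*n. w i \<in> W'" "\<forall>i<2*n. \<forall>j<2*n. w i \<bullet> w j = (if i = j then 1 else 0)"
    "\<forall>i<2*n. \<forall>j<2*n. i div 2 \<noteq> j div 2 \<longrightarrow> B (w i) (w j) = 0"
    using Suc.IH by blast
  \<comment> \<open>The new pair is put last, so that the indices of the inductive frame, and with
    them the blocks \<open>i div 2\<close>, are unchanged.\<close>
  define w' where "w' i = (if i < 2 * n then w i else if i = 2 * n then x else y)" for i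
  have cases: "i < 2 * n \<or> i = 2 * n \<or> i = 2 * n + 1" if "i < 2 * Suc n" for i using that by auto
  have wx: "w i \<in> W" "w i \<bullet> x = 0" "w i \<bullet> y = 0" "x \<bullet> w i = 0" "y \<bullet> w i = 0" 
    "B x (w i) = 0" "B y (w i) = 0" "B (w i) x = 0" "B (w i) y = 0" if "i < 2 * n" for i
    using w(1) that Bxz[of "w i"] skew[of "w i"] by (auto simp: W'_def inner_commute)
  have xx: "x \<bullet> x = 1" "y \<bullet> y = 1" "x \<bullet> y = 0" "y \<bullet> x = 0" "x \<in> W" "y \<in> W"
    using K by (auto simp: K_def norm_eq_1 inner_commute)
  show ?case
  proof (intro exI[of _ w'] conjI allI impI)
    fix i assume i: "i < 2 * Suc n"
    show "w' i \<in> W" using cases[OF i] wx xx by (auto simp: w'_def)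
    fix j assume j: "j < 2 * Suc n"
    show "w' i \<bullet> w' j = (if i = j then 1 else 0)"
      using cases[OF i] cases[OF j] w(2) by (elim disjE) (auto simp: w'_def wx xx)
    show "B (w' i) (w' j) = 0" if "i div 2 \<noteq> j div 2"
      using cases[OF i] cases[OF j] w(3) that by (elim disjE) (auto simp: w'_def wx)
  qed
qed

text \<open>The Rayleigh quotient argument: a maximizer of \<open>B x x\<close> on the unit sphere
  is \<open>B\<close>-orthogonal to its orthogonal complement. The main use is for an inner product
  pulled back along a contraction.\<close>

lemma symmetric_diagonal_frame:
  fixes B :: "'e::euclidean_space \<Rightarrow> 'e \<Rightarrow> real"
  assumes B: "bounded_bilinear B" and sym: "\<And>x y. B x y = B y x"
    and W: "subspace W" "dim W = n"
  shows "\<exists>w. (\<forall>i<n. w i \<in> W) \<and> (\<forall>i<n. \<forall>j<n. w i \<bullet> w j = (if i = j then 1 else 0)) \<and>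
    (\<forall>i<n. \<forall>j<n. i \<noteq> j \<longrightarrow> B (w i) (w j) = 0)"
  using W
proof (induction n arbitrary: W)
  case 0
  then show ?case by auto
next
  case (Suc n)
  interpret B: bounded_bilinear B by (rule B)
  define K where "K = W \<inter> sphere 0 1"
  have "compact K" using Suc.prems(1) unfolding K_def by (intro closed_Int_compact closed_subspace) auto
  moreover have "K \<noteq> {}"
  proof -
    obtain b where b: "b \<subseteq> W" "\<And>x. x \<in> b \<Longrightarrow> norm x = 1" "card b = dim W"
      using orthonormal_basis_subspace[OF Suc.prems(1)] by metis
    then have "b \<noteq> {}" using Suc.prems by auto
    then show ?thesis using b by (auto simp: K_def)
  qed
  moreover have "continuous_on K (\<lambda>x. B x x)" by (intro B.continuous_on continuous_intros)
  ultimately obtain x where x: "x \<in> K" and max: "\<And>p. p \<in> K \<Longrightarrow> B p p \<le> B x x"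
    using continuous_attains_sup[of K "\<lambda>p. B p p"] by blast
  have zero: "B x z = 0" if z: "z \<in> W" "x \<bullet> z = 0" for z
  proof -
    have "2 * B x z = 0"
    proof (rule linear_le_quadratic_imp_zero)
      fix t :: real
      define v where "v = x + t *\<^sub>R z"
      have nv: "(norm v)\<^sup>2 = 1 + t\<^sup>2 * (norm z)\<^sup>2"
        using x z unfolding v_def by (intro norm_add_orthogonal_unit) (auto simp: K_def)
      have v0: "v \<noteq> 0"
    proof
      assume "v = 0"
      then have "1 + t\<^sup>2 * (norm z)\<^sup>2 = 0" using nv by simp
      moreover have "0 \<le> t\<^sup>2 * (norm z)\<^sup>2" by simp
      ultimately show False by linarith
    qed
      have vW: "v \<in> W" using x z Suc.prems(1) by (auto simp: v_def K_def intro!: subspace_add subspace_scale)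
      then have "v /\<^sub>R norm v \<in> K"
        using v0 Suc.prems(1) by (auto simp: K_def intro: subspace_scale)
      from max[OF this] have "B v v / (norm v)\<^sup>2 \<le> B x x"
        by (simp add: B.scaleR_right B.scaleR_left divide_inverse power2_eq_square mult_ac)
      then have "B v v \<le> B x x * (1 + t\<^sup>2 * (norm z)\<^sup>2)" using v0 by (simp add: field_simps flip: nv)
      moreover have "B v v = B x x + t * (2 * B x z) + t\<^sup>2 * B z z"
        using sym[of z x] by (simp add: v_def B.add_right B.add_left B.scaleR_right B.scaleR_left power2_eq_square distrib_left)
      ultimately show "t * (2 * B x z) \<le> (B x x * (norm z)\<^sup>2 - B z z) * t\<^sup>2" by (simp add: algebra_simps)
    qed
    then show ?thesis by simp
  qed
  define W' where "W' = {z \<in> W. x \<bullet> z = 0}"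
  have "subspace W'" using Suc.prems(1) unfolding W'_def by (auto simp: subspace_def inner_add_right)
  moreover have "dim W' = n"
    using dim_orthogonal_complement_single[OF Suc.prems(1), of x] x Suc.prems(2) by (simp add: K_def W'_def)
  ultimately obtain w where w: "\<forall>i<n. w i \<in> W'" "\<forall>i<n. \<forall>j<n. w i \<bullet> w j = (if i = j then 1 else 0)"
    "\<forall>i<n. \<forall>j<n. i \<noteq> j \<longrightarrow> B (w i) (w j) = 0"
    using Suc.IH by blast
  have wx: "w i \<in> W" "w i \<bullet> x = 0" "x \<bullet> w i = 0" "B x (w i) = 0" "B (w i) x = 0" if "i < n" for i
    using w(1) that zero[of "w i"] sym[of "w i" x] by (auto simp: W'_def inner_commute)
  have xx: "x \<bullet> x = 1" "x \<in> W" using x by (auto simp: K_def norm_eq_1)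
  show ?case
    by (intro exI[of _ "w(n := x)"]) (use w wx xx in \<open>auto simp: less_Suc_eq\<close>)
qed

section \<open>Minors of four orthonormal rows\<close>

text \<open>Columns come in blocks \<open>2k, 2k + 1\<close>, as do the vectors of a normal
  frame.\<close>

definition block_minor :: "(nat \<Rightarrow> complex) \<Rightarrow> (nat \<Rightarrow> complex) \<Rightarrow> nat \<Rightarrow> complex" where
  "block_minor a b k = a (2 * k) * b (2 * k + 1) - a (2 * k + 1) * b (2 * k)"

text \<open>The Laplace expansion, along the two columns of block \<open>k\<close>, of the
  \<open>4 \<times> 4\<close> minor at the blocks \<open>k\<close> and \<open>l\<close>. With the
  polynomial explicit, row operations are plain algebra.\<close>

definition pair_minor ::
    "(nat \<Rightarrow> complex) \<Rightarrow> (nat \<Rightarrow> complex) \<Rightarrow> (nat \<Rightarrow> complex) \<Rightarrow> (nat \<Rightarrow> complex) \<Rightarrow> nat \<Rightarrow> nat \<Rightarrow> complex" where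
  "pair_minor a b c d k l =
     block_minor a b k * block_minor c d l - block_minor a c k * block_minor b d l
   + block_minor a d k * block_minor b c l + block_minor b c k * block_minor a d l
   - block_minor b d k * block_minor a c l + block_minor c d k * block_minor a b l"

definition herm :: "nat \<Rightarrow> (nat \<Rightarrow> complex) \<Rightarrow> (nat \<Rightarrow> complex) \<Rightarrow> complex" where
  "herm m x y = (\<Sum>j<m. cnj (x j) * y j)"

definition orthonormal_rows :: "nat \<Rightarrow> (nat \<Rightarrow> nat \<Rightarrow> complex) \<Rightarrow> bool" where
  "orthonormal_rows m R \<longleftrightarrow> (\<forall>i<4. \<forall>j<4. herm m (R i) (R j) = (if i = j then 1 else 0))"

definition minor_sum :: "nat \<Rightarrow> (nat \<Rightarrow> nat \<Rightarrow> complex) \<Rightarrow> real" where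
  "minor_sum n R = (\<Sum>l<n. \<Sum>k<l. cmod (pair_minor (R 0) (R 1) (R 2) (R 3) k l))"

lemma herm_lincomb_right: "herm m x (\<lambda>p. s * y p + t * z p) = s * herm m x y + t * herm m x z"
  and herm_lincomb_left: "herm m (\<lambda>p. s * y p + t * z p) x = cnj s * herm m y x + cnj t * herm m z x"
  by (simp_all add: herm_def sum.distrib sum_distrib_left algebra_simps)

lemma herm_commute: "herm m y x = cnj (herm m x y)"
  by (simp add: herm_def mult.commute)

lemma herm_self: "herm m x x = of_real (\<Sum>j<m. (cmod (x j))\<^sup>2)"
  unfolding herm_def of_real_sum by (intro sum.cong refl) (metis complex_norm_square mult.commute of_real_power)

text \<open>The minor is alternating in its rows, so a linear change of two rows multiplies it by
  the determinant of that change. The five row pairs are those rotated in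
  \<open>minor_sum_le_1\<close>.\<close>

lemma pair_minor_rotate:
  defines "f \<equiv> \<lambda>s t x y (p::nat). s * x p + t * y p :: complex"
  shows "pair_minor (f s t a b) (f u v a b) c d k l = (s * v - t * u) * pair_minor a b c d k l"
    and "pair_minor (f s t a c) b (f u v a c) d k l = (s * v - t * u) * pair_minor a b c d k l"
    and "pair_minor (f s t a d) b c (f u v a d) k l = (s * v - t * u) * pair_minor a b c d k l"
    and "pair_minor a (f s t b c) (f u v b c) d k l = (s * v - t * u) * pair_minor a b c d k l"
    and "pair_minor a (f s t b d) c (f u v b d) k l = (s * v - t * u) * pair_minor a b c d k l"
  unfolding f_def pair_minor_def block_minor_def by (simp_all add: algebra_simps)

lemma pair_minor_scale:
  "pair_minor (\<lambda>p. s * a p) (\<lambda>p. t * b p) c d k l = s * t * pair_minor a b c d k l"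
  unfolding pair_minor_def block_minor_def by (simp add: algebra_simps)

lemma pair_minor_shear:
  "pair_minor a (\<lambda>p. b p - t * a p) c d k l = pair_minor a b c d k l"
  unfolding pair_minor_def block_minor_def by (simp add: algebra_simps)

text \<open>A unitary rotation of rows \<open>i\<close> and \<open>j\<close> with determinant 1,
  chosen to clear the entry of row \<open>j\<close> in column \<open>q\<close>. The last conclusion
  preserves zeros produced by earlier rotations.\<close>

lemma givens_rotation:
  assumes R: "orthonormal_rows m R" and ij: "(i, j) \<in> {(0,1), (0,2), (0,3), (1,2), (1,3::nat)}"
  obtains R' where "orthonormal_rows m R'" "minor_sum n R' = minor_sum n R" "R' j q = 0"
    "\<And>k. k \<noteq> i \<Longrightarrow> k \<noteq> j \<Longrightarrow> R' k = R k"
    "\<And>p. R i p = 0 \<Longrightarrow> R j p = 0 \<Longrightarrow> R' i p = 0 \<and> R' j p = 0"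
proof (cases "R i q = 0 \<and> R j q = 0")
  case True
  then show ?thesis using R by (intro that[of R]) auto
next
  case False
  define N where "N = sqrt ((cmod (R i q))\<^sup>2 + (cmod (R j q))\<^sup>2)"
  define x y where "x = R i q / N" and "y = R j q / N"
  have N: "N > 0" unfolding N_def using False
    by (metis norm_eq_zero real_sqrt_gt_zero sum_power2_gt_zero_iff)
  have "(cmod x)\<^sup>2 + (cmod y)\<^sup>2 = ((cmod (R i q))\<^sup>2 + (cmod (R j q))\<^sup>2) / N\<^sup>2"
    using N by (simp add: x_def y_def norm_divide power_divide add_divide_distrib)
  also have "(cmod (R i q))\<^sup>2 + (cmod (R j q))\<^sup>2 = N\<^sup>2" by (simp add: N_def)
  also have "N\<^sup>2 / N\<^sup>2 = 1" using N by simp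
  finally have "(cmod x)\<^sup>2 + (cmod y)\<^sup>2 = 1" .
  then have xy: "x * cnj x + y * cnj y = 1"
    by (metis complex_norm_square of_real_1 of_real_add)
  define y' where "y' = - y"
  define u v where "u = (\<lambda>p. cnj x * R i p + cnj y * R j p)" and "v = (\<lambda>p. y' * R i p + x * R j p)"
  define R' where "R' = R(i := u, j := v)"
  have ne: "i \<noteq> j" "i < 4" "j < 4" using ij by auto
  have R'i: "R' i = u" "R' j = v" using ne by (auto simp: R'_def)
  have R'k: "R' k = R k" if "k \<noteq> i" "k \<noteq> j" for k using that by (simp add: R'_def)
  have on: "herm m (R k) (R l) = (if k = l then 1 else 0)" if "k < 4" "l < 4" for k l
    using R that by (simp add: orthonormal_rows_def)
  have uu: "herm m u u = 1" "herm m v v = 1"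
    using xy ne unfolding u_def v_def herm_lincomb_left herm_lincomb_right by (simp_all add: on y'_def algebra_simps)
  have uv: "herm m u v = 0" "herm m v u = 0"
    using ne unfolding u_def v_def herm_lincomb_left herm_lincomb_right by (simp_all add: on y'_def algebra_simps)
  have ku: "herm m (R k) u = 0" "herm m (R k) v = 0" "herm m u (R k) = 0" "herm m v (R k) = 0"
    if "k < 4" "k \<noteq> i" "k \<noteq> j" for k
    using that ne by (simp_all add: u_def v_def herm_lincomb_left herm_lincomb_right on)
  have "orthonormal_rows m R'"
    unfolding orthonormal_rows_def
  proof (intro allI impI)
    fix k l :: nat assume "k < 4" "l < 4"
    then show "herm m (R' k) (R' l) = (if k = l then 1 else 0)"
      using ne by (cases "k = i"; cases "k = j"; cases "l = i"; cases "l = j")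
        (auto simp: R'i R'k uu uv ku on)
  qed
  moreover have "cnj x * x - cnj y * y' = 1" using xy by (simp add: y'_def mult.commute)
  then have "pair_minor (R' 0) (R' 1) (R' 2) (R' 3) k l = pair_minor (R 0) (R 1) (R 2) (R 3) k l" for k l
    using ij unfolding R'_def u_def v_def by (auto simp: pair_minor_rotate)
  then have "minor_sum n R' = minor_sum n R" by (simp add: minor_sum_def)
  moreover have "R' j q = 0" using N by (simp add: R'i v_def x_def y_def y'_def)
  ultimately show ?thesis
    by (intro that[of R']) (auto simp: R'i R'k u_def v_def)
qed

lemma block_minor_le:
  "cmod (block_minor a b k) \<le>
     ((cmod (a (2 * k)))\<^sup>2 + (cmod (a (2 * k + 1)))\<^sup>2 + (cmod (b (2 * k)))\<^sup>2 + (cmod (b (2 * k + 1)))\<^sup>2) / 2"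
proof -
  have "cmod (block_minor a b k) \<le>
      cmod (a (2 * k)) * cmod (b (2 * k + 1)) + cmod (a (2 * k + 1)) * cmod (b (2 * k))"
    unfolding block_minor_def by (metis norm_mult norm_triangle_ineq4)
  moreover have "2 * (x * y) \<le> x\<^sup>2 + y\<^sup>2" for x y :: real
    using sum_squares_bound[of x y] by simp
  from this[of "cmod (a (2 * k))" "cmod (b (2 * k + 1))"] this[of "cmod (a (2 * k + 1))" "cmod (b (2 * k))"]
  have "2 * (cmod (a (2 * k)) * cmod (b (2 * k + 1)) + cmod (a (2 * k + 1)) * cmod (b (2 * k))) \<le>
    (cmod (a (2 * k)))\<^sup>2 + (cmod (a (2 * k + 1)))\<^sup>2 + (cmod (b (2 * k)))\<^sup>2 + (cmod (b (2 * k + 1)))\<^sup>2" by argo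
  ultimately show ?thesis by argo
qed

lemma sum_lessThan_double: "(\<Sum>j<2 * n. f j) = (\<Sum>k<n. f (2 * k) + f (2 * k + 1))"
  for f :: "nat \<Rightarrow> 'a::comm_monoid_add"
  by (induction n) (simp_all add: add.assoc)

text \<open>Each block minor is at most half the squared mass of the two rows in that block, and the
  masses add up to 2. In the induction below this bounds the minors that involve the last
  block.\<close>

lemma sum_block_minor_le:
  assumes "herm (2 * n) a a = 1" "herm (2 * n) b b = 1"
  shows "(\<Sum>k<n. cmod (block_minor a b k)) \<le> 1"
proof -
  have "(\<Sum>k<n. (cmod (x (2 * k)))\<^sup>2 + (cmod (x (2 * k + 1)))\<^sup>2) = 1" if "herm (2 * n) x x = 1" for x
    using that unfolding herm_self sum_lessThan_double using of_real_eq_1_iff by blast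
  from this[OF assms(1)] this[OF assms(2)]
  have "(\<Sum>k<n. ((cmod (a (2 * k)))\<^sup>2 + (cmod (a (2 * k + 1)))\<^sup>2 + (cmod (b (2 * k)))\<^sup>2 + (cmod (b (2 * k + 1)))\<^sup>2) / 2) = 1"
    by (simp add: sum.distrib add_divide_distrib flip: sum_divide_distrib)
  moreover have "(\<Sum>k<n. cmod (block_minor a b k)) \<le> (\<Sum>k<n. ((cmod (a (2 * k)))\<^sup>2 + (cmod (a (2 * k + 1)))\<^sup>2 + (cmod (b (2 * k)))\<^sup>2 + (cmod (b (2 * k + 1)))\<^sup>2) / 2)"
    by (intro sum_mono block_minor_le)
  ultimately show ?thesis by simp
qed

lemma minor_sum_zero:
  assumes "\<And>j. j < 2 * n \<Longrightarrow> R 0 j = 0"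
  shows "minor_sum n R = 0"
  unfolding minor_sum_def pair_minor_def block_minor_def using assms by (auto intro!: sum.neutral)

lemma minor_sum_zero1:
  assumes "\<And>j. j < 2 * n \<Longrightarrow> R 1 j = 0"
  shows "minor_sum n R = 0"
  unfolding minor_sum_def pair_minor_def block_minor_def using assms by (auto intro!: sum.neutral)

lemma lagrange_identity:
  "(cmod (cnj a * b + cnj c * d))\<^sup>2 + (cmod (a * d - c * b))\<^sup>2 = ((cmod a)\<^sup>2 + (cmod c)\<^sup>2) * ((cmod b)\<^sup>2 + (cmod d)\<^sup>2)"
  unfolding cmod_power2 by (simp add: algebra_simps power2_eq_square)

text \<open>Gram--Schmidt on the first two rows, which are only assumed orthogonal to the other two.\<close>

lemma minor_sum_le_gram:
  assumes IH: "\<And>R. orthonormal_rows (2 * n) R \<Longrightarrow> minor_sum n R \<le> 1"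
    and A: "herm (2 * n) (R 0) (R 0) = of_real A" and B: "herm (2 * n) (R 1) (R 1) = of_real B"
    and on: "\<And>i j. i < 4 \<Longrightarrow> j \<in> {2, 3} \<Longrightarrow> herm (2 * n) (R i) (R j) = (if i = j then 1 else 0)"
  shows "(minor_sum n R)\<^sup>2 \<le> A * B - (cmod (herm (2 * n) (R 0) (R 1)))\<^sup>2"
proof -
  let ?h = "herm (2 * n)"
  define g where "g = ?h (R 0) (R 1)"
  have zero: "x j = 0" if "?h x x = 0" "j < 2 * n" for x j
  proof -
    have "(\<Sum>j<2 * n. (cmod (x j))\<^sup>2) = 0" using that(1) herm_self of_real_eq_0_iff by metis
    then have "\<forall>j\<in>{..<2 * n}. (cmod (x j))\<^sup>2 = 0" by (subst (asm) sum_nonneg_eq_0_iff) auto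
    then show ?thesis using that(2) by simp
  qed
  have nonneg: "0 \<le> r" if "?h x x = of_real r" for x r
    using that unfolding herm_self of_real_eq_iff by (metis sum_nonneg zero_le_power2)
  show ?thesis
  proof (cases "A = 0")
    case True
    then have R0: "R 0 j = 0" if "j < 2 * n" for j using zero[of "R 0"] A that by simp
    then have "g = 0" by (simp add: g_def herm_def)
    then show ?thesis using minor_sum_zero[of n R] R0 True by (simp add: g_def)
  next
    case False
    then have Apos: "A > 0" using nonneg[OF A] by simp
    define t where "t = g / A"
    define b where "b = (\<lambda>p. R 1 p - t * R 0 p)"
    \<comment> \<open>The squared norm of the part of row 1 orthogonal to row 0;
      \<open>A * C\<close> is the Gram determinant of the two rows.\<close>
    define C where "C = B - (cmod g)\<^sup>2 / A"
    have b': "b = (\<lambda>p. 1 * R 1 p + (- t) * R 0 p)" by (simp add: b_def)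
    have hg: "?h (R 1) (R 0) = cnj g" unfolding g_def by (rule herm_commute)
    have gg: "g * cnj g = of_real ((cmod g)\<^sup>2)" by (metis complex_norm_square)
    have 0: "?h (R 0) b = 0"
      unfolding b' herm_lincomb_right using Apos by (simp add: t_def A g_def)
    have "?h b b = ?h (R 1) b - cnj t * ?h (R 0) b"
      by (subst b', subst herm_lincomb_left) simp
    also have "\<dots> = of_real B - t * cnj g" unfolding 0 unfolding b' herm_lincomb_right by (simp add: B[simplified] hg[simplified])
    also have "\<dots> = of_real C" using gg by (simp add: C_def t_def)
    finally have C: "?h b b = of_real C" .
    have bj: "?h b (R j) = 0" if "j \<in> {2, 3}" for j
      unfolding b' herm_lincomb_left using on[of 0 j] on[of 1 j] that by auto
    define R' where "R' = R(1 := b)"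
    have eq: "minor_sum n R' = minor_sum n R"
      unfolding minor_sum_def R'_def b_def by (simp add: pair_minor_shear)
    have goal: "A * B - (cmod g)\<^sup>2 = A * C" using Apos by (simp add: C_def field_simps)
    show ?thesis
    proof (cases "C = 0")
      case True
      then have "R' 1 j = 0" if "j < 2 * n" for j using zero[of b] C that by (simp add: R'_def)
      then show ?thesis using minor_sum_zero1[of n R'] eq goal True by (simp add: g_def)
    next
      case False
      then have Cpos: "C > 0" using nonneg[OF C] by simp
      define sA sC where "sA = complex_of_real (1 / sqrt A)" and "sC = complex_of_real (1 / sqrt C)"
      \<comment> \<open>Normalizing both rows divides every minor by \<open>sqrt (A * C)\<close>,
        after which the induction hypothesis applies.\<close>
      define Q where "Q = R(0 := (\<lambda>p. sA * R 0 p), 1 := (\<lambda>p. sC * b p))"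
      have sc: "?h (\<lambda>p. s * x p) y = cnj s * ?h x y" "?h x (\<lambda>p. s * y p) = s * ?h x y" for s x y
        by (simp_all add: herm_def sum_distrib_left mult_ac)
      have sA: "sA * sA * of_real A = 1"
        unfolding sA_def of_real_mult[symmetric] using Apos by (simp del: of_real_mult)
      have sC: "sC * sC * of_real C = 1"
        unfolding sC_def of_real_mult[symmetric] using Cpos by (simp del: of_real_mult)
      have cs: "cnj sA = sA" "cnj sC = sC" by (simp_all add: sA_def sC_def)
      have b0: "?h b (R 0) = 0" using 0 herm_commute[of "2 * n" b "R 0"] by simp
      have jb: "?h (R j) b = 0" if "j \<in> {2, 3}" for j using bj[OF that] herm_commute[of "2 * n" "R j" b] by simp
      have j0: "?h (R 0) (R j) = 0" "?h (R j) (R 0) = 0" if "j \<in> {2, 3}" for j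
        using on[of 0 j] herm_commute[of "2 * n" "R j" "R 0"] that by auto
      have jj: "?h (R 2) (R 2) = 1" "?h (R 3) (R 3) = 1" "?h (R 2) (R 3) = 0" "?h (R 3) (R 2) = 0"
        using on[of 2 2] on[of 3 3] on[of 2 3] on[of 3 2] by auto
      have less4: "i < 4 \<Longrightarrow> i = 0 \<or> i = 1 \<or> i = 2 \<or> i = 3" for i :: nat by linarith
      have "orthonormal_rows (2 * n) Q"
        unfolding orthonormal_rows_def
      proof (intro allI impI)
        fix i j :: nat assume "i < 4" "j < 4"
        then show "?h (Q i) (Q j) = (if i = j then 1 else 0)"
          using less4[OF \<open>i < 4\<close>] less4[OF \<open>j < 4\<close>]
          by (elim disjE) (use sA sC in \<open>simp_all add: Q_def sc cs 0 b0 bj jb j0 jj A C mult.assoc\<close>)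
      qed
      from IH[OF this] have le: "minor_sum n Q \<le> 1" .
      have "minor_sum n Q = cmod (sA * sC) * minor_sum n R'"
        unfolding minor_sum_def Q_def R'_def
        by (simp add: pair_minor_scale norm_mult sum_distrib_left)
      also have "cmod (sA * sC) = 1 / sqrt (A * C)"
        using Apos Cpos by (simp add: sA_def sC_def norm_mult norm_divide real_sqrt_mult)
      finally have "minor_sum n R = minor_sum n Q * sqrt (A * C)"
        using eq Apos Cpos by (simp add: field_simps)
      also have "\<dots> \<le> 1 * sqrt (A * C)" using le by (intro mult_right_mono) (use Apos Cpos in auto)
      finally have "minor_sum n R \<le> sqrt (A * C)" by simp
      then have "(minor_sum n R)\<^sup>2 \<le> (sqrt (A * C))\<^sup>2"
        by (rule power_mono) (auto simp: minor_sum_def intro!: sum_nonneg)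
      then show ?thesis using goal Apos Cpos by (simp add: g_def)
    qed
  qed
qed

text \<open>Once rows 2 and 3 vanish on the last block, a minor using that block is
  \<open>\<mu>\<close> times a block minor of rows 2 and 3, so these minors add up to at most
  \<open>cmod \<mu>\<close>. Cutting the block off leaves rows 0 and 1 with Gram determinant
  \<open>1 - \<alpha> - \<beta> + (cmod \<mu>)\<^sup>2\<close> by the Lagrange identity. This is at
  most \<open>(1 - cmod \<mu>)\<^sup>2\<close>, so the other minors add up to at most
  \<open>1 - cmod \<mu>\<close>.\<close>

theorem minor_sum_le_1:
  assumes "orthonormal_rows (2 * n) R"
  shows "minor_sum n R \<le> 1"
  using assms
proof (induction n arbitrary: R)
  case 0
  show ?case by (simp add: minor_sum_def)
next
  case (Suc n)
  define m where "m = 2 * Suc n"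
  have R: "orthonormal_rows m R" using Suc.prems by (simp add: m_def)
  \<comment> \<open>Rotations with row 0 clear column \<open>2n\<close> in rows 1, 2 and 3; then
    rotations with row 1, already zero there, clear column \<open>2n + 1\<close> in rows 2 and 3
    without spoiling those zeros.\<close>
  obtain R1 where R1: "orthonormal_rows m R1" "minor_sum (Suc n) R1 = minor_sum (Suc n) R" "R1 1 (2 * n) = 0"
    by (rule givens_rotation[OF R, of 0 1 "Suc n" "2 * n"]) auto
  obtain R2 where R2: "orthonormal_rows m R2" "minor_sum (Suc n) R2 = minor_sum (Suc n) R" "R2 2 (2 * n) = 0" "R2 1 (2 * n) = 0"
  proof (rule givens_rotation[OF R1(1), of 0 2 "Suc n" "2 * n"])
    fix R' assume "orthonormal_rows m R'" "minor_sum (Suc n) R' = minor_sum (Suc n) R1" "R' 2 (2 * n) = 0"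
      "\<And>k. k \<noteq> 0 \<Longrightarrow> k \<noteq> 2 \<Longrightarrow> R' k = R1 k"
    then show thesis using R1 by (intro that[of R']) auto
  qed auto
  obtain R3 where R3: "orthonormal_rows m R3" "minor_sum (Suc n) R3 = minor_sum (Suc n) R" "R3 3 (2 * n) = 0" "R3 2 (2 * n) = 0" "R3 1 (2 * n) = 0"
  proof (rule givens_rotation[OF R2(1), of 0 3 "Suc n" "2 * n"])
    fix R' assume "orthonormal_rows m R'" "minor_sum (Suc n) R' = minor_sum (Suc n) R2" "R' 3 (2 * n) = 0"
      "\<And>k. k \<noteq> 0 \<Longrightarrow> k \<noteq> 3 \<Longrightarrow> R' k = R2 k"
    then show thesis using R2 by (intro that[of R']) auto
  qed auto
  obtain R4 where R4: "orthonormal_rows m R4" "minor_sum (Suc n) R4 = minor_sum (Suc n) R" "R4 3 (2 * n) = 0" "R4 2 (2 * n) = 0" "R4 1 (2 * n) = 0"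
     "R4 2 (2 * n + 1) = 0"
  proof (rule givens_rotation[OF R3(1), of 1 2 "Suc n" "2 * n + 1"])
    fix R' assume *: "orthonormal_rows m R'" "minor_sum (Suc n) R' = minor_sum (Suc n) R3" "R' 2 (2 * n + 1) = 0"
      "\<And>k. k \<noteq> 1 \<Longrightarrow> k \<noteq> 2 \<Longrightarrow> R' k = R3 k" "\<And>p. R3 1 p = 0 \<Longrightarrow> R3 2 p = 0 \<Longrightarrow> R' 1 p = 0 \<and> R' 2 p = 0"
    show thesis using R3 * *(5)[of "2 * n"] by (intro that[of R']) auto
  qed auto
  obtain Q where Q: "orthonormal_rows m Q" "minor_sum (Suc n) Q = minor_sum (Suc n) R" "Q 3 (2 * n) = 0" "Q 2 (2 * n) = 0" "Q 1 (2 * n) = 0"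
     "Q 2 (2 * n + 1) = 0" "Q 3 (2 * n + 1) = 0"
  proof (rule givens_rotation[OF R4(1), of 1 3 "Suc n" "2 * n + 1"])
    fix R' assume *: "orthonormal_rows m R'" "minor_sum (Suc n) R' = minor_sum (Suc n) R4" "R' 3 (2 * n + 1) = 0"
      "\<And>k. k \<noteq> 1 \<Longrightarrow> k \<noteq> 3 \<Longrightarrow> R' k = R4 k" "\<And>p. R4 1 p = 0 \<Longrightarrow> R4 3 p = 0 \<Longrightarrow> R' 1 p = 0 \<and> R' 3 p = 0"
    show thesis using R4 * *(5)[of "2 * n"] by (intro that[of R']) auto
  qed auto
  have split: "herm m x y = herm (2 * n) x y + (cnj (x (2 * n)) * y (2 * n) + cnj (x (2 * n + 1)) * y (2 * n + 1))" for x y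
    by (simp add: m_def herm_def add.assoc)
  have on: "herm m (Q i) (Q j) = (if i = j then 1 else 0)" if "i < 4" "j < 4" for i j
    using Q(1) that by (simp add: orthonormal_rows_def)
  define \<mu> where "\<mu> = block_minor (Q 0) (Q 1) n"
  define \<alpha> \<beta> where "\<alpha> = (cmod (Q 0 (2 * n)))\<^sup>2 + (cmod (Q 0 (2 * n + 1)))\<^sup>2"
    and "\<beta> = (cmod (Q 1 (2 * n)))\<^sup>2 + (cmod (Q 1 (2 * n + 1)))\<^sup>2"
  have sq: "cnj z * z = of_real ((cmod z)\<^sup>2)" for z by (metis complex_norm_square mult.commute)
  have AB: "herm (2 * n) (Q 0) (Q 0) = of_real (1 - \<alpha>)" "herm (2 * n) (Q 1) (Q 1) = of_real (1 - \<beta>)"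
    using split[of "Q 0" "Q 0"] split[of "Q 1" "Q 1"] on[of 0 0] on[of 1 1] unfolding \<alpha>_def \<beta>_def sq
    by (simp_all add: algebra_simps)
  have g: "herm (2 * n) (Q 0) (Q 1) = - (cnj (Q 0 (2 * n)) * Q 1 (2 * n) + cnj (Q 0 (2 * n + 1)) * Q 1 (2 * n + 1))"
    using split[of "Q 0" "Q 1"] on[of 0 1] by (simp add: add_eq_0_iff2)
  have lag: "(cmod (herm (2 * n) (Q 0) (Q 1)))\<^sup>2 + (cmod \<mu>)\<^sup>2 = \<alpha> * \<beta>"
    unfolding g norm_minus_cancel \<mu>_def block_minor_def \<alpha>_def \<beta>_def by (rule lagrange_identity)
  have ge0: "0 \<le> 1 - \<alpha>" "0 \<le> 1 - \<beta>"
    using AB unfolding herm_self of_real_eq_iff by (metis sum_nonneg zero_le_power2)+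
  have mu2: "2 * cmod \<mu> \<le> \<alpha> + \<beta>"
    using block_minor_le[of "Q 0" "Q 1" n] by (simp add: \<mu>_def \<alpha>_def \<beta>_def)
  have "(minor_sum n Q)\<^sup>2 \<le> (1 - \<alpha>) * (1 - \<beta>) - (cmod (herm (2 * n) (Q 0) (Q 1)))\<^sup>2"
  proof (rule minor_sum_le_gram[OF Suc.IH AB])
    fix i j :: nat assume "i < 4" "j \<in> {2, 3}"
    then show "herm (2 * n) (Q i) (Q j) = (if i = j then 1 else 0)"
      using split[of "Q i" "Q j"] on[of i j] Q by auto
  qed
  also have "\<dots> = 1 - \<alpha> - \<beta> + (cmod \<mu>)\<^sup>2" using lag by (simp add: algebra_simps)
  \<comment> \<open>The difference of the two sides is
    \<open>\<alpha> + \<beta> - 2 * cmod \<mu>\<close>.\<close>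
  also have "\<dots> \<le> (1 - cmod \<mu>)\<^sup>2" using mu2 by (simp add: power2_eq_square algebra_simps)
  \<comment> \<open>Taking roots needs \<open>cmod \<mu> \<le> 1\<close>, which follows from
    \<open>\<alpha> \<le> 1\<close> and \<open>\<beta> \<le> 1\<close>.\<close>
  finally have rest: "minor_sum n Q \<le> 1 - cmod \<mu>"
    by (rule power2_le_imp_le) (use mu2 ge0 in simp)
  have on2: "herm (2 * n) (Q 2) (Q 2) = 1" "herm (2 * n) (Q 3) (Q 3) = 1"
    using split[of "Q 2" "Q 2"] split[of "Q 3" "Q 3"] on[of 2 2] on[of 3 3] Q by auto
  have "pair_minor (Q 0) (Q 1) (Q 2) (Q 3) k n = \<mu> * block_minor (Q 2) (Q 3) k" for k
    using Q by (simp add: pair_minor_def \<mu>_def block_minor_def)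
  then have "minor_sum (Suc n) Q = minor_sum n Q + cmod \<mu> * (\<Sum>k<n. cmod (block_minor (Q 2) (Q 3) k))"
    by (simp add: minor_sum_def norm_mult sum_distrib_left)
  also have "\<dots> \<le> (1 - cmod \<mu>) + cmod \<mu> * 1"
    using rest sum_block_minor_le[OF on2] by (intro add_mono mult_left_mono) auto
  finally show ?case using Q(2) by simp
qed

section \<open>Words in covectors\<close>

lemma cdet_permute:
  assumes p: "p permutes {..<length zs}"
  shows "cdet (map (\<lambda>i. zs ! p i) [0..<length zs]) v = of_int (sign p) * cdet zs v"
proof -
  let ?n = "length zs" and ?A = "Matrix.mat (length zs) (length zs) (\<lambda>(i, j). (zs ! i) (v j))"
  have "p permutes {0..<?n}" using p by (simp add: atLeast0LessThan)
  from det_permute_rows[OF _ this, of ?A]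
  have "Determinant.det (Matrix.mat ?n ?n (\<lambda>(i, j). ?A $$ (p i, j))) = of_int (sign p) * Determinant.det ?A" by simp
  moreover have "Matrix.mat ?n ?n (\<lambda>(i, j). ?A $$ (p i, j)) =
    Matrix.mat ?n ?n (\<lambda>(i, j). (map (\<lambda>i. zs ! p i) [0..<?n] ! i) (v j))"
    using permutes_in_image[OF p] by (intro eq_matI) auto
  ultimately show ?thesis by (simp add: cdet_def)
qed

lemma cdet_swap: "cdet (xs @ a # b # ys) v = - cdet (xs @ b # a # ys) v"
proof -
  let ?zs = "xs @ b # a # ys" and ?k = "length xs"
  let ?p = "Transposition.transpose ?k (Suc ?k)"
  have p: "?p permutes {..<length ?zs}" by (intro permutes_swap_id) auto
  have "map (\<lambda>i. ?zs ! ?p i) [0..<length ?zs] = xs @ a # b # ys"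
  proof (rule nth_equalityI)
    fix i assume i: "i < length (map (\<lambda>i. ?zs ! ?p i) [0..<length ?zs])"
    consider "i < ?k" | "i = ?k" | "i = Suc ?k" | "i > Suc ?k" by linarith
    then show "map (\<lambda>i. ?zs ! ?p i) [0..<length ?zs] ! i = (xs @ a # b # ys) ! i"
    proof cases
      case 4
      then obtain d where "i = Suc (Suc ?k) + d" by (metis Suc_leI le_iff_add)
      then show ?thesis using i by (simp add: nth_append del: upt_Suc)
    qed (use i in \<open>auto simp: nth_append simp del: upt_Suc\<close>)
  qed auto
  then show ?thesis using cdet_permute[OF p, of v] by (simp add: sign_swap_id del: upt_Suc)
qed

text \<open>A product of two covectors is even: it passes any other covector at the cost of two sign
  changes.\<close>

lemma cdet_pair_move: "cdet (xs @ us @ a # b # ys) v = cdet (xs @ a # b # us @ ys) v"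
proof (induction us arbitrary: xs)
  case (Cons u us)
  have "cdet (xs @ (u # us) @ a # b # ys) v = cdet ((xs @ [u]) @ a # b # us @ ys) v"
    using Cons.IH[of "xs @ [u]"] by simp
  also have "\<dots> = - cdet ((xs @ [a]) @ u # b # us @ ys) v"
    using cdet_swap[of xs u a] by simp
  also have "\<dots> = cdet ((xs @ [a]) @ b # u # us @ ys) v"
    using cdet_swap[of "xs @ [a]" u b] by simp
  finally show ?case by simp
qed simp

lemma cdet_not_distinct:
  assumes "\<not> distinct zs"
  shows "cdet zs v = 0"
proof -
  obtain i j where ij: "i < length zs" "j < length zs" "i \<noteq> j" "zs ! i = zs ! j"
    using assms by (auto simp: distinct_conv_nth)
  show ?thesis unfolding cdet_def
    by (rule det_identical_rows[OF _ ij(3) ij(1,2)]) (use ij in \<open>auto simp: Matrix.row_def intro!: eq_vecI\<close>)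
qed

text \<open>The matrix is block upper triangular; the primed version below is the block lower
  triangular case.\<close>

lemma cdet_append_block:
  fixes zs ys :: "('a \<Rightarrow> 'b::idom) list"
  assumes "\<And>y j. y \<in> set ys \<Longrightarrow> j < length zs \<Longrightarrow> y (v j) = 0"
  shows "cdet (zs @ ys) v = cdet zs v * cdet ys (\<lambda>j. v (length zs + j))"
proof -
  let ?n = "length zs" and ?m = "length ys"
  let ?A = "Matrix.mat ?n ?n (\<lambda>(i, j). (zs ! i) (v j))"
    and ?B = "Matrix.mat ?n ?m (\<lambda>(i, j). (zs ! i) (v (?n + j)))"
    and ?C = "Matrix.mat ?m ?n (\<lambda>(i, j). (ys ! i) (v j))"
    and ?D = "Matrix.mat ?m ?m (\<lambda>(i, j). (ys ! i) (v (?n + j)))"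
  have "Matrix.mat (length (zs @ ys)) (length (zs @ ys)) (\<lambda>(i, j). ((zs @ ys) ! i) (v j)) =
      four_block_mat ?A ?B ?C ?D"
    by (rule eq_matI) (auto simp: four_block_mat_def nth_append Let_def)
  moreover have "?C = 0\<^sub>m ?m ?n" by (rule eq_matI) (auto simp: assms)
  ultimately show ?thesis
    unfolding cdet_def using det_four_block_mat_lower_left_zero[of ?A ?n ?B ?m ?C ?D] by simp
qed

lemma cdet_append_block':
  fixes zs ys :: "('a \<Rightarrow> 'b::idom) list"
  assumes "\<And>z j. z \<in> set zs \<Longrightarrow> j < length ys \<Longrightarrow> z (v (length zs + j)) = 0"
  shows "cdet (zs @ ys) v = cdet zs v * cdet ys (\<lambda>j. v (length zs + j))"
proof -
  let ?n = "length zs" and ?m = "length ys"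
  let ?A = "Matrix.mat ?n ?n (\<lambda>(i, j). (zs ! i) (v j))"
    and ?B = "Matrix.mat ?n ?m (\<lambda>(i, j). (zs ! i) (v (?n + j)))"
    and ?C = "Matrix.mat ?m ?n (\<lambda>(i, j). (ys ! i) (v j))"
    and ?D = "Matrix.mat ?m ?m (\<lambda>(i, j). (ys ! i) (v (?n + j)))"
  have "Matrix.mat (length (zs @ ys)) (length (zs @ ys)) (\<lambda>(i, j). ((zs @ ys) ! i) (v j)) =
      four_block_mat ?A ?B ?C ?D"
    by (rule eq_matI) (auto simp: four_block_mat_def nth_append Let_def)
  moreover have "?B = 0\<^sub>m ?n ?m" by (rule eq_matI) (auto simp: assms)
  ultimately show ?thesis
    unfolding cdet_def using det_four_block_mat_upper_right_zero[of ?A ?n ?B ?m ?C ?D] by simp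
qed

text \<open>Evaluation at a vector is a functional on covectors, so vectors and covectors can trade
  places. Rules for moving covectors thereby become rules for moving vectors.\<close>

lemma cdet_transpose:
  assumes "length vs = length zs"
  shows "cdet zs ((!) vs) = cdet (map (\<lambda>v z. z v) vs) ((!) zs)"
proof -
  let ?n = "length zs"
  let ?A = "Matrix.mat ?n ?n (\<lambda>(i, j). (zs ! i) (vs ! j))"
  have "Matrix.mat ?n ?n (\<lambda>(i, j). (map (\<lambda>v z. z v) vs ! i) (zs ! j)) = transpose_mat ?A"
    by (rule eq_matI) (auto simp: assms)
  then show ?thesis using det_transpose[of ?A ?n] by (simp add: cdet_def assms)
qed

lemma cdet_vec_pair_move:
  assumes "length zs = length xs + length us + length ys + 2"
  shows "cdet zs ((!) (xs @ us @ a # b # ys)) = cdet zs ((!) (xs @ a # b # us @ ys))"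
  using assms cdet_pair_move[of "map (\<lambda>v z. z v) xs" "map (\<lambda>v z. z v) us" "\<lambda>z. z a" "\<lambda>z. z b"
      "map (\<lambda>v z. z v) ys" "(!) zs"]
  by (simp add: cdet_transpose[of "xs @ us @ a # b # ys" zs] cdet_transpose[of "xs @ a # b # us @ ys" zs])

section \<open>Laplace expansion in degree up to four, and changes of covectors\<close>

lemma cdet_Cons:
  "cdet (z # zs) v = (\<Sum>j\<le>length zs. (-1) ^ j * z (v j) * cdet zs (\<lambda>i. v (if i < j then i else Suc i)))"
proof -
  let ?n = "Suc (length zs)"
  let ?A = "Matrix.mat ?n ?n (\<lambda>(i, j). ((z # zs) ! i) (v j))"
  have "cdet (z # zs) v = (\<Sum>j<?n. ?A $$ (0, j) * cofactor ?A 0 j)"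
    unfolding cdet_def by (subst laplace_expansion_row[of _ ?n 0]) auto
  also have "\<dots> = (\<Sum>j<?n. (-1) ^ j * z (v j) * cdet zs (\<lambda>i. v (if i < j then i else Suc i)))"
  proof (intro sum.cong refl)
    fix j assume j: "j \<in> {..<?n}"
    have "mat_delete ?A 0 j = Matrix.mat (length zs) (length zs) (\<lambda>(i, k). (zs ! i) (v (if k < j then k else Suc k)))"
      using j by (intro eq_matI) (auto simp: mat_delete_def)
    then show "?A $$ (0, j) * cofactor ?A 0 j = (-1) ^ j * z (v j) * cdet zs (\<lambda>i. v (if i < j then i else Suc i))"
      using j by (simp add: cofactor_def cdet_def)
  qed
  finally show ?thesis by (simp add: lessThan_Suc_atMost)
qed

lemma cdet_2: "cdet [a, b] v = a (v 0) * b (v 1) - a (v 1) * b (v 0)"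
  by (simp add: cdet_Cons atMost_Suc)

lemma cdet_3:
  "cdet [a, b, c] v = a (v 0) * (b (v 1) * c (v 2) - b (v 2) * c (v 1))
    - a (v 1) * (b (v 0) * c (v 2) - b (v 2) * c (v 0)) + a (v 2) * (b (v 0) * c (v 1) - b (v 1) * c (v 0))"
  by (subst cdet_Cons) (simp add: atMost_Suc cdet_2 numeral_2_eq_2)

lemma cdet_4_Cons:
  "cdet [a, b, c, d] v =
      a (v 0) * cdet [b, c, d] (\<lambda>i. v (Suc i)) - a (v 1) * cdet [b, c, d] (\<lambda>i. v (if i < 1 then i else Suc i))
    + a (v 2) * cdet [b, c, d] (\<lambda>i. v (if i < 2 then i else Suc i))
    - a (v 3) * cdet [b, c, d] (\<lambda>i. v (if i < 3 then i else Suc i))"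
  by (subst cdet_Cons) (simp add: atMost_Suc numeral_2_eq_2 numeral_3_eq_3)

lemma cdet_4:
  fixes a b c d :: "'a \<Rightarrow> complex"
  shows "cdet [a, b, c, d] ((!) [w, x, y, z]) =
     (a w * b x - a x * b w) * (c y * d z - c z * d y) - (a w * c x - a x * c w) * (b y * d z - b z * d y)
   + (a w * d x - a x * d w) * (b y * c z - b z * c y) + (b w * c x - b x * c w) * (a y * d z - a z * d y)
   - (b w * d x - b x * d w) * (a y * c z - a z * c y) + (c w * d x - c x * d w) * (a y * b z - a z * b y)"
  unfolding cdet_4_Cons cdet_3
  by simp (simp only: ring_distribs diff_conv_add_uminus minus_mult_left[symmetric] minus_mult_right[symmetric]
    minus_minus minus_add_distrib ac_simps)

lemma cdet_pair_minor:
  "cdet [a, b, c, d] ((!) [v (2 * k), v (2 * k + 1), v (2 * l), v (2 * l + 1)]) =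
   pair_minor (\<lambda>j. a (v j)) (\<lambda>j. b (v j)) (\<lambda>j. c (v j)) (\<lambda>j. d (v j)) k l"
  unfolding cdet_4 pair_minor_def block_minor_def ..

lemma cdet_dual_basis:
  assumes "\<And>i j. i < length zs \<Longrightarrow> j < length zs \<Longrightarrow> (zs ! i) (v j) = (if i = j then 1 else 0)"
  shows "cdet zs v = 1"
proof -
  have "Matrix.mat (length zs) (length zs) (\<lambda>(i, j). (zs ! i) (v j)) = 1\<^sub>m (length zs)"
    by (rule eq_matI) (auto simp: assms)
  then show ?thesis by (simp add: cdet_def)
qed

text \<open>The counterpart of \<open>cdet_mat_mult\<close>: the covectors change and the vectors
  stay.\<close>

lemma cdet_lincomb:
  fixes ys zs :: "('a \<Rightarrow> 'b::comm_ring_1) list"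
  assumes "length ys = length zs"
    and "\<And>i j. i < length zs \<Longrightarrow> j < length zs \<Longrightarrow> (ys ! i) (v j) = (\<Sum>k<length zs. N i k * (zs ! k) (v j))"
  shows "cdet ys v = Determinant.det (Matrix.mat (length zs) (length zs) (\<lambda>(i, j). N i j)) * cdet zs v"
proof -
  let ?n = "length zs"
  have "Matrix.mat ?n ?n (\<lambda>(i, j). (ys ! i) (v j)) =
      Matrix.mat ?n ?n (\<lambda>(i, j). N i j) * Matrix.mat ?n ?n (\<lambda>(i, j). (zs ! i) (v j))"
    by (rule eq_matI) (auto simp: assms scalar_prod_def atLeast0LessThan)
  then show ?thesis unfolding cdet_def assms(1) by (simp add: det_mult[of _ ?n])
qed

lemma det_conj_transpose:
  "Determinant.det (Matrix.mat (length zs) (length zs) (\<lambda>(i, j). cnj ((zs ! j) (v i)))) = cnj (cdet zs v)"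
proof -
  let ?n = "length zs"
  let ?A = "Matrix.mat ?n ?n (\<lambda>(i, j). cnj ((zs ! i) (v j)))"
  have "Matrix.mat ?n ?n (\<lambda>(i, j). cnj ((zs ! j) (v i))) = transpose_mat ?A"
    by (rule eq_matI) auto
  moreover have "Matrix.mat ?n ?n (\<lambda>(i, j). (map (\<lambda>z x. cnj (z x)) zs ! i) (v j)) = ?A"
    by (rule eq_matI) auto
  ultimately show ?thesis using det_transpose[of ?A ?n] unfolding cnj_cdet by (simp add: cdet_def)
qed

text \<open>The word of a product of 2-forms \<open>a j \<and> b j\<close>. It serves for the
  coordinates with their conjugates, for the dual covectors of a normal frame, and for vectors taken
  in pairs.\<close>

definition pair_word :: "(nat \<Rightarrow> 'c) \<Rightarrow> (nat \<Rightarrow> 'c) \<Rightarrow> nat list \<Rightarrow> 'c list" where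
  "pair_word a b js = concat (map (\<lambda>j. [a j, b j]) js)"

lemma pair_word_simps [simp]:
  "pair_word a b [] = []" "pair_word a b (j # js) = a j # b j # pair_word a b js"
  "pair_word a b (js @ ks) = pair_word a b js @ pair_word a b ks"
  "length (pair_word a b js) = 2 * length js"
  by (simp_all add: pair_word_def length_concat comp_def sum_list_triv)

lemma set_pair_word: "set (pair_word a b js) = a ` set js \<union> b ` set js"
  by (auto simp: pair_word_def)

lemma distinct_pair_wordD:
  assumes "distinct (pair_word a b js)"
  shows "distinct js"
  using assms by (induction js) (auto simp: set_pair_word)

text \<open>Products of two covectors commute, so only the multiset of indices counts.\<close>

lemma cdet_pair_word_mset:
  "mset js = mset ks \<Longrightarrow> cdet (xs @ pair_word a b js) v = cdet (xs @ pair_word a b ks) v"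
proof (induction js arbitrary: xs ks)
  case (Cons j js)
  have "j \<in> set ks" using Cons.prems by (metis list.set_intros(1) set_mset_mset)
  then obtain us ws where ks: "ks = us @ j # ws" by (metis split_list)
  then have "mset js = mset (us @ ws)" using Cons.prems by simp
  from Cons.IH[OF this, of "xs @ [a j, b j]"] show ?case
    using cdet_pair_move[of xs "pair_word a b us" "a j" "b j" "pair_word a b ws" v] by (simp add: ks)
qed simp

text \<open>Powers are expanded over all words of indices, without collecting equal terms;
  factorials appear when distinct words are counted in \<open>sum_words_distinct\<close>.\<close>

definition words :: "nat \<Rightarrow> nat set \<Rightarrow> nat list set" where
  "words n J = {js. set js \<subseteq> J \<and> length js = n}"

lemma finite_words [simp]: "finite J \<Longrightarrow> finite (words n J)"
  unfolding words_def by (rule finite_lists_length_eq)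

lemma sum_words_add:
  fixes f :: "nat list \<Rightarrow> 'c::comm_monoid_add"
  shows "(\<Sum>js\<in>words (m + n) J. f js) = (\<Sum>js\<in>words m J. \<Sum>ks\<in>words n J. f (js @ ks))"
proof -
  have "bij_betw (\<lambda>(js, ks). js @ ks) (words m J \<times> words n J) (words (m + n) J)"
    by (rule bij_betw_byWitness[where f' = "\<lambda>xs. (take m xs, drop m xs)"])
      (auto simp: words_def dest: in_set_takeD in_set_dropD)
  then have "(\<Sum>js\<in>words (m + n) J. f js) = (\<Sum>(js, ks)\<in>words m J \<times> words n J. f (js @ ks))"
    by (subst sum.reindex_bij_betw[symmetric]) (auto simp: case_prod_unfold)
  then show ?thesis by (simp add: sum.cartesian_product)
qed

lemma sum_words_1:
  "(\<Sum>js\<in>words (Suc 0) J. f js) = (\<Sum>j\<in>J. f [j])"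
proof -
  have "words (Suc 0) J = (\<lambda>j. [j]) ` J" by (auto simp: words_def length_Suc_conv)
  then show ?thesis by (simp add: sum.reindex inj_on_def)
qed

lemma words_0 [simp]: "words 0 J = {[]}" by (auto simp: words_def)

lemma wedge_power_pair_sum:
  fixes a b :: "nat \<Rightarrow> 'a \<Rightarrow> 'b::field_char_0"
  shows "wedge_power 2 (\<lambda>v. \<Sum>j\<in>J. c j * cdet [a j, b j] v) n =
    (\<lambda>v. \<Sum>js\<in>words n J. prod_list (map c js) * cdet (pair_word a b js) v)"
proof (induction n)
  case (Suc n)
  have "wedge (2 * n) 2 (\<lambda>v. \<Sum>js\<in>words n J. prod_list (map c js) * cdet (pair_word a b js) v)
      (\<lambda>v. \<Sum>j\<in>J. c j * cdet [a j, b j] v) =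
     (\<lambda>v. \<Sum>js\<in>words n J. \<Sum>j\<in>J. prod_list (map c js) * (c j * wedge (2 * n) 2 (cdet (pair_word a b js)) (cdet [a j, b j]) v))"
    by (simp add: wedge_sum_left wedge_sum_right wedge_scale_left wedge_scale_right sum_distrib_left)
  also have "\<dots> = (\<lambda>v. \<Sum>js\<in>words n J. \<Sum>j\<in>J. prod_list (map c (js @ [j])) * cdet (pair_word a b (js @ [j])) v)"
  proof (intro ext sum.cong refl)
    fix v js j assume "js \<in> words n J"
    then have "length (pair_word a b js) = 2 * n" by (simp add: words_def)
    then have "wedge (2 * n) 2 (cdet (pair_word a b js)) (cdet [a j, b j]) = cdet (pair_word a b (js @ [j]))"
      using wedge_cdet[of "pair_word a b js" "[a j, b j]"] by (simp add: numeral_2_eq_2)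
    then show "prod_list (map c js) * (c j * wedge (2 * n) 2 (cdet (pair_word a b js)) (cdet [a j, b j]) v) =
        prod_list (map c (js @ [j])) * cdet (pair_word a b (js @ [j])) v" by (simp add: mult.assoc)
  qed
  also have "\<dots> = (\<lambda>v. \<Sum>js\<in>words (n + Suc 0) J. prod_list (map c js) * cdet (pair_word a b js) v)"
    unfolding sum_words_add[where m = n and n = "Suc 0"] sum_words_1 ..
  finally show ?case by (simp add: Suc)
qed simp

text \<open>Over an alphabet of \<open>n\<close> letters the distinct words of length
  \<open>n\<close> are its \<open>n!\<close> orderings.\<close>

lemma sum_words_distinct:
  fixes f :: "nat list \<Rightarrow> 'c::semiring_char_0"
  assumes "finite J" "card J = n"
    and "\<And>js. js \<in> words n J \<Longrightarrow> \<not> distinct js \<Longrightarrow> f js = 0"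
    and "\<And>js. js \<in> words n J \<Longrightarrow> distinct js \<Longrightarrow> f js = A"
  shows "(\<Sum>js\<in>words n J. f js) = fact n * A"
proof -
  have "(\<Sum>js\<in>words n J. f js) = (\<Sum>js\<in>{js. length js = n \<and> distinct js \<and> set js \<subseteq> J}. f js)"
    using assms finite_words[of J n] by (intro sum.mono_neutral_right) (auto simp: words_def)
  also have "\<dots> = (\<Sum>js\<in>{js. length js = n \<and> distinct js \<and> set js \<subseteq> J}. A)"
    using assms by (intro sum.cong) (auto simp: words_def)
  also have "card {js. length js = n \<and> distinct js \<and> set js \<subseteq> J} = fact n"
    using card_lists_distinct_length_eq[OF assms(1), of n] assms(2) by (simp add: fact_prod)
  then have "(\<Sum>js\<in>{js. length js = n \<and> distinct js \<and> set js \<subseteq> J}. A) = fact n * A"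
    by (simp add: of_nat_fact)
  finally show ?thesis .
qed

section \<open>Unitary coordinates\<close>

declare upt_rec_numeral [simp del]

text \<open>The type \<open>'e\<close> has only a real structure, so all complex data are carried by
  the coordinates. Complex combinations of vectors are prescribed through \<open>surj_z\<close>,
  which together with \<open>inner_z\<close> also fixes the complex dimension 8.\<close>

locale unitary_coordinates =
  fixes z :: "nat \<Rightarrow> 'e::euclidean_space \<Rightarrow> complex"
  assumes linear_z: "i < 8 \<Longrightarrow> linear (z i)"
    and inner_z: "x \<bullet> y = (\<Sum>i<8. Re (cnj (z i x) * z i y))"
    and surj_z: "\<exists>x. \<forall>i<8. z i x = c i"
begin

definition h :: "'e \<Rightarrow> 'e \<Rightarrow> complex" where
  "h x y = (\<Sum>i<8. cnj (z i x) * z i y)"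

definition unitary :: "(nat \<Rightarrow> 'e) \<Rightarrow> bool" where
  "unitary u \<longleftrightarrow> (\<forall>i<8. \<forall>j<8. h (u i) (u j) = (if i = j then 1 else 0))"

lemma Re_h: "Re (h x y) = x \<bullet> y"
  by (simp add: h_def inner_z)

lemma h_commute: "h y x = cnj (h x y)"
  by (simp add: h_def mult.commute)

lemma h_self: "h x x = of_real (x \<bullet> x)"
  by (metis Re_h complex_cnj_cancel_iff complex_is_Real_iff h_commute of_real_Re Reals_cnj_iff)

lemma h_lincomb_right:
  "(\<And>i. i < 8 \<Longrightarrow> z i y = a * z i v + b * z i w) \<Longrightarrow> h x y = a * h x v + b * h x w"
  by (simp add: h_def sum.distrib sum_distrib_left algebra_simps)

lemma h_lincomb_left:
  "(\<And>i. i < 8 \<Longrightarrow> z i y = a * z i v + b * z i w) \<Longrightarrow> h y x = cnj a * h v x + cnj b * h w x"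
  by (simp add: h_def sum.distrib sum_distrib_left algebra_simps)

lemma h_scaleR: "h x (r *\<^sub>R y) = of_real r * h x y" "h (r *\<^sub>R x) y = of_real r * h x y"
  by (simp_all add: h_def linear_scale[OF linear_z] scaleR_conv_of_real sum_distrib_left mult_ac)

lemma bounded_bilinear_Im_h: "bounded_bilinear (\<lambda>x y. Im (h x y))"
proof -
  have "bilinear (\<lambda>x y. Im (h x y))"
    by (auto simp: bilinear_def h_def linear_add[OF linear_z] linear_scale[OF linear_z] scaleR_conv_of_real
      algebra_simps sum.distrib sum_subtractf sum_distrib_left intro!: linearI)
  then show ?thesis by (simp add: bilinear_conv_bounded_bilinear)
qed

text \<open>The orthogonality conditions form a square homogeneous system whose row \<open>k\<close>
  is zero; its determinant vanishes, so there is a nontrivial solution.\<close>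

lemma exists_orthogonal_unit:
  fixes I :: "nat set"
  assumes "k < 8" "k \<notin> I"
  shows "\<exists>x. h x x = 1 \<and> (\<forall>i\<in>I. i < 8 \<longrightarrow> h (u i) x = 0)"
proof -
  let ?A = "Matrix.mat 8 8 (\<lambda>(i, j). if i \<in> I then cnj (z j (u i)) else 0)"
  have "\<exists>v. v \<in> carrier_vec 8 \<and> v \<noteq> 0\<^sub>v 8 \<and> ?A *\<^sub>v v = 0\<^sub>v 8"
  proof (subst det_0_iff_vec_prod_zero_field[symmetric])
    have "Determinant.det ?A = (\<Sum>j<8. ?A $$ (k, j) * cofactor ?A k j)"
      by (rule laplace_expansion_row) (use assms in auto)
    also have "\<dots> = 0" using assms by (intro sum.neutral) auto
    finally show "Determinant.det ?A = 0" .
  qed auto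
  then obtain v where v: "v \<in> carrier_vec 8" "v \<noteq> 0\<^sub>v 8" "?A *\<^sub>v v = 0\<^sub>v 8" by blast
  obtain x where x: "\<And>i. i < 8 \<Longrightarrow> z i x = vec_index v i" using surj_z by metis
  have orth: "h (u i) x = 0" if "i \<in> I" "i < 8" for i
  proof -
    have "vec_index (?A *\<^sub>v v) i = (\<Sum>j<8. cnj (z j (u i)) * vec_index v j)"
      using that v(1) by (simp add: scalar_prod_def atLeast0LessThan)
    then show ?thesis using that v(3) by (simp add: h_def x)
  qed
  have "x \<noteq> 0"
  proof
    assume "x = 0"
    then have "vec_index v i = 0" if "i < 8" for i using x[OF that] linear_0[OF linear_z[OF that]] by simp
    then have "v = 0\<^sub>v 8" using v(1) by (intro eq_vecI) auto
    then show False using v(2) by simp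
  qed
  then show ?thesis
    by (intro exI[of _ "x /\<^sub>R norm x"]) (auto simp: h_scaleR h_self orth dot_square_norm power2_eq_square)
qed

lemma extend_unitary:
  assumes "I \<subseteq> {..<8}" and "\<And>i j. i \<in> I \<Longrightarrow> j \<in> I \<Longrightarrow> h (u i) (u j) = (if i = j then 1 else 0)"
  shows "\<exists>u'. (\<forall>i\<in>I. u' i = u i) \<and> unitary u'"
  using assms
proof (induction "card ({..<8} - I)" arbitrary: I u)
  case 0
  then have "I = {..<8}" by auto
  then show ?case using 0 by (intro exI[of _ u]) (auto simp: unitary_def)
next
  case (Suc n)
  then obtain k where k: "k < 8" "k \<notin> I" by (metis Diff_iff all_not_in_conv card.empty lessThan_iff nat.distinct(1))
  obtain x where x: "h x x = 1" "\<And>i. i \<in> I \<Longrightarrow> h (u i) x = 0"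
    using exists_orthogonal_unit[OF k, of u] Suc.prems(1) by blast
  have x': "h x (u i) = 0" if "i \<in> I" for i using x(2)[OF that] h_commute[of x "u i"] by simp
  have "{..<8} - insert k I = ({..<8} - I) - {k}" by auto
  then have "n = card ({..<8} - insert k I)" using Suc.hyps(2) k by simp
  moreover have "insert k I \<subseteq> {..<8}" using Suc.prems k by auto
  moreover have "h ((u(k := x)) i) ((u(k := x)) j) = (if i = j then 1 else 0)" if "i \<in> insert k I" "j \<in> insert k I" for i j
    using that x x' Suc.prems(2)[of i j] k by auto
  ultimately obtain u' where "\<forall>i\<in>insert k I. u' i = (u(k := x)) i" "unitary u'"
    using Suc.hyps(1)[of "insert k I" "u(k := x)"] by blast
  then show ?case using k by (intro exI[of _ u']) auto
qed

text \<open>The vector \<open>r k\<close>, with the coordinates of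
  \<open>w (2k + 1) - \<i> c\<^sub>k w (2k)\<close>, is the part of \<open>w (2k + 1)\<close> that
  is \<open>h\<close>-orthogonal to \<open>w (2k)\<close>. Its squared norm is
  \<open>1 - c\<^sub>k\<^sup>2\<close>, and different blocks are already
  \<open>h\<close>-orthogonal, so normalizing the nonzero \<open>r k\<close> gives the odd members
  of a unitary system.\<close>

lemma normal_frame_unitary:
  assumes w: "\<And>i j. i < 8 \<Longrightarrow> j < 8 \<Longrightarrow> w i \<bullet> w j = (if i = j then 1 else 0)"
    and blocks: "\<And>i j. i < 8 \<Longrightarrow> j < 8 \<Longrightarrow> i div 2 \<noteq> j div 2 \<Longrightarrow> Im (h (w i) (w j)) = 0"
  defines "c \<equiv> \<lambda>k. Im (h (w (2 * k)) (w (2 * k + 1)))"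
  defines "s \<equiv> \<lambda>k. sqrt (1 - (c k)\<^sup>2)"
  obtains u where "unitary u" "\<And>k. k < 4 \<Longrightarrow> (c k)\<^sup>2 \<le> 1" "\<And>k. k < 4 \<Longrightarrow> u (2 * k) = w (2 * k)"
    "\<And>k i. k < 4 \<Longrightarrow> i < 8 \<Longrightarrow> z i (w (2 * k + 1)) = (\<i> * of_real (c k)) * z i (u (2 * k)) + of_real (s k) * z i (u (2 * k + 1))"
proof -
  have "\<exists>r. \<forall>i<8. z i r = (- \<i> * of_real (c k)) * z i (w (2 * k)) + 1 * z i (w (2 * k + 1))" for k
    by (rule surj_z)
  then obtain r where r: "\<And>k i. i < 8 \<Longrightarrow> z i (r k) = (- \<i> * of_real (c k)) * z i (w (2 * k)) + 1 * z i (w (2 * k + 1))"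
    by metis
  have diff: "h (w i) (w j) = 0" if "i < 8" "j < 8" "i div 2 \<noteq> j div 2" for i j
    using that blocks[of i j] w[of i j] by (auto simp: complex_eq_iff Re_h)
  have ee: "h (w (2 * k)) (w (2 * l)) = (if k = l then 1 else 0)" if "k < 4" "l < 4" for k l
    using that diff[of "2 * k" "2 * l"] w[of "2 * k" "2 * l"] by (auto simp: h_self)
  have oo: "h (w (2 * k + 1)) (w (2 * l + 1)) = (if k = l then 1 else 0)" if "k < 4" "l < 4" for k l
    using that diff[of "2 * k + 1" "2 * l + 1"] w[of "2 * k + 1" "2 * l + 1"] by (auto simp: h_self)
  have eo: "h (w (2 * k)) (w (2 * l + 1)) = (if k = l then \<i> * of_real (c k) else 0)" if "k < 4" "l < 4" for k l
  proof (cases "k = l")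
    case True
    then show ?thesis using that w[of "2 * k" "2 * k + 1"] by (simp add: complex_eq_iff Re_h c_def)
  qed (use that diff[of "2 * k" "2 * l + 1"] in auto)
  have oe: "h (w (2 * l + 1)) (w (2 * k)) = (if k = l then - \<i> * of_real (c k) else 0)" if "k < 4" "l < 4" for k l
    unfolding h_commute[of "w (2 * l + 1)"] eo[OF that] by simp
  have er: "h (w (2 * k)) (r l) = 0" if "k < 4" "l < 4" for k l
    using that by (subst h_lincomb_right[OF r]) (auto simp: ee eo[simplified])
  have re: "h (r l) (w (2 * k)) = 0" if "k < 4" "l < 4" for k l
    using er[OF that] h_commute[of "r l" "w (2 * k)"] by simp
  have rr: "h (r k) (r l) = (if k = l then of_real (1 - (c k)\<^sup>2) else 0)" if "k < 4" "l < 4" for k l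
  proof -
    have "h (r k) (r l) = cnj (- \<i> * of_real (c k)) * h (w (2 * k)) (r l) + cnj 1 * h (w (2 * k + 1)) (r l)"
      by (rule h_lincomb_left[OF r])
    also have "\<dots> = h (w (2 * k + 1)) (r l)" using er that by simp
    also have "\<dots> = (- \<i> * of_real (c l)) * h (w (2 * k + 1)) (w (2 * l)) + 1 * h (w (2 * k + 1)) (w (2 * l + 1))"
      by (rule h_lincomb_right[OF r])
    also have "\<dots> = (if k = l then of_real (1 - (c k)\<^sup>2) else 0)"
      unfolding oo[OF that] oe[OF that(2,1)] by (auto simp: power2_eq_square complex_eq_iff)
    finally show ?thesis .
  qed
  have c1: "(c k)\<^sup>2 \<le> 1" if "k < 4" for k
  proof -
    have "complex_of_real (r k \<bullet> r k) = of_real (1 - (c k)\<^sup>2)" using rr[OF that that] by (simp add: h_self)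
    then have "r k \<bullet> r k = 1 - (c k)\<^sup>2" unfolding of_real_eq_iff .
    then show ?thesis using inner_ge_zero[of "r k"] by linarith
  qed
  have s2: "s k * s k = 1 - (c k)\<^sup>2" if "k < 4" for k using c1[OF that] by (simp add: s_def)
  \<comment> \<open>An odd index is left out if its \<open>r k\<close> is zero. Then
    \<open>extend_unitary\<close> fills the gap with some unit vector, which enters the expansion of
    \<open>w (2 * k + 1)\<close> with coefficient 0.\<close>
  define I where "I = {i. i < 8 \<and> (odd i \<longrightarrow> s (i div 2) \<noteq> 0)}"
  define u0 where "u0 i = (if even i then w i else r (i div 2) /\<^sub>R s (i div 2))" for i
  have "h (u0 i) (u0 j) = (if i = j then 1 else 0)" if ij: "i \<in> I" "j \<in> I" for i j
  proof -
    obtain k l where kl: "i = 2 * k \<or> i = 2 * k + 1" "j = 2 * l \<or> j = 2 * l + 1" "k < 4" "l < 4"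
    proof (rule that[of "i div 2" "j div 2"])
      show "i div 2 < 4" "j div 2 < 4" using ij by (auto simp: I_def)
    qed presburger+
    have ssk: "of_real (inverse (s k)) * (of_real (inverse (s k)) * (1 - (of_real (c k))\<^sup>2)) = (1::complex)" if "s k \<noteq> 0"
    proof -
      have "inverse (s k) * (inverse (s k) * (1 - (c k)\<^sup>2)) = 1"
        unfolding s2[OF kl(3), symmetric] using that by (simp add: field_simps)
      then have "complex_of_real (inverse (s k) * (inverse (s k) * (1 - (c k)\<^sup>2))) = 1" by (simp only: of_real_1)
      then show ?thesis by (simp only: of_real_mult of_real_diff of_real_power of_real_1)
    qed
    have ne: "2 * k \<noteq> Suc (2 * l)" "Suc (2 * k) \<noteq> 2 * l" by presburger+
    show ?thesis using kl(1,2)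
      by (cases "k = l"; elim disjE)
        (use kl(3,4) ij ssk ne in \<open>simp_all add: u0_def h_scaleR ee er re rr I_def\<close>)
  qed
  then obtain u where u: "\<And>i. i \<in> I \<Longrightarrow> u i = u0 i" "unitary u"
    using extend_unitary[of I u0] unfolding I_def by blast
  have ue: "u (2 * k) = w (2 * k)" if "k < 4" for k using u(1)[of "2 * k"] that by (simp add: I_def u0_def)
  have "z i (w (2 * k + 1)) = (\<i> * of_real (c k)) * z i (u (2 * k)) + of_real (s k) * z i (u (2 * k + 1))"
    if ki: "k < 4" "i < 8" for k i
  proof -
    have "of_real (s k) * z i (u (2 * k + 1)) = z i (r k)"
    proof (cases "s k = 0")
      case True
      then have "r k \<bullet> r k = 0" using rr[OF ki(1) ki(1)] s2[OF ki(1)] by (simp add: h_self flip: of_real_diff of_real_power)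
      then show ?thesis using True linear_0[OF linear_z[OF ki(2)]] by simp
    next
      case False
      then show ?thesis using u(1)[of "2 * k + 1"] ki
        by (simp add: I_def u0_def linear_scale[OF linear_z] scaleR_conv_of_real)
    qed
    then show ?thesis using r[OF ki(2), of k] ue[OF ki(1)] by simp
  qed
  then show ?thesis using u(2) c1 ue by (intro that[of u]) auto
qed

section \<open>Determinants and minors of unitary matrices\<close>

lemma dual_basis: "\<exists>e. \<forall>j. \<forall>i<8. z i (e j) = (if i = j then 1 else 0)"
proof -
  have "\<forall>j. \<exists>x. \<forall>i<8. z i x = (if i = j then 1 else 0)" by (intro allI surj_z)
  from choice[OF this] show ?thesis .
qed

text \<open>The covectors \<open>h (v i)\<close> arise from the \<open>z k\<close> through the
  conjugate transpose of the coordinate matrix of \<open>v\<close>.\<close>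

lemma cdet_h:
  "cdet (map (\<lambda>i. h (v i)) [0..<8]) V = cnj (cdet (map z [0..<8]) v) * cdet (map z [0..<8]) V"
proof -
  define zs where "zs = map z [0..<8]"
  define hs where "hs = map (\<lambda>i. h (v i)) [0..<8]"
  have len: "length zs = 8" "length hs = 8" by (simp_all add: zs_def hs_def)
  have nth: "(hs ! i) y = (\<Sum>k<length zs. cnj ((zs ! k) (v i)) * (zs ! k) y)" if "i < length zs" for i y
  proof -
    have "(hs ! i) y = h (v i) y" using that by (simp add: hs_def len)
    also have "\<dots> = (\<Sum>k<length zs. cnj ((zs ! k) (v i)) * (zs ! k) y)"
      unfolding h_def len by (rule sum.cong) (simp_all add: zs_def)
    finally show ?thesis .
  qed
  have "cdet hs V =
    Determinant.det (Matrix.mat (length zs) (length zs) (\<lambda>(i, j). cnj ((zs ! j) (v i)))) * cdet zs V"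
    by (rule cdet_lincomb[where N = "\<lambda>i k. cnj ((zs ! k) (v i))", OF _ nth]) (simp add: len)
  also have "Determinant.det (Matrix.mat (length zs) (length zs) (\<lambda>(i, j). cnj ((zs ! j) (v i)))) = cnj (cdet zs v)"
    by (rule det_conj_transpose)
  finally show ?thesis unfolding hs_def zs_def .
qed

lemma cmod_cdet_unitary:
  assumes "unitary v"
  shows "cmod (cdet (map z [0..<8]) v) = 1"
proof -
  have "cdet (map (\<lambda>i. h (v i)) [0..<8]) v = 1"
    by (rule cdet_dual_basis) (use assms in \<open>auto simp: unitary_def\<close>)
  then have "cnj (cdet (map z [0..<8]) v) * cdet (map z [0..<8]) v = 1" by (simp only: cdet_h)
  then have "cmod (cnj (cdet (map z [0..<8]) v) * cdet (map z [0..<8]) v) = 1" by (simp only: norm_one)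
  then have "(cmod (cdet (map z [0..<8]) v))\<^sup>2 = 1\<^sup>2"
    by (simp add: norm_mult power2_eq_square)
  then show ?thesis by (rule power2_eq_imp_eq) auto
qed

text \<open>Jacobi's identity for complementary minors of a unitary matrix. The identity
  \<open>cdet_h\<close> is evaluated on a frame that mixes \<open>v\<close> with the dual basis;
  both sides are block triangular there, and each retains one of the two minors.\<close>

lemma complementary_minor:
  assumes v: "unitary v"
  shows "cmod (cdet (map z [4..<8]) (\<lambda>j. v (4 + j))) = cmod (cdet (map z [0..<4]) v)"
proof -
  obtain e where e: "\<And>i j. i < 8 \<Longrightarrow> j < 8 \<Longrightarrow> z i (e j) = (if i = j then 1 else 0)"
    using dual_basis by blast
  define V where "V j = (if j < 4 then v j else e j)" for j :: nat
  let ?q = "\<lambda>i. h (v i)"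
  have split: "map f [0..<8] = map f [0..<4] @ map f [4..<8]" for f :: "nat \<Rightarrow> 'e \<Rightarrow> complex"
    using upt_add_eq_append[of 0 4 4] by (simp flip: map_append)
  have he: "h (v i) (e j) = cnj (z j (v i))" if "j < 8" for i j
  proof -
    have "h (v i) (e j) = (\<Sum>k<8. if k = j then cnj (z k (v i)) else 0)"
      unfolding h_def using that by (intro sum.cong) (auto simp: e)
    then show ?thesis using that by simp
  qed
  have "cdet (map ?q [0..<8]) V = cdet (map ?q [0..<4]) V * cdet (map ?q [4..<8]) (\<lambda>j. V (4 + j))"
    unfolding split using v by (subst cdet_append_block) (auto simp: V_def unitary_def)
  also have "cdet (map ?q [0..<4]) V = 1"
    by (rule cdet_dual_basis) (use v in \<open>auto simp: V_def unitary_def\<close>)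
  also have "cdet (map ?q [4..<8]) (\<lambda>j. V (4 + j)) = cnj (cdet (map z [4..<8]) (\<lambda>j. v (4 + j)))"
  proof -
    have "Matrix.mat 4 4 (\<lambda>(i, j). (map ?q [4..<8] ! i) (V (4 + j))) =
        Matrix.mat 4 4 (\<lambda>(i, j). cnj ((map z [4..<8] ! j) (v (4 + i))))"
      by (rule eq_matI) (auto simp: V_def he)
    then show ?thesis using det_conj_transpose[of "map z [4..<8]" "\<lambda>j. v (4 + j)"]
      by (simp add: cdet_def)
  qed
  finally have 1: "cdet (map ?q [0..<8]) V = cnj (cdet (map z [4..<8]) (\<lambda>j. v (4 + j)))" by simp
  have "cdet (map z [0..<8]) V = cdet (map z [0..<4]) V * cdet (map z [4..<8]) (\<lambda>j. V (4 + j))"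
    unfolding split by (subst cdet_append_block') (auto simp: V_def e)
  also have "cdet (map z [4..<8]) (\<lambda>j. V (4 + j)) = 1"
    by (rule cdet_dual_basis) (auto simp: V_def e)
  also have "cdet (map z [0..<4]) V = cdet (map z [0..<4]) v" by (rule cdet_cong) (auto simp: V_def)
  finally have 2: "cdet (map z [0..<8]) V = cdet (map z [0..<4]) v" by simp
  have "cmod (cnj (cdet (map z [4..<8]) (\<lambda>j. v (4 + j)))) = cmod (cnj (cdet (map z [0..<8]) v) * cdet (map z [0..<4]) v)"
    using cdet_h[of v V] 1 2 by simp
  then show ?thesis using cmod_cdet_unitary[OF v] by (simp add: norm_mult)
qed

lemma unitary_reorder:
  assumes "unitary u" "distinct is" "length is = 8" "set is \<subseteq> {..<8}"
  shows "unitary (\<lambda>t. u (is ! t))"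
proof -
  have "is ! t < 8" if "t < 8" for t using subsetD[OF assms(4) nth_mem[of t "is"]] that assms(3) by simp
  then show ?thesis using assms by (simp add: unitary_def nth_eq_iff_index_eq)
qed

text \<open>Unitarity of \<open>u\<close> says that the columns are orthonormal; for square matrices
  a left inverse is a right inverse, which gives the rows.\<close>

lemma orthonormal_rows_unitary:
  assumes u: "unitary u"
  shows "orthonormal_rows 8 (\<lambda>i j. z i (u j))"
proof -
  let ?A = "Matrix.mat 8 8 (\<lambda>(i, k). cnj (z k (u i)))" and ?B = "Matrix.mat 8 8 (\<lambda>(k, j). z k (u j))"
  have "?A * ?B = 1\<^sub>m 8"
    by (rule eq_matI) (use u in \<open>auto simp: scalar_prod_def atLeast0LessThan unitary_def h_def\<close>)
  then have BA: "?B * ?A = 1\<^sub>m 8" by (intro mat_mult_left_right_inverse[of ?A 8]) auto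
  show ?thesis unfolding orthonormal_rows_def
  proof (intro allI impI)
    fix i j :: nat assume ij: "i < 4" "j < 4"
    have "herm 8 (\<lambda>t. z i (u t)) (\<lambda>t. z j (u t)) = (?B * ?A) $$ (j, i)"
      using ij by (simp add: scalar_prod_def atLeast0LessThan herm_def mult.commute)
    also have "\<dots> = (if i = j then 1 else 0)" unfolding BA using ij by auto
    finally show "herm 8 (\<lambda>t. z i (u t)) (\<lambda>t. z j (u t)) = (if i = j then 1 else 0)" .
  qed
qed

end

section \<open>The form on a normal frame\<close>

lemma two_product_sum_le_1:
  fixes a b c d :: real
  assumes "a\<^sup>2 + b\<^sup>2 = 1" "c\<^sup>2 + d\<^sup>2 = 1"
  shows "a * c + b * d \<le> 1"
proof -
  have "2 * (a * c) \<le> a\<^sup>2 + c\<^sup>2" "2 * (b * d) \<le> b\<^sup>2 + d\<^sup>2"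
    using sum_squares_bound[of a c] sum_squares_bound[of b d] by simp_all
  then show ?thesis using assms by linarith
qed

text \<open>Let \<open>T\<close> be the sum of the first two products. For each pairing of the
  blocks, \<open>T\<close> plus the bracket of that pairing factors, for instance into
  \<open>(c 0 * c 1 + s 0 * s 1) * (c 2 * c 3 + s 2 * s 3)\<close>, and so is at most 1. The claim
  is the combination of these three inequalities with weights \<open>p\<close>, \<open>q\<close>,
  \<open>r\<close>.\<close>

lemma angle_estimate:
  fixes c s :: "nat \<Rightarrow> real"
  assumes cs: "\<And>k. k < 4 \<Longrightarrow> (c k)\<^sup>2 + (s k)\<^sup>2 = 1" and pos: "\<And>k. k < 4 \<Longrightarrow> 0 \<le> c k" "\<And>k. k < 4 \<Longrightarrow> 0 \<le> s k"
    and pqr: "0 \<le> p" "0 \<le> q" "0 \<le> r" "p + q + r \<le> 1"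
  shows "s 0 * s 1 * s 2 * s 3 + c 0 * c 1 * c 2 * c 3
    + p * (c 2 * c 3 * (s 0 * s 1) + c 0 * c 1 * (s 2 * s 3))
    + q * (c 1 * c 3 * (s 0 * s 2) + c 0 * c 2 * (s 1 * s 3))
    + r * (c 1 * c 2 * (s 0 * s 3) + c 0 * c 3 * (s 1 * s 2)) \<le> 1" (is "?T + p * ?X + q * ?Y + r * ?Z \<le> 1" is "?S + _ + _ + _ + _ \<le> 1")
proof -
  define T where "T = s 0 * s 1 * s 2 * s 3 + c 0 * c 1 * c 2 * c 3"
  have le: "c i * c j + s i * s j \<le> 1" if "i < 4" "j < 4" for i j
    using cs[OF that(1)] cs[OF that(2)] by (rule two_product_sum_le_1)
  have ge: "0 \<le> c i * c j + s i * s j" if "i < 4" "j < 4" for i j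
    using pos that by (intro add_nonneg_nonneg mult_nonneg_nonneg) auto
  have le2: "(c i * c j + s i * s j) * (c k * c l + s k * s l) \<le> 1" if "i < 4" "j < 4" "k < 4" "l < 4" for i j k l
    using le[of i j] le[of k l] ge[of i j] ge[of k l] that by (simp add: mult_le_one)
  have X: "T + ?X \<le> 1" using le2[of 0 1 2 3] unfolding T_def by (simp add: algebra_simps)
  have Y: "T + ?Y \<le> 1" using le2[of 0 2 1 3] unfolding T_def by (simp add: algebra_simps)
  have Z: "T + ?Z \<le> 1" using le2[of 0 3 1 2] unfolding T_def by (simp add: algebra_simps)
  have "0 \<le> ?X" using pos by (intro add_nonneg_nonneg mult_nonneg_nonneg) auto
  \<comment> \<open>Needed because the weights may add up to less than 1.\<close>
  then have T1: "T \<le> 1" using X by linarith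
  have "p * ?X \<le> p * (1 - T)" "q * ?Y \<le> q * (1 - T)" "r * ?Z \<le> r * (1 - T)"
    using X Y Z pqr by (auto intro!: mult_left_mono)
  moreover have "(p + q + r) * (1 - T) \<le> 1 * (1 - T)" using pqr T1 by (intro mult_right_mono) auto
  then have "p * (1 - T) + q * (1 - T) + r * (1 - T) \<le> 1 - T" by (simp add: distrib_right)
  ultimately have "T + p * ?X + q * ?Y + r * ?Z \<le> 1" by linarith
  then show ?thesis unfolding T_def by (simp add: add.assoc)
qed

text \<open>The matrix is block triangular and its last diagonal block is the identity.\<close>

lemma cdet_dual_block:
  fixes Z ps :: "('a \<Rightarrow> complex) list"
  assumes "length ws = length Z" "length qs = length ps"
    and "\<And>p w. p \<in> set ps \<Longrightarrow> w \<in> set ws \<Longrightarrow> p w = 0"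
    and "\<And>i j. i < length ps \<Longrightarrow> j < length ps \<Longrightarrow> (ps ! i) (qs ! j) = (if i = j then 1 else 0)"
  shows "cdet (Z @ ps) ((!) (ws @ qs)) = cdet Z ((!) ws)"
proof -
  have "cdet (Z @ ps) ((!) (ws @ qs)) = cdet Z ((!) (ws @ qs)) * cdet ps (\<lambda>j. (ws @ qs) ! (length Z + j))"
    by (rule cdet_append_block) (use assms(1,3) in \<open>auto simp: nth_append\<close>)
  also have "cdet ps (\<lambda>j. (ws @ qs) ! (length Z + j)) = 1"
    by (rule cdet_dual_basis) (use assms in \<open>auto simp: nth_append\<close>)
  also have "cdet Z ((!) (ws @ qs)) = cdet Z ((!) ws)"
    by (rule cdet_cong) (use assms in \<open>auto simp: nth_append\<close>)
  finally show ?thesis by simp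
qed

text \<open>The blocks \<open>i, j\<close> go to a complex volume factor of degree 4, the blocks
  \<open>k, l\<close> to the factor \<open>\<omega>\<^sup>2 / 2\<close>.\<close>

definition block_splits :: "(nat \<times> nat \<times> nat \<times> nat) set" where
  "block_splits = {(0,1,2,3), (0,2,1,3), (1,2,0,3), (0,3,1,2), (1,3,0,2), (2,3,0,1)}"

text \<open>Pairs of vectors pass each other without sign; each splitting is reached from the
  natural order by at most two moves.\<close>

lemma cdet_reorder_blocks:
  assumes "length zs = 8" "(i, j, k, l) \<in> block_splits"
  shows "cdet zs w = cdet zs ((!) [w (2 * i), w (2 * i + 1), w (2 * j), w (2 * j + 1),
     w (2 * k), w (2 * k + 1), w (2 * l), w (2 * l + 1)])"
proof -
  define a where "a k = w (2 * k)" for k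
  define b where "b k = w (2 * k + 1)" for k
  define V where "V is = cdet zs ((!) (pair_word a b is))" for "is"
  have lz: "length zs = Suc (Suc (Suc (Suc (Suc (Suc (Suc (Suc 0)))))))" using assms(1) by simp
  have move: "V (xs @ us @ [t] @ ys) = V (xs @ [t] @ us @ ys)" if "length xs + length us + length ys = 3" for xs us t ys
    unfolding V_def using cdet_vec_pair_move[of zs "pair_word a b xs" "pair_word a b us" "pair_word a b ys" "a t" "b t"] assms(1) that
    by simp
  have "cdet zs w = V [0, 1, 2, 3]"
    unfolding V_def by (rule cdet_cong) (use lz in \<open>auto simp: a_def b_def less_Suc_eq nth_Cons numeral_eq_Suc\<close>)
  moreover have "V [i, j, k, l] = V [0, 1, 2, 3]"
    using assms(2) move[of "[0]" "[1]" "[3]" 2] move[of "[]" "[0]" "[2,3]" 1] move[of "[1]" "[0]" "[3]" 2]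
      move[of "[0]" "[1,2]" "[]" 3] move[of "[1]" "[0,2]" "[]" 3] move[of "[]" "[0,1]" "[3]" 2] move[of "[2]" "[0,1]" "[]" 3]
    by (auto simp: block_splits_def)
  ultimately show ?thesis by (simp add: V_def a_def b_def)
qed

lemma sum_lessThan_4: "(\<Sum>k<4. f k) = f 0 + f 1 + f 2 + f (3::nat)"
  for f :: "nat \<Rightarrow> 'a::comm_monoid_add"
  by (simp add: eval_nat_numeral lessThan_Suc add_ac)

lemma less_8_cases: "n < 8 \<Longrightarrow> n = 0 \<or> n = 1 \<or> n = 2 \<or> n = 3 \<or> n = 4 \<or> n = 5 \<or> n = 6 \<or> n = (7::nat)"
  by presburger

context unitary_coordinates
begin

definition kaehler :: "('e, real) form" where
  "kaehler v = Im (h (v 0) (v 1))"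

definition chi :: "('e, complex) form" where
  "chi u = cdet (map z [0..<4]) u + cdet (map z [4..<8]) u"

text \<open>The factor \<open>\<delta>\<close> is the phase of \<open>\<Omega>\<close> against the
  volume form of the chosen coordinates. Real parts are deferred: the comass estimate bounds the
  modulus of this complex form.\<close>

definition Phi :: "complex \<Rightarrow> ('e, complex) form" where
  "Phi \<delta> v = \<delta> * cdet (map z [0..<8]) v + of_real (1 / 24 * wedge_power 2 kaehler 4 v)
     + wedge 4 4 chi (\<lambda>u. of_real (1 / 2 * wedge_power 2 kaehler 2 u)) v"

lemma linear_cnj_z: "i < 8 \<Longrightarrow> linear (\<lambda>x. cnj (z i x))"
  using linear_compose[OF linear_z, of i cnj] by (simp add: o_def bounded_linear.linear bounded_linear_cnj)

text \<open>The classical expression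
  \<open>\<i>/2 \<Sum> dz\<^sub>k \<and> d\<bar>z\<^sub>k\<close>; it exhibits the form as a sum of
  words and is the source of every factor \<open>\<i> / 2\<close> below.\<close>

lemma kaehler_eq_sum: "of_real (kaehler v) = (\<Sum>k<8. (\<i> / 2) * cdet [z k, \<lambda>x. cnj (z k x)] v)"
proof -
  have "complex_of_real (Im (cnj a * b)) = (\<i> / 2) * (a * cnj b - b * cnj a)" for a b
    by (simp add: complex_eq_iff)
  then show ?thesis
    unfolding kaehler_def h_def Im_sum of_real_sum cdet_2 by (intro sum.cong refl)
qed

lemma alt_form_kaehler: "alt_form 2 (\<lambda>v. of_real (kaehler v))"
  unfolding kaehler_eq_sum
  by (intro alt_form_sum alt_form_cdet) (auto intro: linear_z linear_cnj_z)

lemma alt_form_kaehler_power: "alt_form (2 * n) (\<lambda>v. of_real (a * wedge_power 2 kaehler n v))"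
  using alt_form_scale[OF alt_form_wedge_power[OF alt_form_kaehler, of n], where c = "of_real a"]
  by (simp add: of_real_wedge_power)

lemma alt_form_chi: "alt_form 4 chi"
  unfolding chi_def by (intro alt_form_add alt_form_cdet1) (auto intro: linear_z)

lemma alt_form_Phi: "alt_form 8 (Phi \<delta>)"
proof -
  have "alt_form 8 (\<lambda>v. of_real (1 / 24 * wedge_power 2 kaehler 4 v))"
    using alt_form_kaehler_power[of 4 "1 / 24"] by simp
  moreover have "alt_form 4 (\<lambda>u. of_real (1 / 2 * wedge_power 2 kaehler 2 u))"
    using alt_form_kaehler_power[of 2 "1 / 2"] by simp
  from alt_form_wedge[OF alt_form_chi this]
  have "alt_form 8 (wedge 4 4 chi (\<lambda>u. of_real (1 / 2 * wedge_power 2 kaehler 2 u)))" by simp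
  moreover have "alt_form 8 (\<lambda>v. \<delta> * cdet (map z [0..<8]) v)"
    by (intro alt_form_cdet) (auto intro: linear_z)
  ultimately show ?thesis unfolding Phi_def by (intro alt_form_add)
qed

end

text \<open>Vectors behind the eighth do not affect an 8-form, but \<open>wedge_cong\<close> asks
  for identities on the whole range of \<open>w\<close>; the value 0 makes them hold there as
  well.\<close>

locale normal_frame = unitary_coordinates z for z :: "nat \<Rightarrow> 'e::euclidean_space \<Rightarrow> complex" +
  fixes w :: "nat \<Rightarrow> 'e"
  assumes w_orth: "i < 8 \<Longrightarrow> j < 8 \<Longrightarrow> w i \<bullet> w j = (if i = j then 1 else 0)"
    and w_blocks: "i < 8 \<Longrightarrow> j < 8 \<Longrightarrow> i div 2 \<noteq> j div 2 \<Longrightarrow> Im (h (w i) (w j)) = 0"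
    and w_zero: "i \<ge> 8 \<Longrightarrow> w i = 0"
begin

definition c where "c k = Im (h (w (2 * k)) (w (2 * k + 1)))"

definition P :: "nat \<Rightarrow> 'e \<Rightarrow> complex" where "P i x = of_real (w i \<bullet> x)"

lemma P_w: "P i (w j) = (if i = j \<and> i < 8 then 1 else 0)"
  using w_orth[of i j] w_zero[of i] w_zero[of j] by (cases "i < 8"; cases "j < 8") (auto simp: P_def)

lemma Im_h_w:
  assumes "i < 8" "j < 8"
  shows "Im (h (w i) (w j)) =
    (if i div 2 = j div 2 then if i < j then c (i div 2) else if j < i then - c (i div 2) else 0 else 0)"
proof (cases "i div 2 = j div 2")
  case True
  define k where "k = i div 2"
  have "i = 2 * k \<or> i = 2 * k + 1" "j = 2 * k \<or> j = 2 * k + 1" using True unfolding k_def by presburger+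
  moreover have "Im (h (w (2 * k + 1)) (w (2 * k))) = - c k"
    unfolding c_def h_commute[of "w (2 * k + 1)"] by simp
  ultimately show ?thesis by (elim disjE) (simp_all add: h_self c_def)
qed (simp add: w_blocks assms)

text \<open>Claimed only for vectors of the frame and 0, which is what \<open>wedge_cong\<close>
  permits; off their span the Kaehler form need not have this shape.\<close>

lemma kaehler_frame:
  assumes "range u \<subseteq> range w"
  shows "of_real (kaehler u) = (\<Sum>k<4. of_real (c k) * cdet [P (2 * k), P (2 * k + 1)] u)"
proof -
  obtain i j where ij: "u 0 = w i" "u 1 = w j" using assms by (metis imageE rangeI subset_eq)
  have zero: "h x 0 = 0" "h 0 x = 0" for x
    by (simp_all add: h_def linear_0[OF linear_z])
  show ?thesis
  proof (cases "i < 8 \<and> j < 8")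
    case True
    then have i: "i < 8" and j: "j < 8" by auto
    show ?thesis
      unfolding kaehler_def cdet_2 ij sum_lessThan_4 Im_h_w[OF i j]
      using less_8_cases[OF i] less_8_cases[OF j] by (elim disjE; simp add: P_w)
  qed (auto simp: kaehler_def ij ij(2)[simplified] w_zero zero cdet_2 P_def)
qed

lemma kaehler_power_frame:
  assumes "range u \<subseteq> range w"
  shows "of_real (wedge_power 2 kaehler n u) = (\<Sum>js\<in>words n {..<4}.
     prod_list (map (\<lambda>k. of_real (c k)) js) * cdet (pair_word (\<lambda>k. P (2 * k)) (\<lambda>k. P (2 * k + 1)) js) u)"
proof -
  have "complex_of_real (wedge_power 2 kaehler n u) = wedge_power 2 (\<lambda>v. of_real (kaehler v)) n u"
    by (rule of_real_wedge_power)
  also have "\<dots> = wedge_power 2 (\<lambda>v. \<Sum>k<4. of_real (c k) * cdet [P (2 * k), P (2 * k + 1)] v) n u"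
    by (rule wedge_power_cong, rule kaehler_frame) (use assms in blast)
  finally show ?thesis unfolding wedge_power_pair_sum .
qed

text \<open>Words with a repeated block vanish, and the \<open>4!\<close> others agree since pairs
  of covectors commute.\<close>

lemma kaehler_fourth_power_frame: "wedge_power 2 kaehler 4 w = 24 * (c 0 * c 1 * c 2 * c 3)"
proof -
  let ?g = "\<lambda>js. prod_list (map (\<lambda>k. of_real (c k)) js) * cdet (pair_word (\<lambda>k. P (2 * k)) (\<lambda>k. P (2 * k + 1)) js) w"
  have "(\<Sum>js\<in>words 4 {..<4}. ?g js) = fact 4 * of_real (c 0 * c 1 * c 2 * c 3)"
  proof (rule sum_words_distinct)
    fix js :: "nat list" assume "\<not> distinct js"
    then have "\<not> distinct (pair_word (\<lambda>k. P (2 * k)) (\<lambda>k. P (2 * k + 1)) js)" using distinct_pair_wordD by blast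
    then show "?g js = 0" by (simp add: cdet_not_distinct)
  next
    fix js assume js: "js \<in> words 4 {..<4}" "distinct js"
    then have "set js = {..<4}" unfolding words_def by (intro card_subset_eq) (auto simp: distinct_card)
    also have "{..<4} = set [0, 1, 2, 3::nat]" by auto
    finally have ms: "mset js = mset [0, 1, 2, 3]"
      by (rule set_eq_iff_mset_eq_distinct[THEN iffD1, rotated 2]) (use js(2) in simp_all)
    have eq: "cdet (pair_word (\<lambda>k. P (2 * k)) (\<lambda>k. P (2 * k + 1)) js) w =
        cdet (pair_word (\<lambda>k. P (2 * k)) (\<lambda>k. P (2 * k + 1)) [0, 1, 2, 3]) w"
      using cdet_pair_word_mset[OF ms, of "[]"] unfolding append_Nil .
    have "prod_list (map (\<lambda>k. complex_of_real (c k)) js) = prod_mset (image_mset (\<lambda>k. complex_of_real (c k)) (mset js))"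
      by (simp add: prod_mset_prod_list flip: mset_map)
    also have "\<dots> = prod_list (map (\<lambda>k. complex_of_real (c k)) [0, 1, 2, 3])"
      unfolding ms by (simp add: mult_ac)
    finally have "prod_list (map (\<lambda>k. complex_of_real (c k)) js) = prod_list (map (\<lambda>k. complex_of_real (c k)) [0, 1, 2, 3])" .
    moreover have "cdet (pair_word (\<lambda>k. P (2 * k)) (\<lambda>k. P (2 * k + 1)) [0, 1, 2, 3]) w = 1"
    proof (rule cdet_dual_basis)
      fix i j assume "i < length (pair_word (\<lambda>k. P (2 * k)) (\<lambda>k. P (2 * k + 1)) [0, 1, 2, 3])"
      then have "i < 8" by simp
      from less_8_cases[OF this] have "pair_word (\<lambda>k. P (2 * k)) (\<lambda>k. P (2 * k + 1)) [0, 1, 2, 3] ! i = P i"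
        by (elim disjE; simp)
      then show "(pair_word (\<lambda>k. P (2 * k)) (\<lambda>k. P (2 * k + 1)) [0, 1, 2, 3] ! i) (w j) = (if i = j then 1 else 0)"
        using \<open>i < 8\<close> by (simp add: P_w)
    qed
    ultimately show "?g js = of_real (c 0 * c 1 * c 2 * c 3)" unfolding eq by (simp add: mult.assoc)
  qed auto
  then have "complex_of_real (wedge_power 2 kaehler 4 w) = of_real (24 * (c 0 * c 1 * c 2 * c 3))"
    using kaehler_power_frame[of w 4] by (simp add: fact_numeral)
  then show ?thesis unfolding of_real_eq_iff .
qed

lemma cdet_frame_split:
  assumes "length Z = 4" "(i, j, k, l) \<in> block_splits"
  shows "cdet (Z @ [P (2 * k), P (2 * k + 1), P (2 * l), P (2 * l + 1)]) w =
    cdet Z ((!) [w (2 * i), w (2 * i + 1), w (2 * j), w (2 * j + 1)])"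
proof -
  have "cdet (Z @ [P (2 * k), P (2 * k + 1), P (2 * l), P (2 * l + 1)]) w =
      cdet (Z @ [P (2 * k), P (2 * k + 1), P (2 * l), P (2 * l + 1)])
       ((!) ([w (2 * i), w (2 * i + 1), w (2 * j), w (2 * j + 1)] @ [w (2 * k), w (2 * k + 1), w (2 * l), w (2 * l + 1)]))"
    using cdet_reorder_blocks[OF _ assms(2), of "Z @ [P (2 * k), P (2 * k + 1), P (2 * l), P (2 * l + 1)]" w] assms(1) by simp
  also have "\<dots> = cdet Z ((!) [w (2 * i), w (2 * i + 1), w (2 * j), w (2 * j + 1)])"
  proof (rule cdet_dual_block)
    fix p v assume "p \<in> set [P (2 * k), P (2 * k + 1), P (2 * l), P (2 * l + 1)]"
      "v \<in> set [w (2 * i), w (2 * i + 1), w (2 * j), w (2 * j + 1)]"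
    then show "p v = 0" using assms(2) by (auto simp: block_splits_def P_w)
  next
    fix a b assume "a < length [P (2 * k), P (2 * k + 1), P (2 * l), P (2 * l + 1)]"
      "b < length [P (2 * k), P (2 * k + 1), P (2 * l), P (2 * l + 1)]"
    then have "a = 0 \<or> a = 1 \<or> a = 2 \<or> a = 3" "b = 0 \<or> b = 1 \<or> b = 2 \<or> b = 3" by auto
    then show "([P (2 * k), P (2 * k + 1), P (2 * l), P (2 * l + 1)] ! a) ([w (2 * k), w (2 * k + 1), w (2 * l), w (2 * l + 1)] ! b) =
      (if a = b then 1 else 0)"
      using assms(2) by (elim disjE) (auto simp: block_splits_def P_w)
  qed (use assms in auto)
  finally show ?thesis .
qed

end

context unitary_coordinates
begin

text \<open>Only \<open>a = 0\<close> and \<open>a = 4\<close> occur: these belong to the volume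
  forms of the two summands of the space.\<close>

definition minors :: "nat \<Rightarrow> (nat \<Rightarrow> 'e) \<Rightarrow> nat \<Rightarrow> nat \<Rightarrow> complex" where
  "minors a u = pair_minor (\<lambda>t. z a (u t)) (\<lambda>t. z (a + 1) (u t)) (\<lambda>t. z (a + 2) (u t)) (\<lambda>t. z (a + 3) (u t))"

lemma cdet_minors:
  "cdet (map z [a..<a + 4]) ((!) [u (2 * i), u (2 * i + 1), u (2 * j), u (2 * j + 1)]) = minors a u i j"
proof -
  have "[a..<a + 4] = [a, a + 1, a + 2, a + 3]" by (simp add: upt_rec)
  then show ?thesis unfolding minors_def using cdet_pair_minor[of "z a" "z (a + 1)" "z (a + 2)" "z (a + 3)" u i j] by simp
qed

text \<open>\<open>complementary_minor\<close> for the matrix with its columns reordered so that the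
  blocks \<open>k, l\<close> come first.\<close>

lemma minors_complement:
  assumes u: "unitary u" and split: "(i, j, k, l) \<in> block_splits"
  shows "cmod (minors 4 u i j) = cmod (minors 0 u k l)"
proof -
  define js where "js = [2 * k, 2 * k + 1, 2 * l, 2 * l + 1, 2 * i, 2 * i + 1, 2 * j, 2 * j + 1]"
  have "unitary (\<lambda>t. u (js ! t))"
    by (rule unitary_reorder[OF u]) (use split in \<open>auto simp: js_def block_splits_def\<close>)
  from complementary_minor[OF this]
  have "cmod (cdet (map z [4..<8]) (\<lambda>t. u (js ! (4 + t)))) = cmod (cdet (map z [0..<4]) (\<lambda>t. u (js ! t)))" .
  also have "cdet (map z [4..<8]) (\<lambda>t. u (js ! (4 + t))) = cdet (map z [4..<4 + 4]) ((!) [u (2 * i), u (2 * i + 1), u (2 * j), u (2 * j + 1)])"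
    unfolding js_def by (simp, rule cdet_cong) (auto simp: less_Suc_eq numeral_eq_Suc)
  also have "cdet (map z [0..<4]) (\<lambda>t. u (js ! t)) = cdet (map z [0..<0 + 4]) ((!) [u (2 * k), u (2 * k + 1), u (2 * l), u (2 * l + 1)])"
    unfolding js_def by (simp, rule cdet_cong) (auto simp: less_Suc_eq numeral_eq_Suc)
  finally show ?thesis unfolding cdet_minors .
qed

lemma minors_sum_le_1:
  assumes "unitary u"
  shows "cmod (minors 0 u 0 1) + cmod (minors 0 u 0 2) + cmod (minors 0 u 1 2)
    + cmod (minors 0 u 0 3) + cmod (minors 0 u 1 3) + cmod (minors 0 u 2 3) \<le> 1"
proof -
  have "minor_sum 4 (\<lambda>i t. z i (u t)) \<le> 1"
    using minor_sum_le_1[of 4 "\<lambda>i t. z i (u t)"] orthonormal_rows_unitary[OF assms] by simp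
  then show ?thesis
    by (simp add: minor_sum_def minors_def sum_lessThan_4 eval_nat_numeral lessThan_Suc add_ac)
qed

end

context normal_frame
begin

text \<open>Each unordered pair of distinct blocks occurs twice in \<open>\<omega>\<^sup>2\<close>,
  which cancels the factor \<open>1 / 2\<close>; its coefficient multiplies the minor of
  \<open>Z\<close> at the two remaining blocks.\<close>

lemma wedge_kaehler_square_frame:
  fixes Z :: "('e \<Rightarrow> complex) list"
  assumes Z: "length Z = 4"
  defines "F \<equiv> \<lambda>i j. cdet Z ((!) [w (2 * i), w (2 * i + 1), w (2 * j), w (2 * j + 1)])"
  shows "wedge 4 4 (cdet Z) (\<lambda>u. of_real (1 / 2 * wedge_power 2 kaehler 2 u)) w =
    of_real (c 2 * c 3) * F 0 1 + of_real (c 1 * c 3) * F 0 2 + of_real (c 0 * c 3) * F 1 2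
    + of_real (c 1 * c 2) * F 0 3 + of_real (c 0 * c 2) * F 1 3 + of_real (c 0 * c 1) * F 2 3"
proof -
  let ?p = "\<lambda>js. prod_list (map (\<lambda>k. complex_of_real (c k)) js)"
  let ?W = "pair_word (\<lambda>k. P (2 * k)) (\<lambda>k. P (2 * k + 1))"
  define G where "G j k = cdet (Z @ ?W [j, k]) w" for j k
  have "wedge 4 4 (cdet Z) (\<lambda>u. of_real (1 / 2 * wedge_power 2 kaehler 2 u)) w =
      wedge 4 4 (cdet Z) (\<lambda>u. 1 / 2 * (\<Sum>js\<in>words 2 {..<4}. ?p js * cdet (?W js) u)) w"
  proof (rule wedge_cong)
    fix u :: "nat \<Rightarrow> 'e" assume "range u \<subseteq> range w"
    from kaehler_power_frame[OF this, of 2]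
    show "of_real (1 / 2 * wedge_power 2 kaehler 2 u) = 1 / 2 * (\<Sum>js\<in>words 2 {..<4}. ?p js * cdet (?W js) u)"
      unfolding of_real_mult by simp
  qed simp
  also have "\<dots> = 1 / 2 * (\<Sum>js\<in>words 2 {..<4}. ?p js * wedge 4 4 (cdet Z) (cdet (?W js)) w)"
    by (simp only: wedge_scale_right wedge_sum_right)
  also have "(\<Sum>js\<in>words 2 {..<4}. ?p js * wedge 4 4 (cdet Z) (cdet (?W js)) w) =
      (\<Sum>js\<in>words 2 {..<4}. ?p js * cdet (Z @ ?W js) w)"
  proof (intro sum.cong refl)
    fix js assume "js \<in> words 2 {..<4}"
    then have "length (?W js) = 4" by (simp add: words_def)
    then show "?p js * wedge 4 4 (cdet Z) (cdet (?W js)) w = ?p js * cdet (Z @ ?W js) w"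
      using wedge_cdet[of Z "?W js"] Z by simp
  qed
  also have "\<dots> = (\<Sum>js\<in>words (Suc 0 + Suc 0) {..<4}. ?p js * cdet (Z @ ?W js) w)" by (simp add: numeral_2_eq_2)
  also have "\<dots> = (\<Sum>j<4. \<Sum>k<4. of_real (c j * c k) * G j k)"
    unfolding sum_words_add sum_words_1 G_def by simp
  finally have *: "wedge 4 4 (cdet Z) (\<lambda>u. of_real (1 / 2 * wedge_power 2 kaehler 2 u)) w =
     1 / 2 * (\<Sum>j<4. \<Sum>k<4. of_real (c j * c k) * G j k)" .
  have G0: "G j j = 0" for j
    unfolding G_def by (rule cdet_not_distinct) simp
  have Gsym: "G k j = G j k" for j k
    unfolding G_def by (rule cdet_pair_word_mset) simp
  have GF: "G k l = F i j" if "(i, j, k, l) \<in> block_splits" for i j k l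
    using cdet_frame_split[OF Z that] by (simp add: G_def F_def)
  have eqs: "G 2 3 = F 0 1" "G 1 3 = F 0 2" "G 0 3 = F 1 2" "G 1 2 = F 0 3" "G 0 2 = F 1 3" "G 0 1 = F 2 3"
    by (rule GF; simp add: block_splits_def)+
  have sum: "(\<Sum>j<4. \<Sum>k<4. of_real (c j * c k) * G j k) =
    2 * (of_real (c 2 * c 3) * G 2 3 + of_real (c 1 * c 3) * G 1 3 + of_real (c 0 * c 3) * G 0 3
    + of_real (c 1 * c 2) * G 1 2 + of_real (c 0 * c 2) * G 0 2 + of_real (c 0 * c 1) * G 0 1)"
    unfolding sum_lessThan_4 G0 Gsym[of 1 0] Gsym[of 2 0] Gsym[of 3 0] Gsym[of 2 1] Gsym[of 3 1] Gsym[of 3 2]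
    by (simp add: mult_ac)
  show ?thesis unfolding * sum eqs by simp
qed

lemma Phi_frame:
  "Phi \<delta> w = \<delta> * cdet (map z [0..<8]) w + of_real (c 0 * c 1 * c 2 * c 3)
    + of_real (c 2 * c 3) * (minors 0 w 0 1 + minors 4 w 0 1)
    + of_real (c 1 * c 3) * (minors 0 w 0 2 + minors 4 w 0 2)
    + of_real (c 0 * c 3) * (minors 0 w 1 2 + minors 4 w 1 2)
    + of_real (c 1 * c 2) * (minors 0 w 0 3 + minors 4 w 0 3)
    + of_real (c 0 * c 2) * (minors 0 w 1 3 + minors 4 w 1 3)
    + of_real (c 0 * c 1) * (minors 0 w 2 3 + minors 4 w 2 3)"
proof -
  have m: "cdet (map z [0..<4]) ((!) [w (2 * i), w (2 * i + 1), w (2 * j), w (2 * j + 1)]) = minors 0 w i j"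
     "cdet (map z [4..<8]) ((!) [w (2 * i), w (2 * i + 1), w (2 * j), w (2 * j + 1)]) = minors 4 w i j" for i j
    using cdet_minors[of 0 w i j] cdet_minors[of 4 w i j] by simp_all
  have "wedge 4 4 chi (\<lambda>u. of_real (1 / 2 * wedge_power 2 kaehler 2 u)) w =
      wedge 4 4 (cdet (map z [0..<4])) (\<lambda>u. of_real (1 / 2 * wedge_power 2 kaehler 2 u)) w
    + wedge 4 4 (cdet (map z [4..<8])) (\<lambda>u. of_real (1 / 2 * wedge_power 2 kaehler 2 u)) w"
    unfolding chi_def[abs_def] by (simp only: wedge_add_left)
  then have chi: "wedge 4 4 chi (\<lambda>u. of_real (1 / 2 * wedge_power 2 kaehler 2 u)) w =
      of_real (c 2 * c 3) * (minors 0 w 0 1 + minors 4 w 0 1)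
    + of_real (c 1 * c 3) * (minors 0 w 0 2 + minors 4 w 0 2)
    + of_real (c 0 * c 3) * (minors 0 w 1 2 + minors 4 w 1 2)
    + of_real (c 1 * c 2) * (minors 0 w 0 3 + minors 4 w 0 3)
    + of_real (c 0 * c 2) * (minors 0 w 1 3 + minors 4 w 1 3)
    + of_real (c 0 * c 1) * (minors 0 w 2 3 + minors 4 w 2 3)"
    by (simp only: wedge_kaehler_square_frame length_map length_upt m) (simp add: distrib_left)
  show ?thesis unfolding Phi_def chi kaehler_fourth_power_frame by (simp add: add_ac)
qed

text \<open>Up to sign \<open>c k\<close> is the cosine, and \<open>s k\<close> is the sine, of the
  Kaehler angle of block \<open>k\<close>.\<close>

definition s where "s k = sqrt (1 - (c k)\<^sup>2)"

lemma frame_unitary: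
  obtains u where "unitary u" "\<And>k. k < 4 \<Longrightarrow> (c k)\<^sup>2 \<le> 1" "\<And>k. k < 4 \<Longrightarrow> u (2 * k) = w (2 * k)"
    "\<And>k i. k < 4 \<Longrightarrow> i < 8 \<Longrightarrow>
       z i (w (2 * k + 1)) = (\<i> * of_real (c k)) * z i (u (2 * k)) + of_real (s k) * z i (u (2 * k + 1))"
  unfolding c_def s_def by (rule normal_frame_unitary[of w, OF w_orth w_blocks]) blast+

lemma c_square_le_1: "k < 4 \<Longrightarrow> (c k)\<^sup>2 \<le> 1"
  by (rule frame_unitary) blast

lemma s_nonneg: "k < 4 \<Longrightarrow> 0 \<le> s k"
  and c_s_square: "k < 4 \<Longrightarrow> \<bar>c k\<bar>\<^sup>2 + (s k)\<^sup>2 = 1"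
  using c_square_le_1[of k] by (simp_all add: s_def)

text \<open>The transition from \<open>u\<close> to \<open>w\<close> is upper triangular with
  diagonal entries 1 and \<open>s k\<close> in turn.\<close>

lemma cmod_volume_frame: "cmod (cdet (map z [0..<8]) w) = s 0 * s 1 * s 2 * s 3"
proof -
  obtain u where u: "unitary u" and ue: "\<And>k. k < 4 \<Longrightarrow> u (2 * k) = w (2 * k)"
    and uo: "\<And>k i. k < 4 \<Longrightarrow> i < 8 \<Longrightarrow>
       z i (w (2 * k + 1)) = (\<i> * of_real (c k)) * z i (u (2 * k)) + of_real (s k) * z i (u (2 * k + 1))"
    by (rule frame_unitary) blast
  define M where "M k j = (if even j then if k = j then 1 else 0
    else if k = j then of_real (s (j div 2)) else if Suc k = j then \<i> * of_real (c (j div 2)) else 0)" for k j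
  let ?M = "Matrix.mat 8 8 (\<lambda>(i, j). M i j)"
  have "cdet (map z [0..<8]) w = cdet (map z [0..<8]) u *
      Determinant.det (Matrix.mat (length (map z [0..<8])) (length (map z [0..<8])) (\<lambda>(i, j). M i j))"
  proof (rule cdet_mat_mult)
    fix i j assume "i < length (map z [0..<8])" "j < length (map z [0..<8])"
    then have i: "i < 8" and j: "j < 8" by simp_all
    have "z i (w j) = (\<Sum>k<8. z i (u k) * M k j)"
    proof (cases "even j")
      case True
      then obtain k where k: "j = 2 * k" by blast
      have "(\<Sum>k<8. z i (u k) * M k j) = (\<Sum>k<8. if k = j then z i (u k) else 0)"
        using True by (intro sum.cong) (auto simp: M_def)
      then show ?thesis using j k ue[of k] by simp
    next
      case False
      then obtain k where k: "j = 2 * k + 1" using oddE by blast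
      have "(\<Sum>t<8. z i (u t) * M t j) = (\<Sum>t<8. (if t = j then of_real (s k) * z i (u t) else 0) +
          (if t = 2 * k then \<i> * of_real (c k) * z i (u t) else 0))"
        using False k by (intro sum.cong) (auto simp: M_def)
      also have "\<dots> = of_real (s k) * z i (u j) + \<i> * of_real (c k) * z i (u (2 * k))"
        using j k unfolding sum.distrib by simp
      finally show ?thesis using uo[of k i] i j k by simp
    qed
    also have "\<dots> = (\<Sum>k<length (map z [0..<8]). (map z [0..<8] ! i) (u k) * M k j)"
      using i by simp
    finally show "(map z [0..<8] ! i) (w j) = (\<Sum>k<length (map z [0..<8]). (map z [0..<8] ! i) (u k) * M k j)"
      using i by simp
  qed
  moreover have "Determinant.det ?M = of_real (s 0 * s 1 * s 2 * s 3)"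
  proof -
    have "upper_triangular ?M" by (auto simp: upper_triangular_def M_def)
    then have "Determinant.det ?M = prod_list (diag_mat ?M)" by (rule det_upper_triangular) auto
    also have "diag_mat ?M = map (\<lambda>i. M i i) [0..<8]" by (auto simp: diag_mat_def)
    also have "prod_list \<dots> = of_real (s 0 * s 1 * s 2 * s 3)"
    proof -
      have s23: "s (Suc (Suc 0)) = s 2" "s (Suc (Suc (Suc 0))) = s 3"
        by (simp_all add: numeral_2_eq_2 numeral_3_eq_3)
      then show ?thesis by (simp add: upt_rec M_def)
    qed
    finally show ?thesis .
  qed
  ultimately show ?thesis
    using cmod_cdet_unitary[OF u] s_nonneg by (simp add: norm_mult abs_mult)
qed

lemma cmod_Phi_frame_le_1:
  assumes \<delta>: "cmod \<delta> = 1"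
  shows "cmod (Phi \<delta> w) \<le> 1"
proof -
  obtain u where u: "unitary u" and ue: "\<And>k. k < 4 \<Longrightarrow> u (2 * k) = w (2 * k)"
    and uo: "\<And>k i. k < 4 \<Longrightarrow> i < 8 \<Longrightarrow>
       z i (w (2 * k + 1)) = (\<i> * of_real (c k)) * z i (u (2 * k)) + of_real (s k) * z i (u (2 * k + 1))"
    by (rule frame_unitary) blast
  \<comment> \<open>Within block \<open>k\<close> the summand of \<open>w (2 * k + 1)\<close> along
    \<open>u (2 * k)\<close> is proportional to the other column and drops out of every
    \<open>2 \<times> 2\<close> minor, leaving the factor \<open>s k\<close>.\<close>
  have minors_w: "cmod (minors a w i j) = s i * s j * cmod (minors a u i j)" if "a + 3 < 8" "i < 4" "j < 4" for a i j
  proof -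
    have "block_minor (\<lambda>t. z p (w t)) (\<lambda>t. z q (w t)) k = of_real (s k) * block_minor (\<lambda>t. z p (u t)) (\<lambda>t. z q (u t)) k"
      if "p < 8" "q < 8" "k < 4" for p q k
      unfolding block_minor_def uo[OF that(3,1)] uo[OF that(3,2)] ue[OF that(3)] by (simp add: algebra_simps)
    then have "minors a w i j = of_real (s i * s j) * minors a u i j"
      using that unfolding minors_def pair_minor_def by (simp add: algebra_simps)
    then show ?thesis using s_nonneg that by (simp add: norm_mult)
  qed
  define A where "A i j = cmod (minors 0 u i j)" for i j
  have A: "A i j \<ge> 0" for i j by (simp add: A_def)
  have compl: "cmod (minors 4 u i j) = A k l" if "(i, j, k, l) \<in> block_splits" for i j k l
    unfolding A_def by (rule minors_complement[OF u that])
  have term_le: "cmod (of_real (c a * c b) * (minors 0 w i j + minors 4 w i j)) \<le> \<bar>c a\<bar> * \<bar>c b\<bar> * (s i * s j) * (A i j + A k l)"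
    if "(i, j, k, l) \<in> block_splits" "i < 4" "j < 4" for a b i j k l
  proof -
    have "cmod (minors 0 w i j + minors 4 w i j) \<le> cmod (minors 0 w i j) + cmod (minors 4 w i j)" by (rule norm_triangle_ineq)
    also have "\<dots> = (s i * s j) * (A i j + A k l)"
      using that minors_w[of 0 i j] minors_w[of 4 i j] compl[OF that(1)] by (simp add: A_def distrib_left)
    finally show ?thesis by (simp add: norm_mult abs_mult mult.assoc mult_left_mono)
  qed
  \<comment> \<open>Each pairing of blocks collects its two opposite splittings, which carry the
    same sum of moduli thanks to \<open>compl\<close>.\<close>
  define p q r where "p = A 0 1 + A 2 3" and "q = A 0 2 + A 1 3" and "r = A 0 3 + A 1 2"
  have pqr: "0 \<le> p" "0 \<le> q" "0 \<le> r" "p + q + r \<le> 1"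
    using A minors_sum_le_1[OF u] by (simp_all add: p_def q_def r_def A_def)
  have "cmod (Phi \<delta> w) \<le> s 0 * s 1 * s 2 * s 3 + \<bar>c 0\<bar> * \<bar>c 1\<bar> * \<bar>c 2\<bar> * \<bar>c 3\<bar>
    + \<bar>c 2\<bar> * \<bar>c 3\<bar> * (s 0 * s 1) * (A 0 1 + A 2 3)
    + \<bar>c 1\<bar> * \<bar>c 3\<bar> * (s 0 * s 2) * (A 0 2 + A 1 3)
    + \<bar>c 0\<bar> * \<bar>c 3\<bar> * (s 1 * s 2) * (A 1 2 + A 0 3)
    + \<bar>c 1\<bar> * \<bar>c 2\<bar> * (s 0 * s 3) * (A 0 3 + A 1 2)
    + \<bar>c 0\<bar> * \<bar>c 2\<bar> * (s 1 * s 3) * (A 1 3 + A 0 2)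
    + \<bar>c 0\<bar> * \<bar>c 1\<bar> * (s 2 * s 3) * (A 2 3 + A 0 1)"
    unfolding Phi_frame
  proof (intro norm_triangle_mono)
    show "cmod (\<delta> * cdet (map z [0..<8]) w) \<le> s 0 * s 1 * s 2 * s 3" using cmod_volume_frame \<delta> by (simp add: norm_mult)
    show "cmod (of_real (c 0 * c 1 * c 2 * c 3)) \<le> \<bar>c 0\<bar> * \<bar>c 1\<bar> * \<bar>c 2\<bar> * \<bar>c 3\<bar>" by (simp add: norm_mult abs_mult)
  qed (rule term_le; simp add: block_splits_def)+
  also have "\<dots> = s 0 * s 1 * s 2 * s 3 + \<bar>c 0\<bar> * \<bar>c 1\<bar> * \<bar>c 2\<bar> * \<bar>c 3\<bar>
    + p * (\<bar>c 2\<bar> * \<bar>c 3\<bar> * (s 0 * s 1) + \<bar>c 0\<bar> * \<bar>c 1\<bar> * (s 2 * s 3))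
    + q * (\<bar>c 1\<bar> * \<bar>c 3\<bar> * (s 0 * s 2) + \<bar>c 0\<bar> * \<bar>c 2\<bar> * (s 1 * s 3))
    + r * (\<bar>c 1\<bar> * \<bar>c 2\<bar> * (s 0 * s 3) + \<bar>c 0\<bar> * \<bar>c 3\<bar> * (s 1 * s 2))"
    unfolding p_def q_def r_def by (simp add: distrib_left distrib_right mult_ac add_ac)
  also have "\<dots> \<le> 1"
    by (rule angle_estimate[of "\<lambda>k. \<bar>c k\<bar>"]) (use c_s_square s_nonneg pqr in auto)
  finally show ?thesis .
qed

end

section \<open>The comass of the form\<close>

lemma orthonormal_independent:
  fixes w :: "nat \<Rightarrow> 'a::euclidean_space"
  assumes orth: "\<And>i j. i < n \<Longrightarrow> j < n \<Longrightarrow> w i \<bullet> w j = (if i = j then 1 else 0)"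
  shows "inj_on w {..<n}" "independent (w ` {..<n})"
proof -
  show "inj_on w {..<n}"
  proof (rule inj_onI, rule ccontr)
    fix i j assume "i \<in> {..<n}" "j \<in> {..<n}" "w i = w j" "i \<noteq> j"
    then show False using orth[of i j] orth[of j j] by simp
  qed
  have "w i \<noteq> 0" if "i < n" for i using orth[OF that that] by auto
  then show "independent (w ` {..<n})"
    by (intro pairwise_orthogonal_independent) (auto simp: pairwise_def real_inner_class.orthogonal_def orth)
qed

lemma sum_mult_delta:
  fixes a :: "nat \<Rightarrow> real"
  assumes "j < n"
  shows "(\<Sum>i<n. a i * (if i = j then 1 else 0)) = a j" "(\<Sum>i<n. a i * (if j = i then 1 else 0)) = a j"
  using assms by (simp_all add: if_distrib[of "(*) _"] cong: if_cong)

lemma orthonormal_expansion: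
  fixes w :: "nat \<Rightarrow> 'a::euclidean_space"
  assumes W: "subspace W" "dim W = n" and w: "\<And>i. i < n \<Longrightarrow> w i \<in> W"
    and orth: "\<And>i j. i < n \<Longrightarrow> j < n \<Longrightarrow> w i \<bullet> w j = (if i = j then 1 else 0)" and x: "x \<in> W"
  shows "x = (\<Sum>i<n. (w i \<bullet> x) *\<^sub>R w i)"
proof -
  have "independent (w ` {..<n})" "card (w ` {..<n}) = n"
    using orthonormal_independent[of n w] orth by (simp_all add: card_image)
  then have "W \<subseteq> span (w ` {..<n})"
    using w W(2) by (intro card_ge_dim_independent) auto
  define y where "y = x - (\<Sum>i<n. (w i \<bullet> x) *\<^sub>R w i)"
  have "w j \<bullet> y = 0" if "j < n" for j
    using that by (simp add: y_def inner_diff_right inner_sum_right orth sum_mult_delta)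
  then have o: "real_inner_class.orthogonal y v" if "v \<in> w ` {..<n}" for v
    using that by (auto simp: real_inner_class.orthogonal_def inner_commute)
  have "y \<in> W" unfolding y_def using W(1) w x by (intro subspace_diff subspace_sum subspace_scale) auto
  then have "y \<in> span (w ` {..<n})" using \<open>W \<subseteq> span (w ` {..<n})\<close> by blast
  from orthogonal_to_span[OF this o] have "y = 0" by (simp add: real_inner_class.orthogonal_def)
  then show ?thesis by (simp add: y_def)
qed

text \<open>Here \<open>n\<close> may be smaller than \<open>m\<close>: if the vectors are
  dependent, padding with zero rows keeps \<open>M\<close> square, and its determinant is 0.\<close>

lemma gram_det_eq_square:
  fixes w v :: "nat \<Rightarrow> 'a::real_inner"
  assumes orth: "\<And>i j. i < n \<Longrightarrow> j < n \<Longrightarrow> w i \<bullet> w j = (if i = j then 1 else 0)" and n: "n \<le> m"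
    and v: "\<And>j. j < m \<Longrightarrow> v j = (\<Sum>i<n. M i j *\<^sub>R w i)" and M: "\<And>i j. n \<le> i \<Longrightarrow> M i j = 0"
  shows "Determinant.det (Matrix.mat m m (\<lambda>(i, j). v i \<bullet> v j)) = (Determinant.det (Matrix.mat m m (\<lambda>(i, j). M i j)))\<^sup>2"
proof -
  let ?M = "Matrix.mat m m (\<lambda>(i, j). M i j)"
  have "Matrix.mat m m (\<lambda>(i, j). v i \<bullet> v j) = transpose_mat ?M * ?M"
  proof (rule eq_matI)
    fix i j assume "i < dim_row (transpose_mat ?M * ?M)" "j < dim_col (transpose_mat ?M * ?M)"
    then have ij: "i < m" "j < m" by auto
    have "v i \<bullet> v j = (\<Sum>k<n. M k i * (w k \<bullet> v j))"
      unfolding v[OF ij(1)] by (simp add: inner_sum_left)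
    also have "\<dots> = (\<Sum>k<n. M k i * M k j)"
      unfolding v[OF ij(2)] by (intro sum.cong) (simp_all add: inner_sum_right orth sum_mult_delta)
    also have "\<dots> = (\<Sum>k<m. M k i * M k j)" using n M by (intro sum.mono_neutral_left) auto
    finally show "Matrix.mat m m (\<lambda>(i, j). v i \<bullet> v j) $$ (i, j) = (transpose_mat ?M * ?M) $$ (i, j)"
      using ij by (simp add: scalar_prod_def atLeast0LessThan)
  qed auto
  then show ?thesis by (simp add: det_mult[of _ m] det_transpose[of _ m] power2_eq_square)
qed

lemma det_diagonal:
  "Determinant.det (Matrix.mat m m (\<lambda>(i, j). if i = j then d i else 0)) = (\<Prod>i<m. d i)"
proof -
  let ?D = "Matrix.mat m m (\<lambda>(i, j). if i = j then d i else 0)"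
  have "Determinant.det ?D = prod_list (diag_mat ?D)"
    by (rule det_upper_triangular[of _ m]) (auto simp: upper_triangular_def)
  also have "diag_mat ?D = map d [0..<m]" by (auto simp: diag_mat_def)
  also have "prod_list \<dots> = (\<Prod>i<m. d i)" by (simp add: prod.distinct_set_conv_list[symmetric] atLeast0LessThan)
  finally show ?thesis .
qed

lemma det_zero_row:
  fixes M :: "nat \<Rightarrow> nat \<Rightarrow> 'b::comm_ring_1"
  assumes "k < m" "\<And>j. M k j = 0"
  shows "Determinant.det (Matrix.mat m m (\<lambda>(i, j). M i j)) = 0"
proof -
  have "Determinant.det (Matrix.mat m m (\<lambda>(i, j). M i j)) =
      (\<Sum>j<m. Matrix.mat m m (\<lambda>(i, j). M i j) $$ (k, j) * cofactor (Matrix.mat m m (\<lambda>(i, j). M i j)) k j)"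
    by (rule laplace_expansion_row) (use assms in auto)
  also have "\<dots> = 0" using assms by (intro sum.neutral) auto
  finally show ?thesis .
qed

section \<open>Orthonormal frames of unit simple vectors\<close>

lemma simple_norm_orthonormal:
  assumes "\<And>i j. i < m \<Longrightarrow> j < m \<Longrightarrow> v i \<bullet> v j = (if i = j then 1 else 0)"
  shows "simple_norm m v = 1"
proof -
  have "Matrix.mat m m (\<lambda>(i, j). v i \<bullet> v j) = 1\<^sub>m m" using assms by (intro eq_matI) auto
  then show ?thesis by (simp add: simple_norm_def)
qed

text \<open>The frame diagonalizes \<open>B\<close> on the span of \<open>v\<close>. A span of
  smaller dimension would make the Gram determinant 0, so the frame has \<open>m\<close> vectors.
  Only the modulus of the transition determinant is controlled, which is enough for bounds on
  moduli.\<close>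

lemma simple_norm_frame:
  fixes v :: "nat \<Rightarrow> 'a::euclidean_space"
  assumes v: "simple_norm m v = 1" and B: "bounded_bilinear B" and sym: "\<And>x y. B x y = B y x"
  obtains w M where "\<And>i j. i < m \<Longrightarrow> j < m \<Longrightarrow> w i \<bullet> w j = (if i = j then 1 else 0)"
    "\<And>i j. i < m \<Longrightarrow> j < m \<Longrightarrow> i \<noteq> j \<Longrightarrow> B (w i) (w j) = (0::real)"
    "\<And>j. j < m \<Longrightarrow> v j = (\<Sum>i<m. M i j *\<^sub>R w i)"
    "\<bar>Determinant.det (Matrix.mat m m (\<lambda>(i, j). M i j))\<bar> = 1"
proof -
  define W where "W = span (v ` {..<m})"
  define n where "n = dim W"
  have n: "n \<le> m" unfolding n_def W_def dim_span by (rule order_trans[OF dim_le_card']) (auto intro: order_trans[OF card_image_le])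
  obtain w where w: "\<forall>i<n. w i \<in> W" "\<forall>i<n. \<forall>j<n. w i \<bullet> w j = (if i = j then 1 else 0)"
      "\<forall>i<n. \<forall>j<n. i \<noteq> j \<longrightarrow> B (w i) (w j) = 0"
    using symmetric_diagonal_frame[OF B sym, of W n] unfolding n_def W_def by auto
  define M where "M i j = (if i < n then w i \<bullet> v j else 0)" for i j
  have v_eq: "v j = (\<Sum>i<n. M i j *\<^sub>R w i)" if "j < m" for j
  proof -
    have "v j = (\<Sum>i<n. (w i \<bullet> v j) *\<^sub>R w i)"
      by (rule orthonormal_expansion[of W]) (use w that in \<open>auto simp: W_def n_def intro: span_base\<close>)
    then show ?thesis by (simp add: M_def)
  qed
  have "Determinant.det (Matrix.mat m m (\<lambda>(i, j). v i \<bullet> v j)) = (Determinant.det (Matrix.mat m m (\<lambda>(i, j). M i j)))\<^sup>2"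
    by (rule gram_det_eq_square[OF _ n v_eq]) (use w in \<open>auto simp: M_def\<close>)
  then have det: "\<bar>Determinant.det (Matrix.mat m m (\<lambda>(i, j). M i j))\<bar> = 1"
    using v by (simp add: simple_norm_def)
  have "n = m"
  proof (rule ccontr)
    assume "n \<noteq> m"
    then have "n < m" using n by simp
    then have "Determinant.det (Matrix.mat m m (\<lambda>(i, j). M i j)) = 0" by (rule det_zero_row) (simp add: M_def)
    then show False using det by simp
  qed
  then show ?thesis using w v_eq det by (intro that[of w M]) auto
qed

context unitary_coordinates
begin

lemma exists_normal_frame:
  fixes g :: "nat \<Rightarrow> 'e"
  assumes g: "\<And>i j. i < 8 \<Longrightarrow> j < 8 \<Longrightarrow> g i \<bullet> g j = (if i = j then 1 else 0)"
  obtains w M where "normal_frame z w" "\<And>j. j < 8 \<Longrightarrow> g j = (\<Sum>i<8. M i j *\<^sub>R w i)"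
    "\<bar>Determinant.det (Matrix.mat 8 8 (\<lambda>(i, j). M i j))\<bar> = 1"
proof -
  have simple: "simple_norm 8 g = 1" by (rule simple_norm_orthonormal) (rule g)
  define W where "W = span (g ` {..<8})"
  have "independent (g ` {..<8})" "card (g ` {..<8}) = 8"
    using orthonormal_independent[of 8 g] g by (simp_all add: card_image)
  then have dim: "dim W = 2 * 4" unfolding W_def by (simp add: dim_eq_card_independent)
  have skew: "Im (h x y) = - Im (h y x)" for x y unfolding h_commute[of x y] by simp
  have "subspace W" by (simp add: W_def)
  then obtain w0 :: "nat \<Rightarrow> 'e" where w0: "\<forall>i<2*4. w0 i \<in> W" "\<forall>i<2*4. \<forall>j<2*4. w0 i \<bullet> w0 j = (if i = j then 1 else 0)"
      "\<forall>i<2*4. \<forall>j<2*4. i div 2 \<noteq> j div 2 \<longrightarrow> Im (h (w0 i) (w0 j)) = 0"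
    using skew_normal_frame[OF bounded_bilinear_Im_h skew _ dim] by blast
  define w where "w i = (if i < 8 then w0 i else 0)" for i
  have nf: "normal_frame z w"
    by unfold_locales (use w0 in \<open>auto simp: w_def\<close>)
  have exp: "g j = (\<Sum>i<8. (w i \<bullet> g j) *\<^sub>R w i)" if "j < 8" for j
    by (rule orthonormal_expansion[of W]) (use w0 that dim in \<open>auto simp: W_def w_def intro: span_base\<close>)
  define M where "M i j = (if i < 8 then w i \<bullet> g j else 0)" for i j
  have exp': "g j = (\<Sum>i<8. M i j *\<^sub>R w i)" if "j < 8" for j using exp[OF that] by (simp add: M_def)
  have "Determinant.det (Matrix.mat 8 8 (\<lambda>(i, j). g i \<bullet> g j)) = (Determinant.det (Matrix.mat 8 8 (\<lambda>(i, j). M i j)))\<^sup>2"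
    by (rule gram_det_eq_square[OF _ _ exp']) (use w0 in \<open>auto simp: M_def w_def\<close>)
  then have "\<bar>Determinant.det (Matrix.mat 8 8 (\<lambda>(i, j). M i j))\<bar> = 1"
    using simple by (simp add: simple_norm_def)
  then show ?thesis using nf exp' by (intro that[of w M]) auto
qed

lemma cmod_Phi_orthonormal_le_1:
  assumes "\<And>i j. i < 8 \<Longrightarrow> j < 8 \<Longrightarrow> g i \<bullet> g j = (if i = j then 1 else 0)" and "cmod \<delta> = 1"
  shows "cmod (Phi \<delta> g) \<le> 1"
proof -
  obtain w M where w: "normal_frame z w" "\<And>j. j < 8 \<Longrightarrow> g j = (\<Sum>i<8. M i j *\<^sub>R w i)"
    "\<bar>Determinant.det (Matrix.mat 8 8 (\<lambda>(i, j). M i j))\<bar> = 1"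
    using exists_normal_frame[OF assms(1)] by blast
  have "Phi \<delta> g = of_real (Determinant.det (Matrix.mat 8 8 (\<lambda>(i, j). M i j))) * Phi \<delta> w"
    by (rule alt_form_mat_mult[OF alt_form_Phi w(2)])
  then show ?thesis using normal_frame.cmod_Phi_frame_le_1[OF w(1) assms(2)] w(3) by (simp add: norm_mult)
qed

text \<open>With the pulled back inner product diagonalized, the images of the frame are orthogonal
  with norms \<open>d i \<le> 1\<close>. Pulling out the product of the norms leaves an orthonormal
  tuple.\<close>

lemma cmod_Phi_contraction_le_1:
  fixes \<pi> :: "'p::euclidean_space \<Rightarrow> 'e"
  assumes \<pi>: "linear \<pi>" "\<And>x. norm (\<pi> x) \<le> norm x" and v: "simple_norm 8 v = 1" and \<delta>: "cmod \<delta> = 1"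
  shows "cmod (Phi \<delta> (\<pi> \<circ> v)) \<le> 1"
proof -
  have bil: "bounded_bilinear (\<lambda>x y. \<pi> x \<bullet> \<pi> y)"
    using bounded_bilinear.comp[OF bounded_bilinear_inner] \<pi>(1) by (simp add: linear_conv_bounded_linear)
  obtain w M where w: "\<And>i j. i < 8 \<Longrightarrow> j < 8 \<Longrightarrow> w i \<bullet> w j = (if i = j then 1 else 0)"
    "\<And>i j. i < 8 \<Longrightarrow> j < 8 \<Longrightarrow> i \<noteq> j \<Longrightarrow> \<pi> (w i) \<bullet> \<pi> (w j) = 0"
    "\<And>j. j < 8 \<Longrightarrow> v j = (\<Sum>i<8. M i j *\<^sub>R w i)"
    "\<bar>Determinant.det (Matrix.mat 8 8 (\<lambda>(i, j). M i j))\<bar> = 1"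
    by (rule simple_norm_frame[OF v bil]) (auto simp: inner_commute)
  have "(\<pi> \<circ> v) j = (\<Sum>i<8. M i j *\<^sub>R (\<pi> \<circ> w) i)" if "j < 8" for j
    using w(3)[OF that] \<pi>(1) by (simp add: linear_sum linear_scale)
  then have "Phi \<delta> (\<pi> \<circ> v) = of_real (Determinant.det (Matrix.mat 8 8 (\<lambda>(i, j). M i j))) * Phi \<delta> (\<pi> \<circ> w)"
    by (rule alt_form_mat_mult[OF alt_form_Phi])
  then have "cmod (Phi \<delta> (\<pi> \<circ> v)) = cmod (Phi \<delta> (\<pi> \<circ> w))" using w(4) by (simp add: norm_mult)
  also have "\<dots> \<le> 1"
  proof (cases "\<forall>i<8. \<pi> (w i) \<noteq> 0")
    case True
    define d where "d i = norm (\<pi> (w i))" for i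
    have d: "0 \<le> d i" "d i \<le> 1" "d i \<noteq> 0" if "i < 8" for i
      using \<pi>(2)[of "w i"] w(1)[OF that that] True that by (simp_all add: d_def norm_eq_1[symmetric])
    define g where "g i = \<pi> (w i) /\<^sub>R d i" for i
    have "(\<pi> \<circ> w) j = (\<Sum>i<8. (if i = j then d i else 0) *\<^sub>R g i)" if "j < 8" for j
    proof -
      have "(\<Sum>i<8. (if i = j then d i else 0) *\<^sub>R g i) = (\<Sum>i<8. if i = j then d i *\<^sub>R g i else 0)"
        by (intro sum.cong) auto
      also have "\<dots> = d j *\<^sub>R g j" using that by simp
      finally show ?thesis using d(3)[OF that] by (simp add: g_def)
    qed
    then have "Phi \<delta> (\<pi> \<circ> w) = of_real (Determinant.det (Matrix.mat 8 8 (\<lambda>(i, j). if i = j then d i else 0))) * Phi \<delta> g"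
      by (rule alt_form_mat_mult[OF alt_form_Phi])
    then have "cmod (Phi \<delta> (\<pi> \<circ> w)) = \<bar>\<Prod>i<8. d i\<bar> * cmod (Phi \<delta> g)" unfolding det_diagonal by (simp only: norm_mult norm_of_real)
    also have "\<dots> \<le> 1 * 1"
    proof (intro mult_mono)
      have "(\<Prod>i<8. d i) \<le> 1" "0 \<le> (\<Prod>i<8. d i)" using d by (auto intro!: prod_le_1 prod_nonneg)
      then show "\<bar>\<Prod>i<8. d i\<bar> \<le> 1" by simp
      have "g i \<bullet> g j = (if i = j then 1 else 0)" if "i < 8" "j < 8" for i j
        using w(2)[of i j] d(3)[of i] that by (auto simp: g_def d_def dot_square_norm power2_eq_square field_simps)
      then show "cmod (Phi \<delta> g) \<le> 1" using \<delta> by (rule cmod_Phi_orthonormal_le_1)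
    qed auto
    finally show ?thesis by simp
  next
    case False
    then obtain k where k: "k < 8" "\<pi> (w k) = 0" by blast
    \<comment> \<open>Scaling the \<open>k\<close>-th image by 0 does not change the tuple, so the
      form equals 0 times itself.\<close>
    have "(\<pi> \<circ> w) j = (\<Sum>i<8. (if i = j then if i = k then 0 else 1 else 0) *\<^sub>R (\<pi> \<circ> w) i)" if "j < 8" for j
    proof -
      have "(\<Sum>i<8. (if i = j then if i = k then 0 else 1 else 0) *\<^sub>R (\<pi> \<circ> w) i) = (\<Sum>i<8. if i = j then \<pi> (w i) else 0)"
        using k by (intro sum.cong) auto
      then show ?thesis using that by simp
    qed
    then have "Phi \<delta> (\<pi> \<circ> w) = of_real (Determinant.det (Matrix.mat 8 8 (\<lambda>(i, j). if i = j then if i = k then 0 else 1 else 0))) * Phi \<delta> (\<pi> \<circ> w)"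
      by (rule alt_form_mat_mult[OF alt_form_Phi])
    also have "Determinant.det (Matrix.mat 8 8 (\<lambda>(i, j). if i = j then if i = k then 0 else 1 else 0)) = (0::real)"
      by (rule det_zero_row[OF k(1)]) auto
    finally have "Phi \<delta> (\<pi> \<circ> w) = 0" by (simp only: of_real_0 mult_zero_left)
    then show ?thesis by (simp only: norm_zero zero_le_one)
  qed
  finally show ?thesis .
qed

text \<open>The frame of a complex 4-plane: each block is \<open>x, \<i> x\<close>, so all
  \<open>c k\<close> are 1 and all \<open>s k\<close> are 0, and only
  \<open>\<omega>\<^sup>4 / 4!\<close> survives.\<close>

lemma exists_frame_Phi_eq_1:
  "\<exists>w. (\<forall>i<8. \<forall>j<8. w i \<bullet> w j = (if i = j then 1 else 0)) \<and> Phi \<delta> w = 1"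
proof -
  obtain e where e: "\<forall>j. \<forall>i<8. z i (e j) = (if i = j then 1 else 0)" using dual_basis by blast
  have "\<forall>k. \<exists>x. \<forall>i<8. z i x = (if i = k then \<i> else 0)" by (intro allI surj_z)
  from choice[OF this] obtain f where f: "\<forall>k. \<forall>i<8. z i (f k) = (if i = k then \<i> else 0)" by blast
  define w where "w i = (if 8 \<le> i then 0 else if even i then e (i div 2) else f (i div 2))" for i
  define a where "a i = (if even i then 1 else \<i>)" for i :: nat
  have zw: "z k (w i) = (if k = i div 2 then a i else 0)" if "k < 8" "i < 8" for i k
    using e f that by (simp add: w_def a_def)
  have h: "h (w i) (w j) = (if i div 2 = j div 2 then cnj (a i) * a j else 0)" if "i < 8" "j < 8" for i j
  proof -
    have "h (w i) (w j) = (\<Sum>k<8. if k = i div 2 then if i div 2 = j div 2 then cnj (a i) * a j else 0 else 0)"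
      unfolding h_def using that by (intro sum.cong) (auto simp: zw)
    also have "\<dots> = (if i div 2 = j div 2 then cnj (a i) * a j else 0)" using that by simp
    finally show ?thesis .
  qed
  have orth: "w i \<bullet> w j = (if i = j then 1 else 0)" if "i < 8" "j < 8" for i j
  proof -
    have "i div 2 = j div 2 \<Longrightarrow> even i = even j \<Longrightarrow> i = j" by presburger
    then show ?thesis unfolding Re_h[symmetric] h[OF that] by (auto simp: a_def)
  qed
  have zero: "w i = 0" if "8 \<le> i" for i using that by (simp add: w_def)
  interpret normal_frame z w
    by unfold_locales (simp_all add: orth h zero)
  have c: "c k = 1" if "k < 4" for k using that h[of "2 * k" "2 * k + 1"] by (simp add: c_def a_def)
  have "minors b w i j = 0" if "b + 3 < 8" "i < 4" "j < 4" for b i j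
  proof -
    have "block_minor (\<lambda>t. z p (w t)) (\<lambda>t. z q (w t)) k = 0" if "p < 8" "q < 8" "k < 4" for p q k
      using that by (simp add: block_minor_def zw a_def)
    then show ?thesis using that by (simp add: minors_def pair_minor_def)
  qed
  moreover have "cdet (map z [0..<8]) w = 0"
    using cmod_volume_frame c[of 0] by (simp add: s_def)
  ultimately have "Phi \<delta> w = 1" unfolding Phi_frame by (simp add: c)
  then show ?thesis using orth by blast
qed

text \<open>The isometric section \<open>\<sigma>\<close> carries the maximizing frame into the
  source, so the bound 1 is attained.\<close>

theorem comass_pullback_Phi:
  fixes \<pi> :: "'p::euclidean_space \<Rightarrow> 'e"
  assumes \<pi>: "linear \<pi>" "\<And>x. norm (\<pi> x) \<le> norm x" and \<delta>: "cmod \<delta> = 1"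
    and \<sigma>: "\<And>x y. \<sigma> x \<bullet> \<sigma> y = x \<bullet> y" "\<And>x. \<pi> (\<sigma> x) = x"
  shows "comass 8 (\<lambda>v. Re (Phi \<delta> (\<pi> \<circ> v))) = 1"
  unfolding comass_def
proof (rule cSup_eq_maximum)
  obtain w where w: "\<forall>i<8. \<forall>j<8. w i \<bullet> w j = (if i = j then 1 else 0)" "Phi \<delta> w = 1"
    using exists_frame_Phi_eq_1 by blast
  have "simple_norm 8 (\<sigma> \<circ> w) = 1" by (rule simple_norm_orthonormal) (use w \<sigma> in auto)
  moreover have "\<pi> \<circ> (\<sigma> \<circ> w) = w" using \<sigma>(2) by auto
  ultimately show "1 \<in> {Re (Phi \<delta> (\<pi> \<circ> v)) |v. simple_norm 8 v = 1}" using w(2) by (auto intro!: exI[of _ "\<sigma> \<circ> w"])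
next
  fix x assume "x \<in> {Re (Phi \<delta> (\<pi> \<circ> v)) |v. simple_norm 8 v = 1}"
  then show "x \<le> 1"
    using cmod_Phi_contraction_le_1[OF \<pi> _ \<delta>] complex_Re_le_cmod order_trans by blast
qed

end

lemma bdd_above_alt_form:
  fixes F :: "('a::euclidean_space, complex) form"
  assumes F: "alt_form m F"
  shows "bdd_above {Re (F v) |v. simple_norm m v = 1}"
proof -
  obtain K where K: "\<And>w. \<forall>i<m. norm (w i) \<le> 1 \<Longrightarrow> cmod (F w) \<le> K" using alt_form_bounded[OF F] by blast
  show ?thesis
  proof (rule bdd_aboveI)
    fix x assume "x \<in> {Re (F v) |v. simple_norm m v = 1}"
    then obtain v where v: "x = Re (F v)" "simple_norm m v = 1" by blast
    obtain w M where w: "\<And>i j. i < m \<Longrightarrow> j < m \<Longrightarrow> w i \<bullet> w j = (if i = j then 1 else 0)"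
      "\<And>j. j < m \<Longrightarrow> v j = (\<Sum>i<m. M i j *\<^sub>R w i)" "\<bar>Determinant.det (Matrix.mat m m (\<lambda>(i, j). M i j))\<bar> = 1"
      by (rule simple_norm_frame[OF v(2) bounded_bilinear_inner]) (auto simp: inner_commute)
    have "F v = of_real (Determinant.det (Matrix.mat m m (\<lambda>(i, j). M i j))) * F w"
      by (rule alt_form_mat_mult[OF F w(2)])
    then have "cmod (F v) = cmod (F w)" using w(3) by (simp add: norm_mult)
    also have "\<dots> \<le> K" using w(1) by (intro K) (simp add: norm_eq_sqrt_inner)
    finally show "x \<le> K" using v(1) complex_Re_le_cmod[of "F v"] by linarith
  qed
qed

section \<open>The self-wedge of the form\<close>

lemma cdet_move_left: "cdet (xs @ us @ b # ys) v = (- 1) ^ length us * cdet (xs @ b # us @ ys) v"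
proof (induction us arbitrary: xs)
  case (Cons u us)
  show ?case using Cons.IH[of "xs @ [u]"] cdet_swap[of xs u b "us @ ys" v] by simp
qed simp

lemma cdet_block_move:
  "even (length ws) \<Longrightarrow> cdet (xs @ us @ ws @ ys) v = cdet (xs @ ws @ us @ ys) v"
proof (induction ws arbitrary: xs rule: induct_list012)
  case (3 a b ws)
  have "cdet (xs @ us @ (a # b # ws) @ ys) v = cdet ((xs @ [a, b]) @ us @ ws @ ys) v"
    using cdet_pair_move[of xs us a b "ws @ ys" v] by simp
  then show ?case using "3.IH"(1)[of "xs @ [a, b]"] "3.prems" by simp
qed auto

text \<open>Each \<open>b j\<close> passes the \<open>a\<close> letters of all later indices, which
  gives the exponent \<open>0 + 1 + ... + (n - 1)\<close>.\<close>

lemma cdet_interleave: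
  "cdet (xs @ map a js @ map b js @ ys) v = (- 1) ^ (\<Sum>i<length js. i) * cdet (xs @ pair_word a b js @ ys) v"
proof (induction js arbitrary: xs)
  case (Cons j js)
  have "cdet (xs @ map a (j # js) @ map b (j # js) @ ys) v =
      (- 1) ^ length js * cdet ((xs @ [a j, b j]) @ map a js @ map b js @ ys) v"
    using cdet_move_left[of "xs @ [a j]" "map a js" "b j" "map b js @ ys" v] by simp
  also have "\<dots> = (- 1) ^ length js * ((- 1) ^ (\<Sum>i<length js. i) * cdet ((xs @ [a j, b j]) @ pair_word a b js @ ys) v)"
    by (subst Cons.IH) simp
  finally show ?case by (simp add: power_add)
qed simp

lemma wedge_word_sums:
  assumes "\<And>s. s \<in> S \<Longrightarrow> length (V s) = k" "\<And>t. t \<in> T \<Longrightarrow> length (W t) = l"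
  shows "wedge k l (\<lambda>v. \<Sum>s\<in>S. a s * cdet (V s) v) (\<lambda>v. \<Sum>t\<in>T. b t * cdet (W t) v) =
    (\<lambda>v. \<Sum>s\<in>S. \<Sum>t\<in>T. a s * b t * cdet (V s @ W t) v)"
proof -
  have "wedge k l (\<lambda>v. \<Sum>s\<in>S. a s * cdet (V s) v) (\<lambda>v. \<Sum>t\<in>T. b t * cdet (W t) v) =
      (\<lambda>v. \<Sum>s\<in>S. \<Sum>t\<in>T. a s * (b t * wedge k l (cdet (V s)) (cdet (W t)) v))"
    by (simp add: wedge_sum_left wedge_sum_right wedge_scale_left wedge_scale_right sum_distrib_left)
  also have "\<dots> = (\<lambda>v. \<Sum>s\<in>S. \<Sum>t\<in>T. a s * b t * cdet (V s @ W t) v)"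
  proof (intro ext sum.cong refl)
    fix v s t assume "s \<in> S" "t \<in> T"
    then have "wedge k l (cdet (V s)) (cdet (W t)) = cdet (V s @ W t)"
      using wedge_cdet[of "V s" "W t"] assms by simp
    then show "a s * (b t * wedge k l (cdet (V s)) (cdet (W t)) v) = a s * b t * cdet (V s @ W t) v" by simp
  qed
  finally show ?thesis .
qed

lemma prod_list_const: "prod_list (map (\<lambda>_. q) js) = q ^ length js"
  by (induction js) simp_all

lemma words_subset_mono: "J \<subseteq> K \<Longrightarrow> words n J \<subseteq> words n K"
  by (auto simp: words_def)

context unitary_coordinates
begin

definition zb :: "nat \<Rightarrow> 'e \<Rightarrow> complex" where "zb k x = cnj (z k x)"

abbreviation pw :: "nat list \<Rightarrow> ('e \<Rightarrow> complex) list" where "pw \<equiv> pair_word z zb"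

text \<open>The real basis \<open>x\<^sub>0, \<i> x\<^sub>0, x\<^sub>1, \<i> x\<^sub>1, ...\<close>
  of a unitary basis \<open>x\<close>. The value of a 16-form on it is the coefficient of the volume
  form.\<close>

definition adapted_basis :: "(nat \<Rightarrow> 'e) \<Rightarrow> bool" where
  "adapted_basis e \<longleftrightarrow> (\<forall>i<8. \<forall>j. z i (e (2 * j)) = (if i = j then 1 else 0) \<and> z i (e (2 * j + 1)) = (if i = j then \<i> else 0))"

lemma exists_adapted_basis: "\<exists>e. adapted_basis e"
proof -
  have "\<forall>k. \<exists>x. \<forall>i<8. z i x = (if i = k then \<i> else 0)" by (intro allI surj_z)
  from choice[OF this] obtain f where f: "\<forall>k. \<forall>i<8. z i (f k) = (if i = k then \<i> else 0)" by blast
  obtain g where g: "\<forall>k. \<forall>i<8. z i (g k) = (if i = k then 1 else 0)" using dual_basis by blast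
  have "adapted_basis (\<lambda>t. if even t then g (t div 2) else f (t div 2))"
    unfolding adapted_basis_def using f g by simp
  then show ?thesis by blast
qed

lemma adapted_basis_orthonormal:
  assumes e: "adapted_basis e" and ij: "i < 16" "j < 16"
  shows "e i \<bullet> e j = (if i = j then 1 else 0)"
proof -
  define a where "a i = (if even i then 1 else \<i>)" for i :: nat
  have ze: "z k (e i) = (if k = i div 2 then a i else 0)" if "k < 8" for i k
  proof (cases "even i")
    case True
    then obtain m where "i = 2 * m" by blast
    then show ?thesis using e that by (simp add: adapted_basis_def a_def)
  next
    case False
    then obtain m where "i = 2 * m + 1" using oddE by blast
    then show ?thesis using e that by (simp add: adapted_basis_def a_def)
  qed
  have "h (e i) (e j) = (\<Sum>k<8. if k = i div 2 then if i div 2 = j div 2 then cnj (a i) * a j else 0 else 0)"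
    unfolding h_def by (intro sum.cong) (auto simp: ze)
  also have "\<dots> = (if i div 2 = j div 2 then cnj (a i) * a j else 0)" using ij by simp
  finally have h: "h (e i) (e j) = (if i div 2 = j div 2 then cnj (a i) * a j else 0)" .
  have "i div 2 = j div 2 \<Longrightarrow> even i = even j \<Longrightarrow> i = j" by presburger
  then show ?thesis unfolding Re_h[symmetric] h by (auto simp: a_def)
qed

text \<open>The last pair of covectors vanishes on all earlier basis vectors, and on its own two it
  has the value \<open>1 * (- \<i>) - \<i> * 1 = -2\<i>\<close>.\<close>

lemma cdet_pw_basis:
  assumes e: "adapted_basis e"
  shows "n \<le> 8 \<Longrightarrow> cdet (pw [0..<n]) e = (- 2 * \<i>) ^ n"
proof (induction n)
  case (Suc n)
  have e0: "z i (e (2 * j)) = (if i = j then 1 else 0)" "z i (e (2 * j + 1)) = (if i = j then \<i> else 0)" if "i < 8" for i j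
    using e that by (simp_all add: adapted_basis_def)
  have zero: "z n (e j) = 0" if "j < 2 * n" for j
  proof (cases "even j")
    case True
    then show ?thesis using e0(1)[of n "j div 2"] that Suc.prems by auto
  next
    case False
    then obtain m where "j = 2 * m + 1" using oddE by blast
    then show ?thesis using e0(2)[of n m] that Suc.prems by auto
  qed
  have "cdet (pw [0..<Suc n]) e = cdet (pw [0..<n] @ [z n, zb n]) e" by simp
  also have "\<dots> = cdet (pw [0..<n]) e * cdet [z n, zb n] (\<lambda>j. e (length (pw [0..<n]) + j))"
    by (rule cdet_append_block) (auto simp: zero zb_def)
  also have "cdet [z n, zb n] (\<lambda>j. e (length (pw [0..<n]) + j)) = - 2 * \<i>"
    using e0[of n n] Suc.prems by (simp add: cdet_2 zb_def)
  finally show ?case using Suc by simp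
qed simp

text \<open>Kept complex valued, so that it expands into words in the coordinates and their
  conjugates.\<close>

definition Re_Phi :: "complex \<Rightarrow> ('e, complex) form" where
  "Re_Phi \<delta> v = of_real (Re (Phi \<delta> v))"

definition holo_word :: "bool \<Rightarrow> ('e \<Rightarrow> complex) list" where
  "holo_word b = map (if b then z else zb) [0..<8]"

text \<open>The first flag selects holomorphic or conjugate covectors, the second flag the summand
  of the space.\<close>

definition half_word :: "bool \<times> bool \<Rightarrow> ('e \<Rightarrow> complex) list" where
  "half_word p = map (if fst p then z else zb) (if snd p then [0..<4] else [4..<8])"

lemma kaehler_power_sum:
  "of_real (wedge_power 2 kaehler n v) = (\<Sum>js\<in>words n {..<8}. (\<i> / 2) ^ n * cdet (pw js) v)"
proof -
  have "complex_of_real (wedge_power 2 kaehler n v) = wedge_power 2 (\<lambda>v. of_real (kaehler v)) n v"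
    by (rule of_real_wedge_power)
  also have "(\<lambda>v. complex_of_real (kaehler v)) = (\<lambda>v. \<Sum>k<8. (\<i> / 2) * cdet [z k, zb k] v)"
    unfolding kaehler_eq_sum zb_def[abs_def] ..
  also have "wedge_power 2 \<dots> n v = (\<Sum>js\<in>words n {..<8}. prod_list (map (\<lambda>_. \<i> / 2) js) * cdet (pw js) v)"
    unfolding wedge_power_pair_sum ..
  also have "\<dots> = (\<Sum>js\<in>words n {..<8}. (\<i> / 2) ^ n * cdet (pw js) v)"
    by (intro sum.cong) (auto simp: prod_list_const words_def)
  finally show ?thesis .
qed

lemma map_zb: "map (\<lambda>f x. cnj (f x)) (map z js) = map zb js"
  by (simp add: zb_def[abs_def])

lemma of_real_Re: "complex_of_real (Re x) = x / 2 + cnj x / 2"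
  by (simp add: complex_eq_iff)

text \<open>A real part is the average of a form and its conjugate, and conjugation exchanges
  \<open>z\<close> and \<open>zb\<close> in a word. The denominator 4 in the last sum combines this
  average with the factor of \<open>\<omega>\<^sup>2 / 2\<close>.\<close>

lemma Re_Phi_sum:
  "Re_Phi \<delta> = (\<lambda>v. (\<Sum>b\<in>UNIV. (if b then \<delta> / 2 else cnj \<delta> / 2) * cdet (holo_word b) v)
     + (\<Sum>js\<in>words 4 {..<8}. (\<i> / 2) ^ 4 / 24 * cdet (pw js) v)
     + (\<Sum>(p, js)\<in>UNIV \<times> words 2 {..<8}. (\<i> / 2) ^ 2 / 4 * cdet (half_word p @ pw js) v))"
proof
  fix v
  have 1: "of_real (Re (\<delta> * cdet (map z [0..<8]) v)) =
      (\<Sum>b\<in>UNIV. (if b then \<delta> / 2 else cnj \<delta> / 2) * cdet (holo_word b) v)"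
    unfolding of_real_Re complex_cnj_mult cnj_cdet map_zb by (simp add: UNIV_bool holo_word_def)
  have 2: "of_real (1 / 24 * wedge_power 2 kaehler 4 v) = (\<Sum>js\<in>words 4 {..<8}. (\<i> / 2) ^ 4 / 24 * cdet (pw js) v)"
    unfolding of_real_mult kaehler_power_sum sum_distrib_left by (intro sum.cong) auto
  have chi: "(\<lambda>u. complex_of_real (Re (chi u))) = (\<lambda>u. \<Sum>p\<in>UNIV. 1 / 2 * cdet (half_word p) u)"
    unfolding of_real_Re chi_def complex_cnj_add cnj_cdet map_zb
    by (simp add: UNIV_bool half_word_def sum.cartesian_product[symmetric] add_divide_distrib add_ac flip: UNIV_Times_UNIV)
  have sq: "(\<lambda>u. complex_of_real (1 / 2 * wedge_power 2 kaehler 2 u)) = (\<lambda>u. \<Sum>js\<in>words 2 {..<8}. (\<i> / 2) ^ 2 / 2 * cdet (pw js) u)"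
    unfolding of_real_mult kaehler_power_sum sum_distrib_left by (intro ext sum.cong) auto
  have "complex_of_real (Re (wedge 4 4 chi (\<lambda>u. of_real (1 / 2 * wedge_power 2 kaehler 2 u)) v)) =
      wedge 4 4 (\<lambda>u. of_real (Re (chi u))) (\<lambda>u. of_real (1 / 2 * wedge_power 2 kaehler 2 u)) v"
    unfolding Re_wedge_of_real of_real_wedge ..
  also have "\<dots> = (\<Sum>p\<in>UNIV. \<Sum>js\<in>words 2 {..<8}. 1 / 2 * ((\<i> / 2) ^ 2 / 2) * cdet (half_word p @ pw js) v)"
    unfolding chi sq by (subst wedge_word_sums) (auto simp: half_word_def words_def)
  also have "\<dots> = (\<Sum>(p, js)\<in>UNIV \<times> words 2 {..<8}. (\<i> / 2) ^ 2 / 4 * cdet (half_word p @ pw js) v)"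
    by (simp add: sum.cartesian_product)
  finally have 3: "complex_of_real (Re (wedge 4 4 chi (\<lambda>u. of_real (1 / 2 * wedge_power 2 kaehler 2 u)) v)) =
      (\<Sum>(p, js)\<in>UNIV \<times> words 2 {..<8}. (\<i> / 2) ^ 2 / 4 * cdet (half_word p @ pw js) v)" .
  have "Re_Phi \<delta> v = of_real (Re (\<delta> * cdet (map z [0..<8]) v)) + of_real (1 / 24 * wedge_power 2 kaehler 4 v)
      + of_real (Re (wedge 4 4 chi (\<lambda>u. of_real (1 / 2 * wedge_power 2 kaehler 2 u)) v))"
    unfolding Re_Phi_def Phi_def by simp
  then show "Re_Phi \<delta> v = (\<Sum>b\<in>UNIV. (if b then \<delta> / 2 else cnj \<delta> / 2) * cdet (holo_word b) v)
     + (\<Sum>js\<in>words 4 {..<8}. (\<i> / 2) ^ 4 / 24 * cdet (pw js) v)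
     + (\<Sum>(p, js)\<in>UNIV \<times> words 2 {..<8}. (\<i> / 2) ^ 2 / 4 * cdet (half_word p @ pw js) v)"
    unfolding 1 2 3 .
qed

section \<open>Words that vanish because of a repeated letter\<close>

lemma cdet_common_letter: "x \<in> set xs \<Longrightarrow> x \<in> set ys \<Longrightarrow> cdet (xs @ ys) v = 0"
  by (rule cdet_not_distinct) auto

lemma words_memE:
  assumes "js \<in> words (Suc n) J"
  obtains j where "j \<in> J" "z j \<in> set (pw js)" "zb j \<in> set (pw js)"
  using assms by (cases js) (auto simp: words_def)

text \<open>A pair brings both \<open>z j\<close> and \<open>zb j\<close>, and a full word of either
  type contains one of them.\<close>

lemma holo_word_meets: "j < 8 \<Longrightarrow> z j \<in> set xs \<Longrightarrow> zb j \<in> set xs \<Longrightarrow> \<exists>x. x \<in> set (holo_word b) \<and> x \<in> set xs"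
  by (rule exI[of _ "if b then z j else zb j"]) (auto simp: holo_word_def)

definition half_set :: "bool \<times> bool \<Rightarrow> nat set" where
  "half_set p = (if snd p then {..<4} else {4..<8})"

lemma half_word_meets:
  "j \<in> half_set p \<Longrightarrow> z j \<in> set xs \<Longrightarrow> zb j \<in> set xs \<Longrightarrow> \<exists>x. x \<in> set (half_word p) \<and> x \<in> set xs"
  by (rule exI[of _ "if fst p then z j else zb j"]) (auto simp: half_word_def half_set_def)

text \<open>Six different indices out of eight cannot avoid the four of a half, and a pair at such
  an index repeats a letter of \<open>half_word p\<close>.\<close>

lemma half_word_long_not_distinct:
  assumes "js \<in> words 6 {..<8}"
  shows "\<not> distinct (half_word p @ pw js)"
proof
  assume d: "distinct (half_word p @ pw js)"
  then have "distinct js" using distinct_pair_wordD by auto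
  then have "card (set js) = 6" using assms by (simp add: words_def distinct_card)
  moreover have "set js \<inter> half_set p = {}"
  proof (rule ccontr)
    assume "set js \<inter> half_set p \<noteq> {}"
    then obtain j where "j \<in> set js" "j \<in> half_set p" by blast
    then show False using half_word_meets[of j p "pw js"] d by (auto simp: set_pair_word)
  qed
  then have "set js \<subseteq> {..<8} - half_set p" using assms by (auto simp: words_def)
  then have "card (set js) \<le> card ({..<8} - half_set p)" by (intro card_mono) auto
  moreover have "card ({..<8} - half_set p) = 4"
    by (subst card_Diff_subset) (auto simp: half_set_def)
  ultimately show False by simp
qed

lemma cdet_pw_perm:
  assumes "adapted_basis e" "set js = {..<8}" "distinct js"
  shows "cdet (pw js) e = 256"
proof -
  have "mset js = mset [0..<8]"
    by (rule set_eq_iff_mset_eq_distinct[THEN iffD1]) (use assms in \<open>auto simp: atLeast0LessThan\<close>)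
  from cdet_pair_word_mset[OF this, of "[]" z zb e] show ?thesis
    using cdet_pw_basis[OF assms(1), of 8] by (simp add: power_mult_distrib)
qed

text \<open>Half words on different halves meet every index, so any pair repeats a letter; a half
  word taken twice repeats letters too. There remain opposite types on one half, where the pairs
  must run through the other half: \<open>4!\<close> orders, each of value 256.\<close>

lemma half_words_sum:
  assumes e: "adapted_basis e"
  shows "(\<Sum>js\<in>words 4 {..<8}. cdet (half_word p @ half_word q @ pw js) e) =
    (if q = (\<not> fst p, snd p) then 24 * 256 else 0)"
proof (cases "q = (\<not> fst p, snd p)")
  case True
  define J where "J = {..<8} - half_set p"
  define I where "I = (if snd p then [0..<4] else [4..<8::nat])"
  have J: "finite J" "card J = 4" "J \<subseteq> {..<8}"
    unfolding J_def by (simp, subst card_Diff_subset) (auto simp: half_set_def)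
  have I: "set I = half_set p" "distinct I" "length I = 4" by (auto simp: I_def half_set_def atLeast0LessThan)
  have zero: "cdet (half_word p @ half_word q @ pw js) e = 0" if "js \<in> words 4 {..<8}" "js \<notin> words 4 J" for js
  proof -
    have "\<not> set js \<subseteq> J" "set js \<subseteq> {..<8}" using that by (auto simp: words_def)
    then obtain j where j: "j \<in> set js" "j \<in> half_set p" unfolding J_def by blast
    then obtain x where "x \<in> set (half_word p)" "x \<in> set (half_word q @ pw js)"
      using half_word_meets[of j p "pw js"] by (auto simp: set_pair_word)
    then show ?thesis by (rule cdet_common_letter)
  qed
  have "(\<Sum>js\<in>words 4 {..<8}. cdet (half_word p @ half_word q @ pw js) e) =
      (\<Sum>js\<in>words 4 J. cdet (half_word p @ half_word q @ pw js) e)"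
    by (rule sum.mono_neutral_right) (use zero words_subset_mono[OF J(3)] in auto)
  also have "\<dots> = fact 4 * 256"
  proof (rule sum_words_distinct[OF J(1,2)])
    fix js assume js: "js \<in> words 4 J" "\<not> distinct js"
    then have "\<not> distinct (half_word p @ half_word q @ pw js)" using distinct_pair_wordD[of z zb js] by auto
    then show "cdet (half_word p @ half_word q @ pw js) e = 0" by (rule cdet_not_distinct)
  next
    fix js assume js: "js \<in> words 4 J" "distinct js"
    have "set js = J" using js J by (intro card_subset_eq) (auto simp: words_def distinct_card)
    then have d: "set (I @ js) = {..<8}" "distinct (I @ js)" using I js by (auto simp: J_def half_set_def)
    have "cdet (half_word p @ half_word q @ pw js) e = cdet (map z I @ map zb I @ pw js) e"
    proof (cases "fst p")
      case fst: True
      then show ?thesis using True by (simp add: half_word_def I_def)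
    next
      case False
      then have "half_word p = map zb I" "half_word q = map z I" using True by (simp_all add: half_word_def I_def)
      \<comment> \<open>Half words have even length, so exchanging them costs no sign.\<close>
      then show ?thesis using cdet_block_move[of "map z I" "[]" "map zb I" "pw js" e] I(3) by simp
    qed
    \<comment> \<open>The sign of the interleaving is \<open>(- 1) ^ 6\<close>.\<close>
    also have "\<dots> = cdet (pw (I @ js)) e"
      using cdet_interleave[of "[]" z I zb "pw js" e] I(3) by (simp add: sum_lessThan_4)
    also have "\<dots> = 256" using e d by (rule cdet_pw_perm)
    finally show "cdet (half_word p @ half_word q @ pw js) e = 256" .
  qed
  finally show ?thesis using True by (simp add: fact_numeral)
next
  case False
  have "cdet (half_word p @ half_word q @ pw js) e = 0" if js: "js \<in> words 4 {..<8}" for js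
  proof (cases "snd p = snd q")
    case True
    then have "p = q" using False by (cases p; cases q) auto
    moreover have "half_word q \<noteq> []" by (simp add: half_word_def)
    then obtain x where "x \<in> set (half_word q)" by (meson last_in_set)
    ultimately show ?thesis by (intro cdet_common_letter[of x]) auto
  next
    case False
    obtain j where j: "j < 8" "z j \<in> set (pw js)" "zb j \<in> set (pw js)"
      using words_memE[of js 3 "{..<8}"] js by (auto simp: numeral_eq_Suc)
    have "j \<in> half_set p \<or> j \<in> half_set q" using j(1) False by (auto simp: half_set_def)
    then have "\<not> distinct (half_word p @ half_word q @ pw js)"
      using half_word_meets[OF _ j(2,3), of p] half_word_meets[OF _ j(2,3), of q] by auto
    then show ?thesis by (rule cdet_not_distinct)
  qed
  then show ?thesis using False by simp
qed

text \<open>Mixed terms vanish by repeated letters: a full word of either type meets every pair, and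
  the six pairs in a product of the second and third summands cannot avoid the half word.\<close>

theorem wedge_Re_Phi_basis:
  assumes e: "adapted_basis e" and \<delta>: "cmod \<delta> = 1"
  shows "wedge 8 8 (Re_Phi \<delta>) (Re_Phi \<delta>) e = 294"
proof -
  define a where "a b = (if b then \<delta> / 2 else cnj \<delta> / 2)" for b
  define H :: "((bool \<times> bool) \<times> nat list) set" where "H = UNIV \<times> words 2 {..<8}"
  define hw where "hw t = half_word (fst t) @ pw (snd t)" for t
  let ?k4 = "(\<i> / 2) ^ 4 / 24 :: complex" and ?k2 = "(\<i> / 2) ^ 2 / 4 :: complex"
  define f1 where "f1 = (\<lambda>v. \<Sum>b\<in>UNIV. a b * cdet (holo_word b) v)"
  define f2 where "f2 = (\<lambda>v. \<Sum>js\<in>words 4 {..<8}. ?k4 * cdet (pw js) v)"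
  define f3 where "f3 = (\<lambda>v. \<Sum>t\<in>H. ?k2 * cdet (hw t) v)"
  have Phi: "Re_Phi \<delta> = (\<lambda>v. f1 v + f2 v + f3 v)"
    unfolding Re_Phi_sum f1_def f2_def f3_def a_def H_def hw_def case_prod_unfold ..
  have len: "length (holo_word b) = 8" "js \<in> words 4 {..<8} \<Longrightarrow> length (pw js) = 8" "t \<in> H \<Longrightarrow> length (hw t) = 8" for b js t
    by (auto simp: holo_word_def words_def H_def hw_def half_word_def)
  have holo: "cdet (holo_word b @ xs) e = 0" if js: "js \<in> words (Suc n) {..<8}" and sub: "set (pw js) \<subseteq> set xs" for b xs js n
  proof -
    obtain j where "j < 8" "z j \<in> set (pw js)" "zb j \<in> set (pw js)" using words_memE[OF js] by auto
    then obtain x where "x \<in> set (holo_word b)" "x \<in> set xs" using holo_word_meets[of j xs b] sub by blast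
    then show ?thesis by (rule cdet_common_letter)
  qed
  have comm: "cdet (xs @ ys) e = cdet (ys @ xs) e" if "length ys = 8" for xs ys :: "('e \<Rightarrow> complex) list"
    using cdet_block_move[of ys "[]" xs "[]" e] that by simp
  have w2: "js \<in> words 4 {..<8} \<Longrightarrow> js \<in> words (Suc 3) {..<8}" "ks \<in> words 2 {..<8} \<Longrightarrow> ks \<in> words (Suc 1) {..<8}" for js ks
    by (simp_all add: words_def)
  \<comment> \<open>Two orders of the holomorphic word and its conjugate, each with coefficient
    \<open>\<delta> * cnj \<delta> / 4 = 1 / 4\<close> and value 256.\<close>
  have 11: "wedge 8 8 f1 f1 e = 128"
  proof -
    have same: "cdet (holo_word b @ holo_word b) e = 0" for b
      by (rule cdet_common_letter[of "hd (holo_word b)"]) (auto simp: holo_word_def upt_rec)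
    have "cdet (holo_word True @ holo_word False) e = cdet (pw [0..<8]) e"
    proof -
      \<comment> \<open>28 is even, so interleaving costs no sign.\<close>
      have "(\<Sum>i<8. i) = (28::nat)" by (simp add: eval_nat_numeral)
      then show ?thesis using cdet_interleave[of "[]" z "[0..<8]" zb "[]" e] by (simp add: holo_word_def)
    qed
    also have "\<dots> = 256" using e by (rule cdet_pw_perm) (auto simp: atLeast0LessThan)
    finally have TF: "cdet (holo_word True @ holo_word False) e = 256" .
    have FT: "cdet (holo_word False @ holo_word True) e = 256" by (subst comm[OF len(1)]) (rule TF)
    have "\<delta> * cnj \<delta> = 1" using \<delta> complex_norm_square[of \<delta>] by simp
    then have aa: "a True * a False = 1 / 4" "a False * a True = 1 / 4" by (simp_all add: a_def mult.commute)
    have "wedge 8 8 f1 f1 e = (\<Sum>b\<in>UNIV. \<Sum>b'\<in>UNIV. a b * a b' * cdet (holo_word b @ holo_word b') e)"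
      unfolding f1_def by (subst wedge_word_sums) (auto simp: len)
    then show ?thesis by (simp add: UNIV_bool same TF FT aa)
  qed
  have holo_pw: "cdet (holo_word b @ pw js) e = 0" if "js \<in> words 4 {..<8}" for b js
    using that by (intro holo[of js 3]) (auto simp: words_def)
  have holo_hw: "cdet (holo_word b @ hw t) e = 0" if "t \<in> H" for b t
    using that by (intro holo[of "snd t" 1]) (auto simp: words_def H_def hw_def)
  have pw_holo: "cdet (pw js @ holo_word b) e = 0" if "js \<in> words 4 {..<8}" for b js
    by (subst comm[OF len(1)]) (rule holo_pw[OF that])
  have hw_holo: "cdet (hw t @ holo_word b) e = 0" if "t \<in> H" for b t
    by (subst comm[OF len(1)]) (rule holo_hw[OF that])
  have wl: "length js = 4" if "js \<in> words 4 {..<8}" for js using that by (simp add: words_def)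
  have 12: "wedge 8 8 f1 f2 e = 0" and 21: "wedge 8 8 f2 f1 e = 0"
    unfolding f1_def f2_def by (subst wedge_word_sums; simp add: len wl holo_pw pw_holo)+
  have 13: "wedge 8 8 f1 f3 e = 0" and 31: "wedge 8 8 f3 f1 e = 0"
    unfolding f1_def f3_def by (subst wedge_word_sums; simp add: len holo_hw hw_holo)+
  \<comment> \<open>All eight indices occur once: \<open>8!\<close> words of value 256 with
    coefficient \<open>(1 / 384)\<^sup>2\<close>, that is
    \<open>8! / (4!)\<^sup>2 = 70\<close>.\<close>
  have 22: "wedge 8 8 f2 f2 e = 70"
  proof -
    have "wedge 8 8 f2 f2 e = (\<Sum>js\<in>words 4 {..<8}. \<Sum>ks\<in>words 4 {..<8}. ?k4 * ?k4 * cdet (pw (js @ ks)) e)"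
      unfolding f2_def by (subst wedge_word_sums) (auto simp: wl)
    also have "\<dots> = (\<Sum>js\<in>words (4 + 4) {..<8}. ?k4 * ?k4 * cdet (pw js) e)"
      unfolding sum_words_add ..
    also have "\<dots> = (\<Sum>js\<in>words 8 {..<8}. ?k4 * ?k4 * cdet (pw js) e)" by simp
    also have "\<dots> = fact 8 * (?k4 * ?k4 * 256)"
    proof (rule sum_words_distinct)
      fix js :: "nat list" assume "\<not> distinct js"
      then have "\<not> distinct (pw js)" using distinct_pair_wordD by blast
      then show "?k4 * ?k4 * cdet (pw js) e = 0" by (simp add: cdet_not_distinct)
    next
      fix js assume js: "js \<in> words 8 {..<8}" "distinct js"
      then have "set js = {..<8}" by (intro card_subset_eq) (auto simp: words_def distinct_card)
      then show "?k4 * ?k4 * cdet (pw js) e = ?k4 * ?k4 * 256" using cdet_pw_perm[OF e] js(2) by simp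
    qed auto
    also have "\<dots> = 70" by (simp add: fact_numeral power_divide)
    finally show ?thesis .
  qed
  have nd: "cdet (pw js @ hw t) e = 0" if "js \<in> words 4 {..<8}" "t \<in> H" for js t
  proof -
    have "js @ snd t \<in> words 6 {..<8}" using that by (auto simp: words_def H_def)
    from half_word_long_not_distinct[OF this, of "fst t"]
    have "\<not> distinct (pw js @ hw t)" unfolding hw_def by auto
    then show ?thesis by (rule cdet_not_distinct)
  qed
  have nd': "cdet (hw t @ pw js) e = 0" if "js \<in> words 4 {..<8}" "t \<in> H" for js t
    by (subst comm[OF len(2)[OF that(1)]]) (rule nd[OF that])
  have 23: "wedge 8 8 f2 f3 e = 0" and 32: "wedge 8 8 f3 f2 e = 0"
    unfolding f2_def f3_def by (subst wedge_word_sums; simp add: len wl nd nd')+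
  \<comment> \<open>Each of the four half words has exactly one partner. The coefficient is
    \<open>1 / 256\<close> and the sum over words is \<open>24 * 256\<close>, so each contributes
    24.\<close>
  have 33: "wedge 8 8 f3 f3 e = 96"
  proof -
    have move: "cdet (hw (p, js) @ hw (q, ks)) e = cdet (half_word p @ half_word q @ pw (js @ ks)) e" for p q js ks
      using cdet_block_move[of "half_word q" "half_word p" "pw js" "pw ks" e] by (simp add: hw_def half_word_def)
    have "wedge 8 8 f3 f3 e = (\<Sum>t\<in>H. \<Sum>t'\<in>H. ?k2 * ?k2 * cdet (hw t @ hw t') e)"
      unfolding f3_def by (subst wedge_word_sums) (auto simp: len)
    also have "\<dots> = (\<Sum>p\<in>UNIV. \<Sum>js\<in>words 2 {..<8}. \<Sum>q\<in>UNIV. \<Sum>ks\<in>words 2 {..<8}.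
        ?k2 * ?k2 * cdet (half_word p @ half_word q @ pw (js @ ks)) e)"
      unfolding H_def by (simp only: sum.cartesian_product' move)
    also have "\<dots> = (\<Sum>p\<in>UNIV. \<Sum>q\<in>UNIV. \<Sum>js\<in>words 2 {..<8}. \<Sum>ks\<in>words 2 {..<8}.
        ?k2 * ?k2 * cdet (half_word p @ half_word q @ pw (js @ ks)) e)"
      by (intro sum.cong refl sum.swap)
    also have "\<dots> = (\<Sum>p\<in>UNIV. \<Sum>q\<in>UNIV. ?k2 * ?k2 *
        (\<Sum>js\<in>words (2 + 2) {..<8}. cdet (half_word p @ half_word q @ pw js) e))"
      unfolding sum_words_add sum_distrib_left ..
    also have "\<dots> = (\<Sum>p\<in>(UNIV :: (bool \<times> bool) set). \<Sum>q\<in>(UNIV :: (bool \<times> bool) set). ?k2 * ?k2 * (if q = (\<not> fst p, snd p) then 24 * 256 else 0))"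
      using half_words_sum[OF e] by simp
    also have "\<dots> = (\<Sum>p\<in>(UNIV :: (bool \<times> bool) set). ?k2 * ?k2 * (24 * 256))"
      by (intro sum.cong refl) (simp add: if_distrib[of "(*) _"] cong: if_cong)
    also have "\<dots> = 96"
      by (simp add: power_divide card_UNIV_bool flip: UNIV_Times_UNIV)
    finally show ?thesis .
  qed
  show ?thesis unfolding Phi wedge_add_left wedge_add_right 11 12 13 21 22 23 31 32 33 by simp
qed

end

section \<open>Abstract Hermitian spaces\<close>

lemma wedge_covectors_eq_cdet: "wedge_covectors Z n = cdet (map Z [0..<n])"
proof (induction n)
  case (Suc n)
  have "(\<lambda>v. Z n (v 0)) = cdet [Z n]" by (simp add: fun_eq_iff)
  then show ?case using Suc wedge_cdet[of "map Z [0..<n]" "[Z n]"] by simp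
qed simp

lemma pullback_wedge: "pullback f (wedge k l F G) = wedge k l (pullback f F) (pullback f G)"
  by (simp add: pullback_def wedge_def Alt_def tensor_def fun_eq_iff o_def)

lemma pullback_wedge_power: "pullback f (wedge_power k F n) = wedge_power k (pullback f F) n"
proof (induction n)
  case (Suc n)
  then show ?case by (simp add: pullback_wedge)
qed (simp add: pullback_def)

lemma alt_form_scaleR:
  assumes "alt_form m F"
  shows "F (\<lambda>j. r *\<^sub>R v j) = of_real (r ^ m) * F v"
proof -
  have "F (\<lambda>j. r *\<^sub>R v j) = of_real (Determinant.det (Matrix.mat m m (\<lambda>(i, j). if i = j then r else 0))) * F v"
  proof (rule alt_form_mat_mult[OF assms])
    fix j assume "j < m"
    have "(\<Sum>k<m. (if k = j then r else 0) *\<^sub>R v k) = (\<Sum>k<m. if k = j then r *\<^sub>R v k else 0)"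
      by (intro sum.cong) auto
    then show "r *\<^sub>R v j = (\<Sum>k<m. (if k = j then r else 0) *\<^sub>R v k)" using \<open>j < m\<close> by simp
  qed
  then show ?thesis by (simp add: det_diagonal)
qed

context hermitian_space
begin

lemma H_zero_right: "H x 0 = 0"
  using H_add_right[of x 0 0] by simp

lemma H_minus_right: "H x (- y) = - H x y"
  using H_add_right[of x y "- y"] by (simp add: H_zero_right add_eq_0_iff)

lemma H_diff_right: "H x (y - v) = H x y - H x v"
  using H_add_right[of x y "- v"] by (simp add: H_minus_right)

lemma H_sum_right: "H x (sum f A) = (\<Sum>a\<in>A. H x (f a))"
  by (induction A rule: infinite_finite_induct) (simp_all add: H_zero_right H_add_right)

lemma H_self_eq_0: "H x x = 0 \<Longrightarrow> x = 0"
  using H_pos[of x] by fastforce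

lemma unitary_basisD:
  assumes e: "unitary_basis W d e" and x: "x \<in> W"
  shows "x = (\<Sum>i<d. scaleC (H (e i) x) (e i))" "\<And>i. i < d \<Longrightarrow> coordinate d e i x = H (e i) x"
proof -
  let ?B = "e ` {..<d}"
  have on: "H (e i) (e j) = (if i = j then 1 else 0)" if "i < d" "j < d" for i j
    using e that by (simp add: unitary_basis_def)
  have inj: "inj_on e {..<d}"
  proof (rule inj_onI, rule ccontr)
    fix i j assume "i \<in> {..<d}" "j \<in> {..<d}" "e i = e j" "i \<noteq> j"
    then show False using on[of i j] on[of j j] by simp
  qed
  have lin: "H (e i) (\<Sum>b\<in>?B. scaleC (u b) b) = u (e i)" if "i < d" for i u
  proof -
    have "H (e i) (\<Sum>b\<in>?B. scaleC (u b) b) = (\<Sum>j<d. u (e j) * H (e i) (e j))"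
      by (simp add: sum.reindex[OF inj] H_sum_right H_scale_right)
    also have "\<dots> = (\<Sum>j<d. if j = i then u (e j) else 0)" using that on by (intro sum.cong) auto
    finally show ?thesis using that by simp
  qed
  have "independent ?B"
  proof
    assume "dependent ?B"
    then obtain u where u: "(\<Sum>b\<in>?B. scaleC (u b) b) = 0" "\<exists>b\<in>?B. u b \<noteq> 0"
      by (auto simp: dependent_finite)
    then show False using lin[of _ u] by (auto simp: H_zero_right)
  qed
  moreover have "x \<in> span ?B" using e x by (simp add: unitary_basis_def)
  ultimately have rep: "(\<Sum>b\<in>?B. scaleC (representation ?B x b) b) = x"
    by (intro sum_representation_eq) auto
  show coord: "coordinate d e i x = H (e i) x" if "i < d" for i
    using lin[OF that, of "representation ?B x"] unfolding rep by (simp add: coordinate_def)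
  have "x = (\<Sum>i<d. scaleC (representation ?B x (e i)) (e i))"
    by (subst rep[symmetric]) (simp add: sum.reindex[OF inj])
  also have "\<dots> = (\<Sum>i<d. scaleC (H (e i) x) (e i))"
    using coord by (intro sum.cong) (auto simp: coordinate_def)
  finally show "x = (\<Sum>i<d. scaleC (H (e i) x) (e i))" .
qed

lemma unitary_basis_mem: "unitary_basis W d e \<Longrightarrow> i < d \<Longrightarrow> e i \<in> W"
  by (auto simp: unitary_basis_def intro: span_base)

text \<open>On \<open>W\<close> the coordinates of a unitary basis are the functionals
  \<open>H (e i)\<close>, which make sense on the whole space.\<close>

lemma holomorphic_volume_form_cdet:
  assumes "holomorphic_volume_form W d \<Omega>"
  obtains e where "unitary_basis W d e"
    "\<And>v. (\<And>i. i < d \<Longrightarrow> v i \<in> W) \<Longrightarrow> \<Omega> v = cdet (map (\<lambda>i. H (e i)) [0..<d]) v"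
proof -
  obtain e where e: "unitary_basis W d e"
    "\<And>v. (\<forall>i<d. v i \<in> W) \<Longrightarrow> \<Omega> v = wedge_covectors (coordinate d e) d v"
    using assms by (auto simp: holomorphic_volume_form_def)
  have "\<Omega> v = cdet (map (\<lambda>i. H (e i)) [0..<d]) v" if "\<And>i. i < d \<Longrightarrow> v i \<in> W" for v
  proof -
    have "Matrix.mat d d (\<lambda>(i, j). (map (coordinate d e) [0..<d] ! i) (v j)) =
        Matrix.mat d d (\<lambda>(i, j). (map (\<lambda>i. H (e i)) [0..<d] ! i) (v j))"
      by (rule eq_matI) (auto simp: unitary_basisD(2)[OF e(1) that])
    then show ?thesis using e(2)[of v] that by (simp add: wedge_covectors_eq_cdet cdet_def)
  qed
  then show ?thesis using e(1) by (intro that[of e]) auto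
qed

text \<open>Two candidates differ by a vector of \<open>W\<close> that is orthogonal to itself, so
  positivity makes the description unique.\<close>

lemma orth_proj:
  assumes "subspace W" "y \<in> W" "\<And>w. w \<in> W \<Longrightarrow> H w (x - y) = 0"
  shows "orth_proj W x = y"
  unfolding orth_proj_def
proof (rule the_equality)
  fix y' assume y': "y' \<in> W \<and> (\<forall>w\<in>W. H w (x - y') = 0)"
  have "H (y' - y) (y' - y) = H (y' - y) ((x - y) - (x - y'))" by simp
  also have "\<dots> = 0" unfolding H_diff_right[of _ "x - y"]
    using assms y' subspace_diff[OF assms(1), of y' y] by simp
  finally show "y' = y" using H_self_eq_0[of "y' - y"] by simp
qed (use assms in auto)

lemma orthogonal_decomposition_swap:
  assumes "orthogonal_decomposition X Y"
  shows "orthogonal_decomposition Y X"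
proof -
  have "H y x = 0" if "x \<in> X" "y \<in> Y" for x y
    using assms that H_commute[of y x] by (simp add: orthogonal_decomposition_def)
  moreover have "{x + y |x y. x \<in> Y \<and> y \<in> X} = UNIV"
    using assms unfolding orthogonal_decomposition_def by (auto simp: set_eq_iff) (metis add.commute)
  ultimately show ?thesis using assms by (simp add: orthogonal_decomposition_def)
qed

lemma orth_proj_decomposition:
  assumes "orthogonal_decomposition X Y"
  shows "orth_proj X x \<in> X" "w \<in> X \<Longrightarrow> H w (orth_proj X x) = H w x"
proof -
  have "x \<in> {x + y |x y. x \<in> X \<and> y \<in> Y}" using assms by (simp add: orthogonal_decomposition_def)
  then obtain a b where ab: "x = a + b" "a \<in> X" "b \<in> Y" by auto
  have "H w b = 0" if "w \<in> X" for w using assms that ab by (simp add: orthogonal_decomposition_def)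
  moreover from this have "orth_proj X x = a"
    using assms ab by (intro orth_proj) (auto simp: orthogonal_decomposition_def)
  ultimately show "orth_proj X x \<in> X" "w \<in> X \<Longrightarrow> H w (orth_proj X x) = H w x"
    using ab by (simp_all add: H_add_right)
qed

text \<open>\<open>H (e i)\<close> does not see the component orthogonal to \<open>X\<close>, so
  projecting first leaves the determinant of these functionals unchanged on the whole space.\<close>

lemma pullback_volume_form:
  assumes "orthogonal_decomposition X Y" "holomorphic_volume_form X d \<Omega>"
  obtains e where "unitary_basis X d e"
    "pullback (orth_proj X) \<Omega> = cdet (map (\<lambda>i. H (e i)) [0..<d])"
proof -
  obtain e where e: "unitary_basis X d e"
    "\<And>v. (\<And>i. i < d \<Longrightarrow> v i \<in> X) \<Longrightarrow> \<Omega> v = cdet (map (\<lambda>i. H (e i)) [0..<d]) v"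
    using holomorphic_volume_form_cdet[OF assms(2)] by blast
  have "pullback (orth_proj X) \<Omega> v = cdet (map (\<lambda>i. H (e i)) [0..<d]) v" for v
  proof -
    have "Matrix.mat d d (\<lambda>(i, j). (map (\<lambda>i. H (e i)) [0..<d] ! i) (orth_proj X (v j))) =
        Matrix.mat d d (\<lambda>(i, j). (map (\<lambda>i. H (e i)) [0..<d] ! i) (v j))"
      using orth_proj_decomposition(2)[OF assms(1) unitary_basis_mem[OF e(1)]] by (intro eq_matI) auto
    then show ?thesis
      using e(2)[of "orth_proj X \<circ> v"] orth_proj_decomposition(1)[OF assms(1)] by (simp add: pullback_def cdet_def)
  qed
  then show ?thesis using e(1) by (intro that[of e]) auto
qed

text \<open>For the second claim, \<open>y\<close> is split along the decomposition and each part
  expanded in its own basis. This Parseval form is what \<open>unitary_coordinates\<close> and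
  \<open>volume_form_phase\<close> ask for.\<close>

lemma unitary_basis_direct_sum:
  assumes dec: "orthogonal_decomposition X Y" and e: "unitary_basis X 4 e" and e': "unitary_basis Y 4 e'"
  defines "f \<equiv> \<lambda>i. if i < 4 then e i else e' (i - 4)"
  shows "\<And>i j. i < 8 \<Longrightarrow> j < 8 \<Longrightarrow> H (f i) (f j) = (if i = j then 1 else 0)"
    and "\<And>x y. H x y = (\<Sum>i<8. cnj (H (f i) x) * H (f i) y)"
proof -
  have XY: "H x y = 0" "H y x = 0" if "x \<in> X" "y \<in> Y" for x y
    using dec orthogonal_decomposition_swap[OF dec] that by (simp_all add: orthogonal_decomposition_def)
  have eX: "e i \<in> X" "e' i \<in> Y" if "i < 4" for i
    using unitary_basis_mem[OF e that] unitary_basis_mem[OF e' that] by auto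
  show "H (f i) (f j) = (if i = j then 1 else 0)" if "i < 8" "j < 8" for i j
    using that e e' XY eX by (auto simp: f_def unitary_basis_def)
  show "H x y = (\<Sum>i<8. cnj (H (f i) x) * H (f i) y)" for x y
  proof -
    have "y \<in> {x + y |x y. x \<in> X \<and> y \<in> Y}" using dec by (simp add: orthogonal_decomposition_def)
    then obtain a b where ab: "y = a + b" "a \<in> X" "b \<in> Y" by auto
    have a: "H (e i) y = H (e i) a" "H (e' i) y = H (e' i) b" if "i < 4" for i
      using XY eX[OF that] ab by (simp_all add: H_add_right)
    have "(\<Sum>i<4. scaleC (H (e i) y) (e i)) = (\<Sum>i<4. scaleC (H (e i) a) (e i))"
      by (intro sum.cong) (simp_all add: a)
    also have "\<dots> = a" by (rule unitary_basisD(1)[OF e ab(2), symmetric])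
    finally have ya: "(\<Sum>i<4. scaleC (H (e i) y) (e i)) = a" .
    have "(\<Sum>i<4. scaleC (H (e' i) y) (e' i)) = (\<Sum>i<4. scaleC (H (e' i) b) (e' i))"
      by (intro sum.cong) (simp_all add: a)
    also have "\<dots> = b" by (rule unitary_basisD(1)[OF e' ab(3), symmetric])
    finally have "y = (\<Sum>i<4. scaleC (H (e i) y) (e i)) + (\<Sum>i<4. scaleC (H (e' i) y) (e' i))"
      using ya ab(1) by simp
    then have "H x y = H x ((\<Sum>i<4. scaleC (H (e i) y) (e i)) + (\<Sum>i<4. scaleC (H (e' i) y) (e' i)))" by simp
    also have "\<dots> = (\<Sum>i<4. H (e i) y * H x (e i)) + (\<Sum>i<4. H (e' i) y * H x (e' i))"
      by (simp add: H_add_right H_sum_right H_scale_right)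
    also have "\<dots> = (\<Sum>i<4. cnj (H (f i) x) * H (f i) y) + (\<Sum>i<4. cnj (H (f (i + 4)) x) * H (f (i + 4)) y)"
      unfolding f_def by (intro arg_cong2[where f = "(+)"] sum.cong) (simp_all add: H_commute[of x] mult.commute)
    also have "(\<Sum>i<4. cnj (H (f (i + 4)) x) * H (f (i + 4)) y) = (\<Sum>i\<in>{4..<8}. cnj (H (f i) x) * H (f i) y)"
      using sum.shift_bounds_nat_ivl[of "\<lambda>i. cnj (H (f i) x) * H (f i) y" 0 4 4] by (simp add: atLeast0LessThan)
    also have "(\<Sum>i<4. cnj (H (f i) x) * H (f i) y) + (\<Sum>i\<in>{4..<8}. cnj (H (f i) x) * H (f i) y) = (\<Sum>i<8. cnj (H (f i) x) * H (f i) y)"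
      using sum.atLeastLessThan_concat[of 0 4 8 "\<lambda>i. cnj (H (f i) x) * H (f i) y"] by (simp add: atLeast0LessThan)
    finally show ?thesis .
  qed
qed

text \<open>The two determinants differ by the transition determinant. Evaluating at
  \<open>e\<close>, where the left side is 1, gives that scalar times its conjugate, so its modulus
  is 1.\<close>

lemma volume_form_phase:
  assumes e: "\<And>i j. i < n \<Longrightarrow> j < n \<Longrightarrow> H (e i) (e j) = (if i = j then 1 else 0)"
    and f: "\<And>x y. H x y = (\<Sum>k<n. cnj (H (f k) x) * H (f k) y)"
  obtains \<delta> where "cmod \<delta> = 1"
    "\<And>v. cdet (map (\<lambda>i. H (e i)) [0..<n]) v = \<delta> * cdet (map (\<lambda>i. H (f i)) [0..<n]) v"
proof -
  define fs where "fs = map (\<lambda>i. H (f i)) [0..<n]"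
  define es where "es = map (\<lambda>i. H (e i)) [0..<n]"
  have len: "length es = length fs" "length fs = n" by (simp_all add: es_def fs_def)
  have eq: "cdet es v = cnj (cdet fs e) * cdet fs v" for v
  proof -
    have "cdet es v = Determinant.det (Matrix.mat (length fs) (length fs) (\<lambda>(i, j). cnj ((fs ! j) (e i)))) * cdet fs v"
    proof (rule cdet_lincomb[where N = "\<lambda>i k. cnj ((fs ! k) (e i))", OF len(1)])
      fix i j assume "i < length fs" "j < length fs"
      then have "(es ! i) (v j) = H (e i) (v j)" by (simp add: es_def len)
      also have "\<dots> = (\<Sum>k<n. cnj (H (f k) (e i)) * H (f k) (v j))" by (rule f)
      also have "\<dots> = (\<Sum>k<length fs. cnj ((fs ! k) (e i)) * (fs ! k) (v j))"
        unfolding len(2) by (intro sum.cong) (simp_all add: fs_def)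
      finally show "(es ! i) (v j) = (\<Sum>k<length fs. cnj ((fs ! k) (e i)) * (fs ! k) (v j))" .
    qed
    then show ?thesis unfolding det_conj_transpose .
  qed
  have "cdet es e = 1" by (rule cdet_dual_basis) (simp add: es_def e)
  then have "cnj (cdet fs e) * cdet fs e = 1" using eq[of e] by simp
  then have "cmod (cnj (cdet fs e) * cdet fs e) = 1" by (simp only: norm_one)
  then have "(cmod (cnj (cdet fs e)))\<^sup>2 = 1\<^sup>2" by (simp add: norm_mult power2_eq_square)
  then have "cmod (cnj (cdet fs e)) = 1" by (rule power2_eq_imp_eq) auto
  then show ?thesis using eq unfolding es_def fs_def by (intro that)
qed

end

context unitary_coordinates
begin

lemma alt_form_Re_Phi: "alt_form 8 (Re_Phi \<delta>)"
proof -
  have "alt_form 8 (\<lambda>v. 1 / 2 * Phi \<delta> v + 1 / 2 * cnj (Phi \<delta> v))"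
    by (intro alt_form_add alt_form_scale alt_form_cnj alt_form_Phi)
  moreover have "(\<lambda>v. 1 / 2 * Phi \<delta> v + 1 / 2 * cnj (Phi \<delta> v)) = Re_Phi \<delta>"
    by (simp add: Re_Phi_def of_real_Re fun_eq_iff)
  ultimately show ?thesis by simp
qed

theorem comass_wedge_Re_Phi_ge:
  assumes \<delta>: "cmod \<delta> = 1"
  shows "294 / 256 \<le> comass 16 (wedge 8 8 (pullback fst (\<lambda>v. Re (Phi \<delta> v))) (pullback snd (\<lambda>v. Re (Phi \<delta> v))))"
proof -
  let ?F = "wedge 8 8 (pullback fst (Re_Phi \<delta>)) (pullback snd (Re_Phi \<delta>)) :: ('e \<times> 'e, complex) form"
  let ?G = "wedge 8 8 (pullback fst (\<lambda>v. Re (Phi \<delta> v))) (pullback snd (\<lambda>v. Re (Phi \<delta> v))) :: ('e \<times> 'e, real) form"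
  have FG: "?F v = of_real (?G v)" for v
    unfolding of_real_wedge by (simp add: pullback_def Re_Phi_def)
  have "alt_form (8 + 8) ?F"
    by (intro alt_form_wedge alt_form_pullback alt_form_Re_Phi linear_fst linear_snd)
  from bdd_above_alt_form[OF this] have bdd: "bdd_above {?G v |v. simple_norm 16 v = 1}"
    unfolding FG by simp
  obtain e where e: "adapted_basis e" using exists_adapted_basis by blast
  \<comment> \<open>With this \<open>r\<close> the diagonal map
    \<open>x \<mapsto> (r x, r x)\<close> is isometric, so it carries the adapted basis to an
    admissible tuple; each factor of degree 8 scales by \<open>r ^ 8 = 1 / 16\<close>.\<close>
  define r :: real where "r = 1 / sqrt 2"
  have r: "r * r = 1 / 2" "r ^ 8 = 1 / 16"
  proof -
    show rr: "r * r = 1 / 2" by (simp add: r_def)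
    have "r ^ 8 = (r * r) ^ 4" by (simp add: power_mult[symmetric] flip: power2_eq_square)
    then show "r ^ 8 = 1 / 16" unfolding rr by (simp add: power_divide)
  qed
  define \<Delta> where "\<Delta> x = (r *\<^sub>R x, r *\<^sub>R x)" for x :: 'e
  have "simple_norm 16 (\<Delta> \<circ> e) = 1"
  proof (rule simple_norm_orthonormal)
    fix i j :: nat assume "i < 16" "j < 16"
    then show "(\<Delta> \<circ> e) i \<bullet> (\<Delta> \<circ> e) j = (if i = j then 1 else 0)"
      using adapted_basis_orthonormal[OF e, of i j] r(1) by (simp add: \<Delta>_def mult.assoc[symmetric])
  qed
  then have "?G (\<Delta> \<circ> e) \<le> comass 16 ?G"
    unfolding comass_def by (intro cSup_upper[OF _ bdd]) blast
  moreover have "?G (\<Delta> \<circ> e) = 294 / 256"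
  proof -
    have scale: "pullback \<Delta> (pullback fst (Re_Phi \<delta>)) = (\<lambda>v. 1 / 16 * Re_Phi \<delta> v)"
      "pullback \<Delta> (pullback snd (Re_Phi \<delta>)) = (\<lambda>v. 1 / 16 * Re_Phi \<delta> v)"
      using alt_form_scaleR[OF alt_form_Re_Phi, of \<delta> r] r(2)
      by (simp_all add: fun_eq_iff pullback_def \<Delta>_def o_def)
    have "of_real (?G (\<Delta> \<circ> e)) = pullback \<Delta> ?F e" unfolding FG[symmetric] by (simp add: pullback_def)
    also have "\<dots> = 1 / 16 * (1 / 16 * wedge 8 8 (Re_Phi \<delta>) (Re_Phi \<delta>) e)"
      unfolding pullback_wedge scale wedge_scale_left wedge_scale_right ..
    also have "\<dots> = of_real (294 / 256)" unfolding wedge_Re_Phi_basis[OF e \<delta>] by simp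
    finally show ?thesis unfolding of_real_eq_iff .
  qed
  ultimately show ?thesis by simp
qed

end

lemma pullback_cdet: "pullback g (cdet zs) = cdet (map (\<lambda>z. z \<circ> g) zs)"
  by (simp add: pullback_def cdet_perm_sum fun_eq_iff)

theorem corollary1p4:
  fixes scaleC :: "complex \<Rightarrow> 'a::ab_group_add \<Rightarrow> 'a"
    and H :: "'a \<Rightarrow> 'a \<Rightarrow> complex"
    and X\<^sub>1 X\<^sub>2 :: "'a set"
    and \<omega> \<Phi> :: "('a, real) form"
    and \<Omega> \<Omega>\<^sub>1 \<Omega>\<^sub>2 :: "('a, complex) form"
    and \<iota> :: "real ^ 16 \<Rightarrow> 'a"
    and \<Phi>\<^sub>1 \<Phi>\<^sub>2 :: "((real ^ 16) \<times> (real ^ 16), real) form"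
  assumes "hermitian_space scaleC H"
    and "vector_space.dim scaleC (UNIV :: 'a set) = 8"
    and "\<omega> = hermitian_space.kaehler_form H"
    and "hermitian_space.holomorphic_volume_form scaleC H UNIV 8 \<Omega>"
    and "hermitian_space.orthogonal_decomposition scaleC H X\<^sub>1 X\<^sub>2"
    and "vector_space.dim scaleC X\<^sub>1 = 4" and "vector_space.dim scaleC X\<^sub>2 = 4"
    and "hermitian_space.holomorphic_volume_form scaleC H X\<^sub>1 4 \<Omega>\<^sub>1"
    and "hermitian_space.holomorphic_volume_form scaleC H X\<^sub>2 4 \<Omega>\<^sub>2"
    and "\<Phi> = (\<lambda>v. Re (\<Omega> v) + 1 / fact 4 * wedge_power 2 \<omega> 4 v
            + wedge 4 4
                (\<lambda>u. Re (pullback (hermitian_space.orth_proj H X\<^sub>1) \<Omega>\<^sub>1 u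
                       + pullback (hermitian_space.orth_proj H X\<^sub>2) \<Omega>\<^sub>2 u))
                (\<lambda>u. 1 / 2 * wedge_power 2 \<omega> 2 u) v)"
    and "hermitian_space.euclidean_identification scaleC H \<iota>"
    and "\<Phi>\<^sub>1 = pullback fst (pullback \<iota> \<Phi>)"
    and "\<Phi>\<^sub>2 = pullback snd (pullback \<iota> \<Phi>)"
  shows "comass 16 (wedge 8 8 \<Phi>\<^sub>1 \<Phi>\<^sub>2) \<ge> 294 / 256 \<and> 294 / 256 > (1 :: real)
       \<and> 1 = comass 8 \<Phi>\<^sub>1 * comass 8 \<Phi>\<^sub>2"
proof -
  interpret hermitian_space scaleC H by (rule assms(1))
  obtain e1 where e1: "unitary_basis X\<^sub>1 4 e1" "pullback (orth_proj X\<^sub>1) \<Omega>\<^sub>1 = cdet (map (\<lambda>i. H (e1 i)) [0..<4])"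
    by (rule pullback_volume_form[OF assms(5,8)])
  obtain e2 where e2: "unitary_basis X\<^sub>2 4 e2" "pullback (orth_proj X\<^sub>2) \<Omega>\<^sub>2 = cdet (map (\<lambda>i. H (e2 i)) [0..<4])"
    by (rule pullback_volume_form[OF orthogonal_decomposition_swap[OF assms(5)] assms(9)])
  obtain e where e: "unitary_basis UNIV 8 e" "\<And>v. \<Omega> v = cdet (map (\<lambda>i. H (e i)) [0..<8]) v"
    by (rule holomorphic_volume_form_cdet[OF assms(4)]) simp
  \<comment> \<open>A unitary basis adapted to both summands. Its coordinates represent
    \<open>\<Omega>\<^sub>1\<close> and \<open>\<Omega>\<^sub>2\<close> exactly, while the basis
    behind \<open>\<Omega>\<close> is unrelated to the decomposition; the phase
    \<open>\<delta>\<close> is the only trace of this.\<close>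
  define f where "f i = (if i < 4 then e1 i else e2 (i - 4))" for i
  have on: "H (f i) (f j) = (if i = j then 1 else 0)" if "i < 8" "j < 8" for i j
    using unitary_basis_direct_sum(1)[OF assms(5) e1(1) e2(1) that] by (simp add: f_def)
  have exp: "H x y = (\<Sum>k<8. cnj (H (f k) x) * H (f k) y)" for x y
    using unitary_basis_direct_sum(2)[OF assms(5) e1(1) e2(1), of x y] by (simp add: f_def)
  have one: "H (e i) (e j) = (if i = j then 1 else 0)" if "i < 8" "j < 8" for i j
    using e(1) that by (simp add: unitary_basis_def)
  obtain \<delta> where \<delta>: "cmod \<delta> = 1"
      "\<And>v. cdet (map (\<lambda>i. H (e i)) [0..<8]) v = \<delta> * cdet (map (\<lambda>i. H (f i)) [0..<8]) v"
    by (rule volume_form_phase[of 8 e f], erule (1) one, rule exp, rule that)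
  have lin: "Vector_Spaces.linear scaleR (\<lambda>r. scaleC (complex_of_real r)) \<iota>" and bij: "bij \<iota>"
    and inner: "\<And>x y. Re (H (\<iota> x) (\<iota> y)) = x \<bullet> y"
    using assms(11) by (simp_all add: euclidean_identification_def euclidean_inner_def)
  interpret \<iota>: Vector_Spaces.linear scaleR "\<lambda>r. scaleC (complex_of_real r)" \<iota> by (rule lin)
  \<comment> \<open>Complex coordinates on \<open>real ^ 16\<close>, where the comass lives; they
    express its inner product because \<open>\<iota>\<close> is isometric.\<close>
  define z where "z i = H (f i) \<circ> \<iota>" for i
  interpret U: unitary_coordinates z
  proof
    show "z i (x + y) = z i x + z i y" and "z i (r *\<^sub>R x) = r *\<^sub>R z i x" for i r x y
      by (simp_all add: z_def \<iota>.add \<iota>.scale H_add_right H_scale_right scaleR_conv_of_real[of _ "H _ _"])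
    show "x \<bullet> y = (\<Sum>i<8. Re (cnj (z i x) * z i y))" for x y
      unfolding inner[symmetric] exp[of "\<iota> x"] z_def by simp
    show "\<exists>x. \<forall>i<8. z i x = c i" for c
    proof -
      define y where "y = (\<Sum>k<8. scaleC (c k) (f k))"
      obtain x where x: "\<iota> x = y" using bij by (metis bij_pointE)
      have "H (f i) y = c i" if "i < 8" for i
      proof -
        have "H (f i) y = (\<Sum>k<8. c k * H (f i) (f k))" by (simp add: y_def H_sum_right H_scale_right)
        also have "\<dots> = (\<Sum>k<8. if k = i then c k else 0)" using on that by (intro sum.cong) auto
        finally show ?thesis using that by simp
      qed
      then show ?thesis using x by (intro exI[of _ x]) (simp add: z_def)
    qed
  qed
  have h: "U.h x y = H (\<iota> x) (\<iota> y)" for x y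
    unfolding U.h_def exp[of "\<iota> x"] by (simp add: z_def)
  have kaehler: "pullback \<iota> \<omega> = U.kaehler"
    by (simp add: assms(3) kaehler_form_def U.kaehler_def h pullback_def fun_eq_iff)
  have vol: "pullback \<iota> \<Omega> = (\<lambda>v. \<delta> * cdet (map z [0..<8]) v)"
  proof
    fix v
    have "pullback \<iota> \<Omega> v = \<delta> * pullback \<iota> (cdet (map (\<lambda>i. H (f i)) [0..<8])) v"
      by (simp add: pullback_def e(2) \<delta>(2))
    then show "pullback \<iota> \<Omega> v = \<delta> * cdet (map z [0..<8]) v"
      by (simp add: pullback_cdet z_def[abs_def] o_def)
  qed
  have vol1: "pullback \<iota> (pullback (orth_proj X\<^sub>1) \<Omega>\<^sub>1) = cdet (map z [0..<4])"
  proof -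
    have "map (\<lambda>z. z \<circ> \<iota>) (map (\<lambda>i. H (e1 i)) [0..<4]) = map z [0..<4]"
      by (rule nth_equalityI) (simp_all add: z_def f_def)
    then show ?thesis unfolding e1(2) pullback_cdet by (rule arg_cong)
  qed
  have vol2: "pullback \<iota> (pullback (orth_proj X\<^sub>2) \<Omega>\<^sub>2) = cdet (map z [4..<8])"
  proof -
    have "map (\<lambda>z. z \<circ> \<iota>) (map (\<lambda>i. H (e2 i)) [0..<4]) = map z [4..<8]"
      by (rule nth_equalityI) (simp_all add: z_def f_def)
    then show ?thesis unfolding e2(2) pullback_cdet by (rule arg_cong)
  qed
  have chi: "pullback \<iota> (\<lambda>u. Re (pullback (orth_proj X\<^sub>1) \<Omega>\<^sub>1 u + pullback (orth_proj X\<^sub>2) \<Omega>\<^sub>2 u)) = (\<lambda>u. Re (U.chi u))"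
    unfolding U.chi_def vol1[symmetric] vol2[symmetric] by (simp add: pullback_def)
  have square: "pullback \<iota> (\<lambda>u. 1 / 2 * wedge_power 2 \<omega> 2 u) = (\<lambda>u. 1 / 2 * wedge_power 2 U.kaehler 2 u)"
    unfolding kaehler[symmetric] pullback_wedge_power[symmetric] by (simp add: pullback_def)
  have \<Phi>: "pullback \<iota> \<Phi> = (\<lambda>v. Re (U.Phi \<delta> v))"
  proof
    fix v
    have "pullback \<iota> \<Phi> v = Re (pullback \<iota> \<Omega> v) + 1 / fact 4 * pullback \<iota> (wedge_power 2 \<omega> 4) v
        + pullback \<iota> (wedge 4 4
            (\<lambda>u. Re (pullback (orth_proj X\<^sub>1) \<Omega>\<^sub>1 u + pullback (orth_proj X\<^sub>2) \<Omega>\<^sub>2 u))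
            (\<lambda>u. 1 / 2 * wedge_power 2 \<omega> 2 u)) v"
      unfolding assms(10) pullback_def ..
    also have "\<dots> = Re (\<delta> * cdet (map z [0..<8]) v) + 1 / 24 * wedge_power 2 U.kaehler 4 v
        + wedge 4 4 (\<lambda>u. Re (U.chi u)) (\<lambda>u. 1 / 2 * wedge_power 2 U.kaehler 2 u) v"
      unfolding pullback_wedge pullback_wedge_power vol kaehler chi square by (simp add: fact_numeral)
    also have "\<dots> = Re (U.Phi \<delta> v)"
      unfolding U.Phi_def plus_complex.sel Re_wedge_of_real Re_complex_of_real ..
    finally show "pullback \<iota> \<Phi> v = Re (U.Phi \<delta> v)" .
  qed
  have le: "norm (fst p) \<le> norm p" "norm (snd p) \<le> norm p" for p :: "(real ^ 16) \<times> (real ^ 16)"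
    using norm_fst_le[of "fst p" "snd p"] norm_snd_le[of "snd p" "fst p"] by simp_all
  have "comass 8 \<Phi>\<^sub>1 = 1"
    unfolding assms(12) \<Phi> unfolding pullback_def
    by (rule U.comass_pullback_Phi[of fst \<delta> "\<lambda>x. (x, 0)"]) (simp_all add: linear_fst le \<delta>(1))
  moreover have "comass 8 \<Phi>\<^sub>2 = 1"
    unfolding assms(13) \<Phi> unfolding pullback_def
    by (rule U.comass_pullback_Phi[of snd \<delta> "\<lambda>x. (0, x)"]) (simp_all add: linear_snd le \<delta>(1))
  moreover have "294 / 256 \<le> comass 16 (wedge 8 8 \<Phi>\<^sub>1 \<Phi>\<^sub>2)"
    unfolding assms(12,13) \<Phi> by (rule U.comass_wedge_Re_Phi_ge[OF \<delta>(1)])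
  ultimately show ?thesis by simp
qed

end
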